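(* Let $N=(N_t)_{t\in[0,T]}$ be a Poisson process with intensity $\lambda>0$, let $\tilde N_t=N_t-\lambda t$, and let $D_{\tilde N}$ be the operator--covariant derivative of $\tilde N$. For every $\mathcal{F}_T^N$-measurable $F\in L^2(\Omega)$, $$(D_{\tilde N}F)_t=\mathbb{E}[\mathcal{D}_t^+F\mid\mathcal{F}_{t-}]\qquad dt\otimes dP\text{-a.e.},$$ where $\mathcal{D}_t^+$ is the add-a-point operator $(\mathcal{D}_t^+G)(\omega)=G(\omega+\varepsilon_t)-G(\omega)$. In particular, $D_{\tilde N}F$ is the predictable projection of the discrete gradient $(\mathcal{D}_t^+F)_{t\in[0,T]}$.
   Context: $(\Omega,\mathcal{F},P)$ is a complete probability space. $(\mathcal{F}_t^N)_{t\in[0,T]}$ is the natural filtration of $N$, augmented to satisfy the usual conditions, written $(\mathcal{F}_t)$; $\mathcal{F}_{t-}=\sigma\bigl(\bigcup_{s<t}\mathcal{F}_s\bigr)$. "Predictable" refers to this filtration. The energy space is the real Hilbert space $\mathcal{H}_{\tilde N}$ of (equivalence classes of) predictable processes $u=(u_t)_{t\in[0,T]}$ with $\|u\|_{\mathcal{H}_{\tilde N}}^2:=\lambda\,\mathbb{E}\bigl[\int_0^T|u_t|^2\,dt\bigr]<\infty$, with inner product $\langle g,u\rangle_{\mathcal{H}_{\tilde N}}=\lambda\,\mathbb{E}\bigl[\int_0^Tg_tu_t\,dt\bigr]$. The stochastic integral is $\delta_{\tilde N}(u)=\int_0^Tu_t\,d\tilde N_t$, which maps $\mathcal{H}_{\tilde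 N}$ isometrically into $L^2(\Omega)$. The operator--covariant derivative $D_{\tilde N}\colon L^2(\Omega)\to\mathcal{H}_{\tilde N}$ is the Hilbert space adjoint of $\delta_{\tilde N}$: $D_{\tilde N}F$ is the unique element of $\mathcal{H}_{\tilde N}$ with $\mathbb{E}[F\,\delta_{\tilde N}(u)]=\langle D_{\tilde N}F,u\rangle_{\mathcal{H}_{\tilde N}}$ for all $u\in\mathcal{H}_{\tilde N}$. Each sample path $\omega$ of the Poisson process is identified with its set of jump times $\{T_1,T_2,\ldots\}\subset[0,T]$, so that an $\mathcal{F}_T^N$-measurable random variable is regarded as a function of this configuration; $\omega+\varepsilon_t$ denotes the configuration obtained from $\omega$ by adding one jump at time $t$. *)

theory Defs
  imports "HOL-Probability.Probability"
begin

text \<open>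
  Processes are curried, \<open>u :: real \<Rightarrow> 'a \<Rightarrow> real\<close>, and only their values at times in
  \<open>{0..T}\<close> matter.
\<close>

section \<open>The Poisson process and its filtration\<close>

text \<open>
  \<open>poisson_pmf r\<close> is only specified for \<open>r > 0\<close>, so the definition is meant for \<open>lam > 0\<close>.
  Subtraction on \<open>nat\<close> does not truncate here, because the paths are nondecreasing. That the
  jumps have size one almost surely is a consequence and is not assumed.
\<close>

definition poisson_process :: "'a measure \<Rightarrow> real \<Rightarrow> real \<Rightarrow> (real \<Rightarrow> 'a \<Rightarrow> nat) \<Rightarrow> bool" where
  "poisson_process M lam T N \<longleftrightarrow>
     (\<forall>t\<in>{0..T}. N t \<in> measurable M (count_space UNIV)) \<and>
     (\<forall>\<omega>\<in>space M. N 0 \<omega> = 0 \<and> mono_on {0..T} (\<lambda>t. N t \<omega>) \<and>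
        (\<forall>t\<in>{0..<T}. ((\<lambda>s. real (N s \<omega>)) \<longlongrightarrow> real (N t \<omega>)) (at_right t))) \<and>
     (\<forall>s t. 0 \<le> s \<longrightarrow> s < t \<longrightarrow> t \<le> T \<longrightarrow>
        distr M (count_space UNIV) (\<lambda>\<omega>. N t \<omega> - N s \<omega>)
          = measure_pmf (poisson_pmf (lam * (t - s)))) \<and>
     (\<forall>n (ts :: nat \<Rightarrow> real).
        0 \<le> ts 0 \<longrightarrow> (\<forall>i<n. ts i < ts (Suc i)) \<longrightarrow> ts n \<le> T \<longrightarrow>
        prob_space.indep_vars M (\<lambda>_. count_space UNIV)
          (\<lambda>i \<omega>. N (ts (Suc i)) \<omega> - N (ts i) \<omega>) {..<n})"

definition compensated :: "real \<Rightarrow> (real \<Rightarrow> 'a \<Rightarrow> nat) \<Rightarrow> real \<Rightarrow> 'a \<Rightarrow> real" where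
  "compensated lam N t \<omega> = real (N t \<omega>) - lam * t"

definition null_augmented :: "'a measure \<Rightarrow> (real \<Rightarrow> 'a \<Rightarrow> nat) \<Rightarrow> real \<Rightarrow> 'a measure" where
  "null_augmented M N t =
     sigma (space M) ({N s -` B \<inter> space M | s B. s \<in> {0..t}} \<union> null_sets M)"

text \<open>
  The usual augmentation: the natural filtration with the null sets adjoined, made
  right-continuous. At \<open>t = T\<close> the intersection reduces to \<open>null_augmented M N T\<close>.
\<close>

definition filt :: "'a measure \<Rightarrow> real \<Rightarrow> (real \<Rightarrow> 'a \<Rightarrow> nat) \<Rightarrow> real \<Rightarrow> 'a measure" where
  "filt M T N t = sigma (space M) (\<Inter>s\<in>{t<..}. sets (null_augmented M N (min s T)))"

definition filt_left :: "'a measure \<Rightarrow> real \<Rightarrow> (real \<Rightarrow> 'a \<Rightarrow> nat) \<Rightarrow> real \<Rightarrow> 'a measure" where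
  "filt_left M T N t = sigma (space M) (\<Union>s\<in>{0..<t}. sets (filt M T N s))"

definition time_measure :: "real \<Rightarrow> real measure" where
  "time_measure T = restrict_space lborel {0..T}"

definition predictable_sigma ::
  "'a measure \<Rightarrow> real \<Rightarrow> (real \<Rightarrow> 'a \<Rightarrow> nat) \<Rightarrow> (real \<times> 'a) measure" where
  "predictable_sigma M T N = sigma ({0..T} \<times> space M)
     ({{0} \<times> A | A. A \<in> sets (filt M T N 0)} \<union>
      {{s<..t} \<times> A | s t A. 0 \<le> s \<and> s \<le> t \<and> t \<le> T \<and> A \<in> sets (filt M T N s)})"

definition predictable ::
  "'a measure \<Rightarrow> real \<Rightarrow> (real \<Rightarrow> 'a \<Rightarrow> nat) \<Rightarrow> (real \<Rightarrow> 'a \<Rightarrow> real) \<Rightarrow> bool" where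
  "predictable M T N u \<longleftrightarrow> (\<lambda>(t, \<omega>). u t \<omega>) \<in> borel_measurable (predictable_sigma M T N)"


section \<open>Energy space, stochastic integral and operator-covariant derivative\<close>

text \<open>
  Elements of the energy space are represented by processes; equality in it is equality
  almost everywhere for \<open>time_measure T \<Otimes>\<^sub>M M\<close>.
\<close>

definition energy_norm_sq ::
  "'a measure \<Rightarrow> real \<Rightarrow> real \<Rightarrow> (real \<Rightarrow> 'a \<Rightarrow> real) \<Rightarrow> ennreal" where
  "energy_norm_sq M lam T u =
     ennreal lam * (\<integral>\<^sup>+\<omega>. (\<integral>\<^sup>+t. ennreal (\<bar>u t \<omega>\<bar>\<^sup>2) \<partial>time_measure T) \<partial>M)"

definition energy_space ::
  "'a measure \<Rightarrow> real \<Rightarrow> real \<Rightarrow> (real \<Rightarrow> 'a \<Rightarrow> nat) \<Rightarrow> (real \<Rightarrow> 'a \<Rightarrow> real) set" where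
  "energy_space M lam T N = {u. predictable M T N u \<and> energy_norm_sq M lam T u < \<infinity>}"

definition energy_inner ::
  "'a measure \<Rightarrow> real \<Rightarrow> real \<Rightarrow> (real \<Rightarrow> 'a \<Rightarrow> real) \<Rightarrow> (real \<Rightarrow> 'a \<Rightarrow> real) \<Rightarrow> real" where
  "energy_inner M lam T g u =
     lam * (\<integral>\<omega>. (\<integral>t. g t \<omega> * u t \<omega> \<partial>time_measure T) \<partial>M)"

definition L2 :: "'a measure \<Rightarrow> ('a \<Rightarrow> real) set" where
  "L2 M = {F \<in> borel_measurable M. integrable M (\<lambda>\<omega>. (F \<omega>)\<^sup>2)}"

text \<open>
  A value at time 0 would not change a simple integrand up to \<open>dt \<otimes> dP\<close>-null sets, so no
  such term is included.
\<close>

definition simple_data ::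
  "'a measure \<Rightarrow> real \<Rightarrow> (real \<Rightarrow> 'a \<Rightarrow> nat) \<Rightarrow> nat \<Rightarrow> (nat \<Rightarrow> real) \<Rightarrow> (nat \<Rightarrow> 'a \<Rightarrow> real) \<Rightarrow> bool"
  where
  "simple_data M T N n ts \<xi> \<longleftrightarrow>
     0 \<le> ts 0 \<and> (\<forall>i<n. ts i \<le> ts (Suc i)) \<and> ts n \<le> T \<and>
     (\<forall>i<n. \<xi> i \<in> borel_measurable (filt M T N (ts i)) \<and>
        (\<exists>C. \<forall>\<omega>\<in>space M. \<bar>\<xi> i \<omega>\<bar> \<le> C))"

definition simple_process ::
  "nat \<Rightarrow> (nat \<Rightarrow> real) \<Rightarrow> (nat \<Rightarrow> 'a \<Rightarrow> real) \<Rightarrow> real \<Rightarrow> 'a \<Rightarrow> real" where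
  "simple_process n ts \<xi> t \<omega> = (\<Sum>i<n. \<xi> i \<omega> * indicator {ts i<..ts (Suc i)} t)"

definition simple_integral ::
  "real \<Rightarrow> (real \<Rightarrow> 'a \<Rightarrow> nat) \<Rightarrow> nat \<Rightarrow> (nat \<Rightarrow> real) \<Rightarrow> (nat \<Rightarrow> 'a \<Rightarrow> real) \<Rightarrow> 'a \<Rightarrow> real" where
  "simple_integral lam N n ts \<xi> \<omega> =
     (\<Sum>i<n. \<xi> i \<omega> * (compensated lam N (ts (Suc i)) \<omega> - compensated lam N (ts i) \<omega>))"

text \<open>
  \<open>is_stoch_integral M lam T N u I\<close>: the random variable \<open>I\<close> is a version of the Ito integral
  of \<open>u\<close> against the compensated process, that is, the isometric extension from simple
  integrands. For \<open>u\<close> in the energy space such an \<open>I\<close> exists and is unique almost surely.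
\<close>

definition is_stoch_integral ::
  "'a measure \<Rightarrow> real \<Rightarrow> real \<Rightarrow> (real \<Rightarrow> 'a \<Rightarrow> nat) \<Rightarrow> (real \<Rightarrow> 'a \<Rightarrow> real) \<Rightarrow> ('a \<Rightarrow> real) \<Rightarrow> bool"
  where
  "is_stoch_integral M lam T N u I \<longleftrightarrow>
     I \<in> L2 M \<and>
     (\<exists>n ts \<xi>. (\<forall>k. simple_data M T N (n k) (ts k) (\<xi> k)) \<and>
        (\<lambda>k. energy_norm_sq M lam T (\<lambda>t \<omega>. u t \<omega> - simple_process (n k) (ts k) (\<xi> k) t \<omega>))
          \<longlonglongrightarrow> 0 \<and>
        (\<lambda>k. \<integral>\<^sup>+\<omega>. ennreal ((I \<omega> - simple_integral lam N (n k) (ts k) (\<xi> k) \<omega>)\<^sup>2) \<partial>M)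
          \<longlonglongrightarrow> 0)"

text \<open>
  \<open>is_op_cov_deriv M lam T N F g\<close>: the process \<open>g\<close> represents the value at \<open>F\<close> of the Hilbert
  space adjoint of the stochastic integral.
\<close>

definition is_op_cov_deriv ::
  "'a measure \<Rightarrow> real \<Rightarrow> real \<Rightarrow> (real \<Rightarrow> 'a \<Rightarrow> nat) \<Rightarrow> ('a \<Rightarrow> real) \<Rightarrow> (real \<Rightarrow> 'a \<Rightarrow> real) \<Rightarrow> bool"
  where
  "is_op_cov_deriv M lam T N F g \<longleftrightarrow>
     g \<in> energy_space M lam T N \<and>
     (\<forall>u\<in>energy_space M lam T N. \<forall>I. is_stoch_integral M lam T N u I \<longrightarrow>
        (\<integral>\<omega>. F \<omega> * I \<omega> \<partial>M) = energy_inner M lam T g u)"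


section \<open>Configurations and the add-a-point operator\<close>

definition jump_times :: "real \<Rightarrow> (real \<Rightarrow> 'a \<Rightarrow> nat) \<Rightarrow> 'a \<Rightarrow> real set" where
  "jump_times T N \<omega> =
     {t \<in> {0<..T}. \<not> ((\<lambda>s. real (N s \<omega>)) \<longlongrightarrow> real (N t \<omega>)) (at_left t)}"

definition configurations :: "real \<Rightarrow> real set set" where
  "configurations T = {\<eta>. finite \<eta> \<and> \<eta> \<subseteq> {0..T}}"

definition config_space :: "real \<Rightarrow> real set measure" where
  "config_space T = sigma (configurations T)
     {{\<eta> \<in> configurations T. card (\<eta> \<inter> {0..t}) = k} | t k. t \<in> {0..T}}"

text \<open>
  The random variable \<open>F\<close> regarded as a function of the configuration. The functional \<open>f\<close> is
  determined only up to a null set for the law of the configuration.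
\<close>

definition is_config_functional ::
  "'a measure \<Rightarrow> real \<Rightarrow> (real \<Rightarrow> 'a \<Rightarrow> nat) \<Rightarrow> ('a \<Rightarrow> real) \<Rightarrow> (real set \<Rightarrow> real) \<Rightarrow> bool" where
  "is_config_functional M T N F f \<longleftrightarrow>
     f \<in> borel_measurable (config_space T) \<and> (AE \<omega> in M. F \<omega> = f (jump_times T N \<omega>))"

definition add_point :: "(real set \<Rightarrow> real) \<Rightarrow> real \<Rightarrow> real set \<Rightarrow> real" where
  "add_point f t \<eta> = f (insert t \<eta>) - f \<eta>"

definition discrete_gradient ::
  "real \<Rightarrow> (real \<Rightarrow> 'a \<Rightarrow> nat) \<Rightarrow> (real set \<Rightarrow> real) \<Rightarrow> real \<Rightarrow> 'a \<Rightarrow> real" where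
  "discrete_gradient T N f t \<omega> = add_point f t (jump_times T N \<omega>)"


section \<open>Conditional expectation process and predictable projection\<close>

text \<open>
  \<open>is_cond_exp_process M T N X Y\<close>: \<open>Y\<close> is a jointly measurable version of the process
  \<open>t \<mapsto> E[X\<^sub>t | F\<^sub>t\<^sub>-]\<close>. Joint measurability has to be asked for: \<open>real_cond_exp\<close> picks a version
  separately for each \<open>t\<close>, and these choices need not be measurable in \<open>(t, \<omega>)\<close>.
\<close>

definition is_cond_exp_process ::
  "'a measure \<Rightarrow> real \<Rightarrow> (real \<Rightarrow> 'a \<Rightarrow> nat) \<Rightarrow> (real \<Rightarrow> 'a \<Rightarrow> real) \<Rightarrow> (real \<Rightarrow> 'a \<Rightarrow> real) \<Rightarrow> bool"
  where
  "is_cond_exp_process M T N X Y \<longleftrightarrow>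
     (\<lambda>(t, \<omega>). Y t \<omega>) \<in> borel_measurable (time_measure T \<Otimes>\<^sub>M M) \<and>
     (AE t in time_measure T. integrable M (X t) \<and>
        (AE \<omega> in M. Y t \<omega> = real_cond_exp M (filt_left M T N t) (X t) \<omega>))"

text \<open>
  The predictable projection of a class of \<open>dt \<otimes> dP\<close>-integrable processes modulo
  \<open>dt \<otimes> dP\<close>-null sets: the projection onto the predictable sigma-algebra. A requirement at
  every predictable stopping time would not be invariant under changing \<open>X\<close> on a null set, and
  the discrete gradient of a random variable is only determined up to such a set.
\<close>

definition is_predictable_projection ::
  "'a measure \<Rightarrow> real \<Rightarrow> (real \<Rightarrow> 'a \<Rightarrow> nat) \<Rightarrow> (real \<Rightarrow> 'a \<Rightarrow> real) \<Rightarrow> (real \<Rightarrow> 'a \<Rightarrow> real) \<Rightarrow> bool"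
  where
  "is_predictable_projection M T N X Y \<longleftrightarrow>
     integrable (time_measure T \<Otimes>\<^sub>M M) (\<lambda>(t, \<omega>). X t \<omega>) \<and>
     predictable M T N Y \<and>
     (AE (t, \<omega>) in time_measure T \<Otimes>\<^sub>M M.
        Y t \<omega> = real_cond_exp (time_measure T \<Otimes>\<^sub>M M) (predictable_sigma M T N)
                   (\<lambda>(s, \<omega>'). X s \<omega>') (t, \<omega>))"

end

theory Submission
  imports Defs
begin

text \<open>
  Let \<open>\<eta>\<close> be the random set of jump times and \<open>F = f(\<eta>)\<close>. The operator-covariant derivative is determined
  by pairing \<open>F\<close> with integrals of elementary integrands, that is by the numbers
  \<open>E[F \<xi> (N~\<^sub>b - N~\<^sub>a)]\<close> with \<open>N~\<close> the compensated process, \<open>a \<le> b\<close>, and \<open>\<xi>\<close> bounded and measurable at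
  time \<open>a\<close>. The core of the proof is the integration by parts formula (\<open>integration_by_parts\<close>)
  \<open>E[F \<xi> (N~\<^sub>b - N~\<^sub>a)] = lam * E[\<integral>\<^sub>a\<^sup>b \<xi> D\<^sub>rF dr]\<close>, where \<open>D\<^sub>rF = f(\<eta> + \<epsilon>\<^sub>r) - f(\<eta>)\<close>.

  It comes from the Mecke formula \<open>E[(N\<^sub>b - N\<^sub>a) h(\<eta>)] = lam * E[\<integral>\<^sub>a\<^sup>b h(\<eta> + \<epsilon>\<^sub>r) dr]\<close> (\<open>mecke\<close>): take
  \<open>h = f 1\<^sub>A\<close> with an event \<open>A\<close> about the path up to time \<open>a\<close>, which a point added after time \<open>a\<close> does not
  affect, and subtract the compensator. The Mecke formula is an equality of two measures on
  configurations. It suffices to check it on events that prescribe the counts at finitely many times,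
  and there, by independence of the increments, it is the identity \<open>k p(k) = \<mu> p(k - 1)\<close> for the
  weights \<open>p\<close> of the Poisson distribution with parameter \<open>\<mu>\<close>.

  By integration by parts, any process representing the operator-covariant derivative has the same
  integral as the gradient \<open>DF\<close> over each of the rectangles that generate the predictable
  sigma-algebra. So it is the conditional expectation of the gradient given this sigma-algebra, which
  is the claim about the predictable projection (\<open>op_cov_deriv_eq_projection\<close>). For the
  claim at fixed times the agreement is used on products of a set of times with one event \<open>A\<close>; this
  gives the identity of integrals over \<open>A\<close> at almost every time, with an exceptional set that depends
  on \<open>A\<close>. Since countably many events and the null sets generate the left limit of the filtration
  (\<open>filt_left_rational_cylinders\<close>), one exceptional set is enough.

  Existence is not immediate, because the gradient of a square integrable \<open>F\<close> is in general only
  integrable. The candidate is the projection of the gradient. Its square integrability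
  (\<open>proj_square_integrable\<close>) follows by duality from the isometry of the integral on simple integrands
  (\<open>simple_pair_isometry\<close>) and their density (\<open>predictable_approximable\<close>). The isometry is again
  integration by parts: \<open>F = 1\<close> shows that the increments of \<open>N~\<close> are centred given the past, and
  \<open>F = N~\<^sub>b - N~\<^sub>a\<close> gives their conditional second moment.
\<close>

section \<open>Jump times and configurations\<close>

lemma nat_tendsto_eventually_eq:
  fixes f :: "'b \<Rightarrow> nat"
  assumes "((\<lambda>s. real (f s)) \<longlongrightarrow> real k) G"
  shows "eventually (\<lambda>s. f s = k) G"
proof -
  have "eventually (\<lambda>s. dist (real (f s)) (real k) < 1) G"
    using tendstoD[OF assms, of 1] by simp
  then show ?thesis by eventually_elim (auto simp: dist_real_def)
qed

lemma jump_strict_increase: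
  assumes mono: "mono_on {0..T} (\<lambda>t. N t \<omega>)" and t: "t \<in> jump_times T N \<omega>" and s: "0 \<le> s" "s < t"
  shows "N s \<omega> < N t \<omega>"
proof (rule ccontr)
  assume "\<not> N s \<omega> < N t \<omega>"
  have tT: "t \<in> {0<..T}" using t by (auto simp: jump_times_def)
  have "eventually (\<lambda>r. r \<in> {s<..<t}) (at_left t)"
    using s(2) by (rule eventually_at_leftI[rotated]) auto
  then have "eventually (\<lambda>r. real (N r \<omega>) = real (N t \<omega>)) (at_left t)"
  proof eventually_elim
    case (elim r)
    have "N s \<omega> \<le> N r \<omega>" "N r \<omega> \<le> N t \<omega>"
      using elim s tT by (auto intro!: mono_onD[OF mono])
    then show ?case using \<open>\<not> N s \<omega> < N t \<omega>\<close> by simp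
  qed
  then have "((\<lambda>s. real (N s \<omega>)) \<longlongrightarrow> real (N t \<omega>)) (at_left t)"
    by (rule tendsto_eventually)
  then show False using t by (auto simp: jump_times_def)
qed

text \<open>
  The value of the path at a jump labels the jump. In particular there are at most \<open>N T \<omega>\<close> jumps,
  whatever their sizes.
\<close>

lemma inj_on_jump_times:
  assumes mono: "mono_on {0..T} (\<lambda>t. N t \<omega>)"
  shows "inj_on (\<lambda>t. N t \<omega>) (jump_times T N \<omega>)"
proof (rule inj_onI)
  fix x y assume xy: "x \<in> jump_times T N \<omega>" "y \<in> jump_times T N \<omega>" "N x \<omega> = N y \<omega>"
  have "0 \<le> x" "0 \<le> y" using xy by (auto simp: jump_times_def)
  then show "x = y"
    using jump_strict_increase[OF mono xy(2), of x] jump_strict_increase[OF mono xy(1), of y] xy(3)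
    by (metis less_irrefl linorder_neqE)
qed

lemma jump_times_in_configurations:
  assumes mono: "mono_on {0..T} (\<lambda>t. N t \<omega>)"
  shows "jump_times T N \<omega> \<in> configurations T"
proof -
  have "(\<lambda>t. N t \<omega>) ` jump_times T N \<omega> \<subseteq> {..N T \<omega>}"
    by (auto simp: jump_times_def intro!: mono_onD[OF mono])
  then have "finite ((\<lambda>t. N t \<omega>) ` jump_times T N \<omega>)" using finite_subset by blast
  then have "finite (jump_times T N \<omega>)"
    using inj_on_jump_times[where N=N and \<omega>=\<omega>, OF mono] by (rule finite_imageD)
  then show ?thesis by (auto simp: configurations_def jump_times_def)
qed

text \<open>
  The labelling of the jumps by \<open>t \<mapsto> N t \<omega>\<close> is inverted by sending a level \<open>k\<close> to the first time at
  which the path reaches \<open>k\<close>. By right-continuity the level is reached at that time, and since jumps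
  have size at most one it is not exceeded.
\<close>

lemma card_jump_times:
  assumes mono: "mono_on {0..T} (\<lambda>t. N t \<omega>)"
    and zero: "N 0 \<omega> = 0"
    and rc: "\<And>t. t \<in> {0..<T} \<Longrightarrow> ((\<lambda>s. real (N s \<omega>)) \<longlongrightarrow> real (N t \<omega>)) (at_right t)"
    and unit: "\<And>s. 0 < s \<Longrightarrow> s \<le> T \<Longrightarrow> \<exists>s'. 0 \<le> s' \<and> s' < s \<and> N s \<omega> \<le> Suc (N s' \<omega>)"
    and t: "0 \<le> t" "t \<le> T"
  shows "card (jump_times T N \<omega> \<inter> {0..t}) = N t \<omega>"
proof -
  have "bij_betw (\<lambda>t. N t \<omega>) (jump_times T N \<omega> \<inter> {0..t}) {1..N t \<omega>}"
    unfolding bij_betw_def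
  proof (intro conjI set_eqI iffI)
    show "inj_on (\<lambda>t. N t \<omega>) (jump_times T N \<omega> \<inter> {0..t})"
      by (rule inj_on_subset[OF inj_on_jump_times[where N=N and \<omega>=\<omega>, OF mono]]) auto
  next
    fix k assume "k \<in> (\<lambda>t. N t \<omega>) ` (jump_times T N \<omega> \<inter> {0..t})"
    then obtain s where s: "s \<in> jump_times T N \<omega>" "s \<le> t" "k = N s \<omega>" by auto
    have "s > 0" using s by (auto simp: jump_times_def)
    then have "k > 0" using jump_strict_increase[OF mono s(1), of 0] s(3) by simp
    moreover have "k \<le> N t \<omega>" using s t \<open>s > 0\<close> by (auto intro!: mono_onD[OF mono])
    ultimately show "k \<in> {1..N t \<omega>}" by auto
  next
    fix k assume k: "k \<in> {1..N t \<omega>}"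
    \<comment> \<open>the first time at which the level \<open>k\<close> is reached\<close>
    define S where "S = {s \<in> {0..t}. k \<le> N s \<omega>}"
    define \<tau> where "\<tau> = Inf S"
    have tS: "t \<in> S" using k t by (auto simp: S_def)
    have bdd: "bdd_below S" by (auto simp: S_def bdd_below_def intro!: exI[of _ 0])
    have \<tau>0: "0 \<le> \<tau>" unfolding \<tau>_def using tS by (intro cInf_greatest) (auto simp: S_def)
    have \<tau>t: "\<tau> \<le> t" unfolding \<tau>_def using cInf_lower[OF tS bdd] .
    have below: "N s \<omega> < k" if "0 \<le> s" "s < \<tau>" for s
    proof (rule ccontr)
      assume "\<not> N s \<omega> < k"
      then have "s \<in> S" using that \<tau>t by (auto simp: S_def)
      then have "\<tau> \<le> s" unfolding \<tau>_def using bdd by (rule cInf_lower)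
      then show False using that by simp
    qed
    have reach: "k \<le> N \<tau> \<omega>"
    proof (cases "\<tau> = t")
      case True then show ?thesis using tS by (auto simp: S_def)
    next
      case False
      then have "\<tau> < t" using \<tau>t by simp
      then have "eventually (\<lambda>s. N s \<omega> = N \<tau> \<omega>) (at_right \<tau>)"
        using rc[of \<tau>] \<tau>0 t by (intro nat_tendsto_eventually_eq) auto
      then obtain b where b: "b > \<tau>" "\<And>y. \<tau> < y \<Longrightarrow> y < b \<Longrightarrow> N y \<omega> = N \<tau> \<omega>"
        unfolding eventually_at_right_field by auto
      then obtain s where s: "s \<in> S" "s < b"
        using cInf_lessD[of S b] tS unfolding \<tau>_def by auto
      have "\<tau> \<le> s" unfolding \<tau>_def using s(1) bdd by (rule cInf_lower)
      then have "N s \<omega> = N \<tau> \<omega>" using b(2)[of s] s(2) by (cases "s = \<tau>") auto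
      then show ?thesis using s(1) by (auto simp: S_def)
    qed
    have "\<tau> \<noteq> 0" using reach zero k by (cases "\<tau> = 0") auto
    then have \<tau>pos: "0 < \<tau>" using \<tau>0 by simp
    have "\<not> ((\<lambda>s. real (N s \<omega>)) \<longlongrightarrow> real (N \<tau> \<omega>)) (at_left \<tau>)"
    proof
      assume "((\<lambda>s. real (N s \<omega>)) \<longlongrightarrow> real (N \<tau> \<omega>)) (at_left \<tau>)"
      then have "eventually (\<lambda>s. N s \<omega> = N \<tau> \<omega>) (at_left \<tau>)"
        by (rule nat_tendsto_eventually_eq)
      moreover have "eventually (\<lambda>r. r \<in> {0<..<\<tau>}) (at_left \<tau>)"
        using \<tau>pos by (rule eventually_at_leftI[rotated]) auto
      ultimately have "eventually (\<lambda>s. False) (at_left \<tau>)"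
      proof eventually_elim
        case (elim s)
        then show False using below[of s] reach by auto
      qed
      then show False by simp
    qed
    then have J: "\<tau> \<in> jump_times T N \<omega>" using \<tau>pos \<tau>t t by (auto simp: jump_times_def)
    obtain s' where s': "0 \<le> s'" "s' < \<tau>" "N \<tau> \<omega> \<le> Suc (N s' \<omega>)"
      using unit[of \<tau>] \<tau>pos \<tau>t t by auto
    have "N \<tau> \<omega> = k" using s' below[of s'] reach by auto
    then show "k \<in> (\<lambda>t. N t \<omega>) ` (jump_times T N \<omega> \<inter> {0..t})"
      using J \<tau>t \<tau>0 by (intro image_eqI[of _ _ \<tau>]) auto
  qed
  then show ?thesis using bij_betw_same_card by fastforce
qed

lemma space_config_space: "space (config_space T) = configurations T"
  unfolding config_space_def by (rule space_measure_of) auto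

lemma sets_config_space:
  "sets (config_space T) = sigma_sets (configurations T)
     {{\<eta> \<in> configurations T. card (\<eta> \<inter> {0..t}) = k} | t k. t \<in> {0..T}}"
  unfolding config_space_def by (rule sets_measure_of) auto

lemma insert_configurations: "r \<in> {0..T} \<Longrightarrow> \<eta> \<in> configurations T \<Longrightarrow> insert r \<eta> \<in> configurations T"
  by (auto simp: configurations_def)

lemma measurable_count:
  "(\<lambda>\<eta>. card (\<eta> \<inter> {0..t})) \<in> measurable (config_space T) (count_space UNIV)"
proof -
  have *: "(\<lambda>\<eta>. card (\<eta> \<inter> {0..t})) \<in> measurable (config_space T) (count_space UNIV)"
    if t: "t \<in> {0..T}" for t
  proof -
    have "(\<lambda>\<eta>. card (\<eta> \<inter> {0..t})) \<in> space (config_space T) \<rightarrow> UNIV \<and>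
      (\<forall>a\<in>UNIV. (\<lambda>\<eta>. card (\<eta> \<inter> {0..t})) -` {a} \<inter> space (config_space T) \<in> sets (config_space T))"
    proof (intro conjI ballI)
      fix a
      have "(\<lambda>\<eta>. card (\<eta> \<inter> {0..t})) -` {a} \<inter> space (config_space T) =
        {\<eta> \<in> configurations T. card (\<eta> \<inter> {0..t}) = a}"
        by (auto simp: space_config_space)
      also have "\<dots> \<in> sets (config_space T)"
        unfolding sets_config_space using t by (intro sigma_sets.Basic) auto
      finally show "(\<lambda>\<eta>. card (\<eta> \<inter> {0..t})) -` {a} \<inter> space (config_space T) \<in> sets (config_space T)" .
    qed auto
    then show ?thesis by (simp add: measurable_count_space_eq2_countable)
  qed
  consider "t < 0" | "t \<in> {0..T}" | "0 \<le> t" "T < t" by fastforce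
  then show ?thesis
  proof cases
    case 1
    then have "{0..t} = {}" by auto
    then show ?thesis by simp
  next
    case 2 then show ?thesis by (rule *)
  next
    case 3
    show ?thesis
    proof (cases "0 \<le> T")
      case True
      have "card (\<eta> \<inter> {0..t}) = card (\<eta> \<inter> {0..T})" if "\<eta> \<in> space (config_space T)" for \<eta>
        using that 3 by (intro arg_cong[where f=card]) (auto simp: space_config_space configurations_def)
      then show ?thesis using *[of T] True by (subst measurable_cong) auto
    next
      case False
      have "card (\<eta> \<inter> {0..t}) = 0" if "\<eta> \<in> space (config_space T)" for \<eta>
        using that False by (auto simp: space_config_space configurations_def)
      then show ?thesis by (subst measurable_cong) auto
    qed
  qed
qed

lemma measurable_count_comp [measurable (raw)]:
  "f \<in> measurable K (config_space T) \<Longrightarrow> (\<lambda>x. card (f x \<inter> {0..t})) \<in> measurable K (count_space UNIV)"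
  by (rule measurable_compose[OF _ measurable_count])

text \<open>
  Membership of a point in a configuration is detected by the counts over short rational
  intervals around the point; this makes the evaluation \<open>(r, \<eta>) \<mapsto> r \<in> \<eta>\<close> jointly measurable.
\<close>

lemma mem_config_iff:
  fixes r :: real
  assumes "finite \<eta>"
  shows "r \<in> \<eta> \<and> 0 \<le> r \<longleftrightarrow> (\<forall>n::nat. \<exists>p q::rat. of_rat p < r \<and> r \<le> of_rat q \<and>
    (of_rat q :: real) - of_rat p < 1 / real (Suc n) \<and>
    card (\<eta> \<inter> {0..of_rat p}) \<noteq> card (\<eta> \<inter> {0..of_rat q}))" (is "?L \<longleftrightarrow> ?R")
proof
  assume L: ?L
  show ?R
  proof
    fix n :: nat
    let ?d = "1 / (2 * real (Suc n))"
    obtain p :: rat where p: "r - ?d < of_rat p" "of_rat p < r"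
      using of_rat_dense[of "r - ?d" r] by auto
    obtain q :: rat where q: "r < of_rat q" "of_rat q < r + ?d"
      using of_rat_dense[of r "r + ?d"] by auto
    have "r \<in> \<eta> \<inter> {0..of_rat q}" "r \<notin> \<eta> \<inter> {0..of_rat p}" using p q L by auto
    moreover have "\<eta> \<inter> {0..of_rat p} \<subseteq> \<eta> \<inter> {0..of_rat q}" using p q by auto
    ultimately have "\<eta> \<inter> {0..of_rat p} \<subset> \<eta> \<inter> {0..of_rat q}" by blast
    then have "card (\<eta> \<inter> {0..of_rat p}) < card (\<eta> \<inter> {0..of_rat q})"
      using assms by (intro psubset_card_mono) auto
    moreover have "(of_rat q :: real) - of_rat p < 2 * ?d" using p q by linarith
    then have "(of_rat q :: real) - of_rat p < 1 / real (Suc n)" by (simp add: field_simps)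
    ultimately show "\<exists>p q::rat. of_rat p < r \<and> r \<le> of_rat q \<and>
      (of_rat q :: real) - of_rat p < 1 / real (Suc n) \<and>
      card (\<eta> \<inter> {0..of_rat p}) \<noteq> card (\<eta> \<inter> {0..of_rat q})"
      using p q by (intro exI[of _ p] exI[of _ q]) auto
  qed
next
  assume R: ?R
  show ?L
  proof (rule ccontr)
    assume "\<not> ?L"
    then have nr: "r \<notin> \<eta> \<inter> {0..}" by auto
    have "finite (\<eta> \<inter> {0..})" using assms by auto
    then obtain e where e: "e > 0" "\<And>x. x \<in> \<eta> \<inter> {0..} \<Longrightarrow> x \<noteq> r \<Longrightarrow> e \<le> dist r x"
      using finite_set_avoid by metis
    obtain n where n: "1 / real (Suc n) < e" using nat_approx_posE[OF e(1)] by auto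
    from R obtain p q :: rat where pq: "of_rat p < r" "r \<le> of_rat q"
      "(of_rat q :: real) - of_rat p < 1 / real (Suc n)"
      "card (\<eta> \<inter> {0..of_rat p}) \<noteq> card (\<eta> \<inter> {0..of_rat q})" by blast
    have "\<eta> \<inter> {0..of_rat p} = \<eta> \<inter> {0..of_rat q}"
    proof (intro equalityI subsetI)
      fix x assume x: "x \<in> \<eta> \<inter> {0..of_rat q}"
      show "x \<in> \<eta> \<inter> {0..of_rat p}"
      proof (rule ccontr)
        assume "x \<notin> \<eta> \<inter> {0..of_rat p}"
        then have "of_rat p < x" using x by auto
        then have "dist r x < e" using x pq n by (auto simp: dist_real_def)
        moreover have "x \<noteq> r" using x nr by auto
        ultimately show False using e(2)[of x] x by auto
      qed
    qed (use pq in auto)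
    then show False using pq by simp
  qed
qed

lemma space_time_measure: "space (time_measure T) = {0..T}"
  by (simp add: time_measure_def space_restrict_space)

lemma measurable_ident_time: "(\<lambda>r. r) \<in> borel_measurable (time_measure T)"
  unfolding time_measure_def by (rule measurable_restrict_space1) simp

lemma measurable_fst_time [measurable]: "fst \<in> borel_measurable (time_measure T \<Otimes>\<^sub>M K)"
  by (rule measurable_compose[OF measurable_fst measurable_ident_time])

lemma measurable_mem_config [measurable]:
  "Measurable.pred (time_measure T \<Otimes>\<^sub>M config_space T) (\<lambda>(r, \<eta>). r \<in> \<eta>)"
proof -
  let ?K = "time_measure T \<Otimes>\<^sub>M config_space T"
  have c: "(\<lambda>x. real (card (snd x \<inter> {0..t}))) \<in> borel_measurable ?K" for t
    by measurable
  have ne: "Measurable.pred ?K (\<lambda>x. card (snd x \<inter> {0..t}) \<noteq> card (snd x \<inter> {0..s}))" for s t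
  proof -
    have "Measurable.pred ?K (\<lambda>x. real (card (snd x \<inter> {0..t})) \<noteq> real (card (snd x \<inter> {0..s})))"
      using c[of s] c[of t] by measurable
    then show ?thesis by simp
  qed
  have "Measurable.pred ?K (\<lambda>x. \<forall>n::nat. \<exists>p q::rat. of_rat p < fst x \<and> fst x \<le> of_rat q \<and>
    (of_rat q :: real) - of_rat p < 1 / real (Suc n) \<and>
    card (snd x \<inter> {0..of_rat p}) \<noteq> card (snd x \<inter> {0..of_rat q}))"
  proof (rule pred_intros_countable(1), rule pred_intros_countable(2), rule pred_intros_countable(2))
    fix n :: nat and p q :: rat
    have "Measurable.pred ?K (\<lambda>x. of_rat p < fst x)" "Measurable.pred ?K (\<lambda>x. fst x \<le> of_rat q)"
      by measurable
    then show "Measurable.pred ?K (\<lambda>x. of_rat p < fst x \<and> fst x \<le> of_rat q \<and>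
      (of_rat q :: real) - of_rat p < 1 / real (Suc n) \<and>
      card (snd x \<inter> {0..of_rat p}) \<noteq> card (snd x \<inter> {0..of_rat q}))"
      by (rule pred_intros_logic(3)[OF _ pred_intros_logic(3)[OF _ pred_intros_conj1'[OF ne]]])
  qed
  also have "(\<lambda>x. \<forall>n::nat. \<exists>p q::rat. of_rat p < fst x \<and> fst x \<le> of_rat q \<and>
    (of_rat q :: real) - of_rat p < 1 / real (Suc n) \<and>
    card (snd x \<inter> {0..of_rat p}) \<noteq> card (snd x \<inter> {0..of_rat q})) =
    (\<lambda>(r, \<eta>). \<forall>n::nat. \<exists>p q::rat. of_rat p < r \<and> r \<le> of_rat q \<and>
    (of_rat q :: real) - of_rat p < 1 / real (Suc n) \<and>
    card (\<eta> \<inter> {0..of_rat p}) \<noteq> card (\<eta> \<inter> {0..of_rat q}))" by (simp add: case_prod_unfold)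
  finally show ?thesis
  proof (rule measurable_cong[THEN iffD1, rotated])
    fix x assume "x \<in> space (time_measure T \<Otimes>\<^sub>M config_space T)"
    then obtain r \<eta> where x: "x = (r, \<eta>)" "0 \<le> r" "finite \<eta>"
      by (auto simp: space_pair_measure space_time_measure space_config_space configurations_def)
    show "(case x of (r, \<eta>) \<Rightarrow> \<forall>n::nat. \<exists>p q::rat. of_rat p < r \<and> r \<le> of_rat q \<and>
      (of_rat q :: real) - of_rat p < 1 / real (Suc n) \<and>
      card (\<eta> \<inter> {0..of_rat p}) \<noteq> card (\<eta> \<inter> {0..of_rat q})) = (case x of (r, \<eta>) \<Rightarrow> r \<in> \<eta>)"
      unfolding x(1) prod.case mem_config_iff[OF x(3), symmetric] using x(2) by blast
  qed
qed

lemma card_insert_count: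
  assumes "finite \<eta>" "0 \<le> r"
  shows "card (insert r \<eta> \<inter> {0..t}) = card (\<eta> \<inter> {0..t}) + (if r \<le> t \<and> r \<notin> \<eta> then 1 else 0)"
proof (cases "r \<le> t")
  case True
  then have "insert r \<eta> \<inter> {0..t} = insert r (\<eta> \<inter> {0..t})" using assms by auto
  then show ?thesis using assms True by (auto simp: card_insert_if)
next
  case False
  then have "insert r \<eta> \<inter> {0..t} = \<eta> \<inter> {0..t}" by auto
  then show ?thesis using False by simp
qed

text \<open>
  This makes the discrete gradient jointly measurable in time and path.
\<close>

lemma measurable_insert_config [measurable]:
  "(\<lambda>(r, \<eta>). insert r \<eta>) \<in> measurable (time_measure T \<Otimes>\<^sub>M config_space T) (config_space T)"
  unfolding config_space_def[of T]
proof (rule measurable_measure_of)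
  show "(\<lambda>(r, \<eta>). insert r \<eta>) \<in> space (time_measure T \<Otimes>\<^sub>M sigma (configurations T)
     {{\<eta> \<in> configurations T. card (\<eta> \<inter> {0..t}) = k} | t k. t \<in> {0..T}}) \<rightarrow> configurations T"
    unfolding config_space_def[symmetric]
    by (auto simp: space_pair_measure space_time_measure space_config_space insert_configurations)
next
  fix A assume "A \<in> {{\<eta> \<in> configurations T. card (\<eta> \<inter> {0..t}) = k} | t k. t \<in> {0..T}}"
  then obtain t k where A: "A = {\<eta> \<in> configurations T. card (\<eta> \<inter> {0..t}) = k}" by auto
  have eq: "(\<lambda>(r, \<eta>). insert r \<eta>) -` A \<inter> space (time_measure T \<Otimes>\<^sub>M config_space T) =
     {x \<in> space (time_measure T \<Otimes>\<^sub>M config_space T).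
        card (snd x \<inter> {0..t}) + (if fst x \<le> t \<and> \<not> (\<lambda>(r, \<eta>). r \<in> \<eta>) x then 1 else 0) = k}"
    by (auto simp: A space_pair_measure space_time_measure space_config_space insert_configurations
         card_insert_count configurations_def split: if_splits)
  have "(\<lambda>(r, \<eta>). insert r \<eta>) -` A \<inter> space (time_measure T \<Otimes>\<^sub>M config_space T)
     \<in> sets (time_measure T \<Otimes>\<^sub>M config_space T)"
    unfolding eq by measurable
  then show "(\<lambda>(r, \<eta>). insert r \<eta>) -` A \<inter> space (time_measure T \<Otimes>\<^sub>M sigma (configurations T)
     {{\<eta> \<in> configurations T. card (\<eta> \<inter> {0..t}) = k} | t k. t \<in> {0..T}})
     \<in> sets (time_measure T \<Otimes>\<^sub>M sigma (configurations T)
     {{\<eta> \<in> configurations T. card (\<eta> \<inter> {0..t}) = k} | t k. t \<in> {0..T}})"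
    unfolding config_space_def[symmetric] .
qed auto

section \<open>Paths, jump times and filtrations of the Poisson process\<close>

locale poisson_setting = prob_space M + complete_measure M
  for M :: "'a measure" +
  fixes N :: "real \<Rightarrow> 'a \<Rightarrow> nat" and lam T :: real
  assumes T_pos: "0 < T" and lam_pos: "0 < lam" and poisson: "poisson_process M lam T N"
begin

abbreviation "conf \<equiv> jump_times T N"
abbreviation "prodM \<equiv> time_measure T \<Otimes>\<^sub>M M"

lemma measurable_N: "t \<in> {0..T} \<Longrightarrow> N t \<in> measurable M (count_space UNIV)"
  using poisson by (auto simp: poisson_process_def)

lemma measurable_real_N [measurable]: "t \<in> {0..T} \<Longrightarrow> (\<lambda>\<omega>. real (N t \<omega>)) \<in> borel_measurable M"
  by (rule measurable_compose[OF measurable_N]) auto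

lemma N_zero: "\<omega> \<in> space M \<Longrightarrow> N 0 \<omega> = 0"
  and N_mono_on: "\<omega> \<in> space M \<Longrightarrow> mono_on {0..T} (\<lambda>t. N t \<omega>)"
  and N_right_cont: "\<omega> \<in> space M \<Longrightarrow> t \<in> {0..<T} \<Longrightarrow>
    ((\<lambda>s. real (N s \<omega>)) \<longlongrightarrow> real (N t \<omega>)) (at_right t)"
  using poisson by (auto simp: poisson_process_def)

lemma N_mono: "\<omega> \<in> space M \<Longrightarrow> 0 \<le> s \<Longrightarrow> s \<le> t \<Longrightarrow> t \<le> T \<Longrightarrow> N s \<omega> \<le> N t \<omega>"
  using mono_onD[OF N_mono_on, of \<omega> s t] by auto

lemma increment_distr: "0 \<le> s \<Longrightarrow> s < t \<Longrightarrow> t \<le> T \<Longrightarrow>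
    distr M (count_space UNIV) (\<lambda>\<omega>. N t \<omega> - N s \<omega>) = measure_pmf (poisson_pmf (lam * (t - s)))"
  using poisson unfolding poisson_process_def by blast

lemma increments_indep: "0 \<le> ts 0 \<Longrightarrow> (\<forall>i<n. ts i < ts (Suc i)) \<Longrightarrow> ts n \<le> T \<Longrightarrow>
    indep_vars (\<lambda>_. count_space UNIV) (\<lambda>i \<omega>. N (ts (Suc i)) \<omega> - N (ts i) \<omega>) {..<n}"
  using poisson unfolding poisson_process_def by blast

lemma measurable_increment: "0 \<le> s \<Longrightarrow> s \<le> t \<Longrightarrow> t \<le> T \<Longrightarrow>
    (\<lambda>\<omega>. N t \<omega> - N s \<omega>) \<in> measurable M (count_space UNIV)"
  using measurable_N[of s] measurable_N[of t] by measurable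

lemma prob_increment:
  assumes "0 \<le> s" "s < t" "t \<le> T"
  shows "prob {\<omega> \<in> space M. N t \<omega> - N s \<omega> \<in> B} = measure (measure_pmf (poisson_pmf (lam * (t - s)))) B"
proof -
  have "measure (distr M (count_space UNIV) (\<lambda>\<omega>. N t \<omega> - N s \<omega>)) B =
      prob ((\<lambda>\<omega>. N t \<omega> - N s \<omega>) -` B \<inter> space M)"
    using assms measurable_increment[of s t] by (intro measure_distr) auto
  moreover have "(\<lambda>\<omega>. N t \<omega> - N s \<omega>) -` B \<inter> space M = {\<omega> \<in> space M. N t \<omega> - N s \<omega> \<in> B}" by auto
  ultimately show ?thesis using increment_distr[OF assms] by simp
qed

lemma poisson_ge_two:
  assumes "0 < x"
  shows "measure (measure_pmf (poisson_pmf x)) {k. 2 \<le> k} \<le> x\<^sup>2"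
proof -
  have "measure (measure_pmf (poisson_pmf x)) {0, 1} = exp (- x) + x * exp (- x)"
    using assms by (subst measure_measure_pmf_finite) auto
  moreover have "{k::nat. 2 \<le> k} = UNIV - {0, 1}" by auto
  then have "measure (measure_pmf (poisson_pmf x)) {k. 2 \<le> k} =
      1 - measure (measure_pmf (poisson_pmf x)) {0, 1}"
    using measure_pmf.prob_compl[of "{0, 1}" "poisson_pmf x"] by simp
  moreover have "(1 - x) * (1 + x) \<le> exp (- x) * (1 + x)"
    using exp_ge_add_one_self[of "- x"] assms by (intro mult_right_mono) auto
  ultimately show ?thesis by (simp add: algebra_simps power2_eq_square)
qed

text \<open>
  A jump of size at least two at some time forces, for every \<open>n\<close>, an increment of size at least two
  over one of \<open>n + 1\<close> intervals of equal length. Each of these has probability of order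
  \<open>n\<^sup>-\<^sup>2\<close>, so the event is null.
\<close>

lemma AE_unit_jumps:
  "AE \<omega> in M. \<forall>s. 0 < s \<and> s \<le> T \<longrightarrow> (\<exists>s'. 0 \<le> s' \<and> s' < s \<and> N s \<omega> \<le> Suc (N s' \<omega>))"
proof -
  define G where "G n i = real i * (T / real (Suc n))" for n i :: nat
  define A where "A n = (\<Union>i\<le>n. {\<omega> \<in> space M. N (G n (Suc i)) \<omega> - N (G n i) \<omega> \<in> {k. 2 \<le> k}})" for n
  define B where "B = (\<Inter>n. A n)"
  have G: "0 \<le> G n i" "G n i < G n (Suc i)" "i \<le> n \<Longrightarrow> G n (Suc i) \<le> T" for n i
    using T_pos by (auto simp: G_def field_simps intro: add_pos_nonneg)
  have Gdiff: "G n (Suc i) - G n i = T / real (Suc n)" for n i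
    by (simp add: G_def algebra_simps add_divide_distrib)
  have meas: "{\<omega> \<in> space M. N (G n (Suc i)) \<omega> - N (G n i) \<omega> \<in> C} \<in> sets M" if "i \<le> n" for n i C
    using measurable_sets[OF measurable_increment[of "G n i" "G n (Suc i)"], of C] G(1,2)[of n i] G(3)[OF that]
    by (simp add: vimage_def Int_def conj_commute)
  then have A: "A n \<in> sets M" for n unfolding A_def by (intro sets.finite_UN meas) auto
  have pA: "prob (A n) \<le> (lam * T)\<^sup>2 / real (Suc n)" for n
  proof -
    have "prob (A n) \<le> (\<Sum>i\<le>n. prob {\<omega> \<in> space M. N (G n (Suc i)) \<omega> - N (G n i) \<omega> \<in> {k. 2 \<le> k}})"
      unfolding A_def by (intro finite_measure_subadditive_finite image_subsetI meas) auto
    also have "\<dots> \<le> (\<Sum>i\<le>n. (lam * T / real (Suc n))\<^sup>2)"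
    proof (rule sum_mono)
      fix i assume "i \<in> {..n}"
      then show "prob {\<omega> \<in> space M. N (G n (Suc i)) \<omega> - N (G n i) \<omega> \<in> {k. 2 \<le> k}} \<le> (lam * T / real (Suc n))\<^sup>2"
        using prob_increment[of "G n i" "G n (Suc i)" "{k. 2 \<le> k}"] G(1,2)[of n i] G(3)[of i n]
          poisson_ge_two[of "lam * (G n (Suc i) - G n i)"] lam_pos Gdiff[of n i] by simp
    qed
    also have "\<dots> = (lam * T)\<^sup>2 / real (Suc n)"
      by (simp add: power2_eq_square field_simps del: of_nat_Suc)
    finally show ?thesis .
  qed
  have B: "B \<in> sets M" unfolding B_def using A by auto
  have "prob B \<le> (lam * T)\<^sup>2 / real (Suc n)" for n
    using finite_measure_mono[of B "A n"] A pA[of n] unfolding B_def by force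
  moreover have "(\<lambda>n. (lam * T)\<^sup>2 / real (Suc n)) \<longlonglongrightarrow> 0"
    by (rule LIMSEQ_Suc) (rule lim_const_over_n)
  ultimately have "prob B \<le> 0"
    using LIMSEQ_le_const[of "\<lambda>n. (lam * T)\<^sup>2 / real (Suc n)" 0 "prob B"] by auto
  then have "prob B = 0" using measure_nonneg[of M B] by linarith
  then have "AE \<omega> in M. \<omega> \<notin> B" using B prob_eq_0 by blast
  with AE_space show ?thesis
  proof eventually_elim
    case (elim \<omega>)
    then obtain n where n: "\<omega> \<notin> A n" unfolding B_def by auto
    show ?case
    proof (intro allI impI)
      fix s assume s: "0 < s \<and> s \<le> T"
      define i where "i = nat (\<lceil>s / (T / real (Suc n))\<rceil> - 1)"
      have pos: "0 < s / (T / real (Suc n))" using s T_pos by simp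
      then have c: "\<lceil>s / (T / real (Suc n))\<rceil> \<ge> 1" by (simp add: one_le_ceiling)
      have i: "real i = of_int \<lceil>s / (T / real (Suc n))\<rceil> - 1" using c by (simp add: i_def)
      have "real i < s / (T / real (Suc n))" "s / (T / real (Suc n)) \<le> real i + 1"
        using i by linarith+
      then have b: "G n i < s" "s \<le> G n (Suc i)"
        using T_pos unfolding G_def by (simp_all add: field_simps)
      have "real i < real (Suc n)"
      proof -
        have "s * real (Suc n) \<le> T * real (Suc n)" using s by (intro mult_right_mono) auto
        then have "s / (T / real (Suc n)) \<le> real (Suc n)" using T_pos by (simp add: field_simps)
        then show ?thesis using \<open>real i < s / (T / real (Suc n))\<close> by linarith
      qed
      then have "i \<le> n" by simp
      have "N (G n (Suc i)) \<omega> - N (G n i) \<omega> < 2"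
        using n elim(1) \<open>i \<le> n\<close> unfolding A_def by force
      moreover have "N s \<omega> \<le> N (G n (Suc i)) \<omega>"
        using N_mono[OF elim(1), of s "G n (Suc i)"] s b G(1,2)[of n i] G(3)[of i n] \<open>i \<le> n\<close> by auto
      ultimately show "\<exists>s'. 0 \<le> s' \<and> s' < s \<and> N s \<omega> \<le> Suc (N s' \<omega>)"
        using b G(1)[of n i] by (intro exI[of _ "G n i"]) auto
    qed
  qed
qed

lemma conf_in_configurations: "\<omega> \<in> space M \<Longrightarrow> conf \<omega> \<in> configurations T"
  by (rule jump_times_in_configurations[where N=N and \<omega>=\<omega>, OF N_mono_on])

lemma finite_conf: "\<omega> \<in> space M \<Longrightarrow> finite (conf \<omega>)"
  using conf_in_configurations by (auto simp: configurations_def)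

lemma AE_count: "AE \<omega> in M. \<forall>t\<in>{0..T}. card (conf \<omega> \<inter> {0..t}) = N t \<omega>"
  using AE_unit_jumps AE_space
proof eventually_elim
  case (elim \<omega>)
  show ?case
  proof
    fix t assume "t \<in> {0..T}"
    then show "card (conf \<omega> \<inter> {0..t}) = N t \<omega>"
      using elim N_zero[OF elim(2)] N_right_cont[OF elim(2)]
      by (intro card_jump_times[where N=N and \<omega>=\<omega>, OF N_mono_on[OF elim(2)]]) auto
  qed
qed

text \<open>
  Completeness enters here: the number of jump times up to \<open>t\<close> is only almost surely equal to \<open>N t\<close>.
\<close>

lemma measurable_conf [measurable]: "conf \<in> measurable M (config_space T)"
  unfolding config_space_def
proof (rule measurable_measure_of)
  show "conf \<in> space M \<rightarrow> configurations T" using conf_in_configurations by auto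
next
  fix A assume "A \<in> {{\<eta> \<in> configurations T. card (\<eta> \<inter> {0..t}) = k} | t k. t \<in> {0..T}}"
  then obtain t k where A: "A = {\<eta> \<in> configurations T. card (\<eta> \<inter> {0..t}) = k}" and t: "t \<in> {0..T}" by auto
  have "AE \<omega> in M. \<omega> \<in> N t -` {k} \<inter> space M \<longleftrightarrow> \<omega> \<in> conf -` A \<inter> space M"
    using AE_count AE_space by eventually_elim (use t conf_in_configurations in \<open>auto simp: A\<close>)
  then show "conf -` A \<inter> space M \<in> sets M"
    by (rule in_sets_AE) (use measurable_sets[OF measurable_N[OF t], of "{k}"] in auto)
qed auto

lemma finite_measure_time: "finite_measure (time_measure T)"
  unfolding time_measure_def
  by (rule finite_measureI) (use T_pos in \<open>simp add: space_restrict_space emeasure_restrict_space\<close>)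

sublocale time: finite_measure "time_measure T"
  by (rule finite_measure_time)

sublocale tm: pair_sigma_finite "time_measure T" M
  ..

sublocale mt: pair_sigma_finite M "time_measure T"
  ..

lemma finite_measure_prod: "finite_measure prodM"
  by (intro finite_measure_pair_measure finite_measure_time) unfold_locales

sublocale prod: finite_measure prodM
  by (rule finite_measure_prod)

lemma AE_time_iff: "(AE t in time_measure T. P t) \<longleftrightarrow> (AE t in lborel. t \<in> {0..T} \<longrightarrow> P t)"
  unfolding time_measure_def by (rule AE_restrict_space_iff) simp

lemma AE_time_not_in_finite: "finite A \<Longrightarrow> AE t in time_measure T. t \<notin> A"
proof -
  assume "finite A"
  then have "A \<in> null_sets lborel" by (rule finite_imp_null_set_lborel)
  then have "AE t in lborel. t \<notin> A" by (rule AE_not_in)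
  then show ?thesis unfolding AE_time_iff by eventually_elim auto
qed

text \<open>
  Each path jumps at finitely many times, so by Fubini a point added at time \<open>t\<close> is new for almost
  every pair of a time and a path.
\<close>

lemma AE_not_in_conf: "AE x in prodM. fst x \<notin> conf (snd x)"
proof -
  have "AE \<omega> in M. AE t in time_measure T. t \<notin> conf \<omega>"
    using AE_space by eventually_elim (rule AE_time_not_in_finite[OF finite_conf])
  moreover have m: "{x \<in> space prodM. fst x \<notin> conf (snd x)} \<in> sets prodM"
  proof -
    have "(\<lambda>x. (fst x, conf (snd x))) \<in> measurable prodM (time_measure T \<Otimes>\<^sub>M config_space T)"
      by measurable
    from measurable_compose[OF this measurable_mem_config]
    have "Measurable.pred prodM (\<lambda>x. fst x \<in> conf (snd x))" by simp
    then show ?thesis by measurable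
  qed
  ultimately have "AE t in time_measure T. AE \<omega> in M. t \<notin> conf \<omega>"
    using tm.AE_commute[of "\<lambda>t \<omega>. t \<notin> conf \<omega>"] by simp
  then show ?thesis using tm.AE_pair_iff[of "\<lambda>t \<omega>. t \<notin> conf \<omega>"] m by simp
qed

lemma AE_prod_snd:
  assumes "AE \<omega> in M. P \<omega>"
  shows "AE x in prodM. P (snd x)"
proof -
  have n: "{\<omega> \<in> space M. \<not> P \<omega>} \<in> null_sets M" using assms AE_iff_null_sets by simp
  then have "emeasure prodM ({0..T} \<times> {\<omega> \<in> space M. \<not> P \<omega>}) = 0"
    using sets.top[of "time_measure T"]
    by (subst emeasure_pair_measure_Times) (auto simp: space_time_measure null_setsD1)
  then have "{0..T} \<times> {\<omega> \<in> space M. \<not> P \<omega>} \<in> null_sets prodM"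
    using n sets.top[of "time_measure T"]
    by (intro null_setsI pair_measureI) (auto simp: space_time_measure)
  then show ?thesis
    by (rule AE_I') (auto simp: space_pair_measure space_time_measure)
qed

lemma AE_fst_pos: "AE x in prodM. fst x \<in> {0<..T}"
proof -
  have "AE t in time_measure T. t \<notin> {0}" by (rule AE_time_not_in_finite) simp
  moreover have "{x \<in> space prodM. fst x \<noteq> 0} \<in> sets prodM" by measurable
  ultimately have "AE x in prodM. fst x \<noteq> 0"
    using tm.AE_pair_iff[of "\<lambda>t \<omega>. t \<noteq> 0"] by auto
  with AE_space show ?thesis
    by eventually_elim (auto simp: space_pair_measure space_time_measure)
qed

lemma space_NA: "space (null_augmented M N t) = space M"
  unfolding null_augmented_def by (rule space_measure_of) (auto dest: null_setsD2 sets.sets_into_space)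

lemma sets_NA: "sets (null_augmented M N t) =
    sigma_sets (space M) ({N s -` B \<inter> space M | s B. s \<in> {0..t}} \<union> null_sets M)"
  unfolding null_augmented_def by (rule sets_measure_of) (auto dest: null_setsD2 sets.sets_into_space)

lemma NA_mono: "s \<le> t \<Longrightarrow> sets (null_augmented M N s) \<subseteq> sets (null_augmented M N t)"
  unfolding sets_NA by (intro sigma_sets_mono' Un_mono order_refl) fastforce

lemma NA_subset: "t \<le> T \<Longrightarrow> sets (null_augmented M N t) \<subseteq> sets M"
  unfolding sets_NA
proof (rule sets.sigma_sets_subset, safe)
  fix s and B :: "nat set" assume "t \<le> T" "s \<in> {0..t}"
  then show "N s -` B \<inter> space M \<in> sets M" by (intro measurable_sets[OF measurable_N]) auto
qed auto

lemma NA_inter_sigma: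
  "sigma_sets (space M) (\<Inter>s\<in>{t<..}. sets (null_augmented M N (min s T))) =
   (\<Inter>s\<in>{t<..}. sets (null_augmented M N (min s T)))"
proof (intro equalityI INT_greatest)
  fix s assume s: "s \<in> {t<..}"
  have "sigma_sets (space M) (\<Inter>s\<in>{t<..}. sets (null_augmented M N (min s T))) \<subseteq>
      sigma_sets (space M) (sets (null_augmented M N (min s T)))"
    using s by (intro sigma_sets_mono') auto
  then show "sigma_sets (space M) (\<Inter>s\<in>{t<..}. sets (null_augmented M N (min s T))) \<subseteq>
      sets (null_augmented M N (min s T))"
    using sets.sigma_sets_eq[of "null_augmented M N (min s T)"] by (simp add: space_NA)
qed auto

lemma NA_inter_Pow: "(\<Inter>s\<in>{t<..}. sets (null_augmented M N (min s T))) \<subseteq> Pow (space M)"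
proof
  fix A assume A: "A \<in> (\<Inter>s\<in>{t<..}. sets (null_augmented M N (min s T)))"
  then have "A \<in> sets (null_augmented M N (min (t + 1) T))" by auto
  then show "A \<in> Pow (space M)" using sets.sets_into_space space_NA by blast
qed

lemma space_filt: "space (filt M T N t) = space M"
  unfolding filt_def using NA_inter_Pow by (rule space_measure_of)

lemma sets_filt: "sets (filt M T N t) = (\<Inter>s\<in>{t<..}. sets (null_augmented M N (min s T)))"
  unfolding filt_def using NA_inter_sigma NA_inter_Pow by (simp add: sets_measure_of)

lemma filt_subset_NA: "s < t \<Longrightarrow> t \<le> T \<Longrightarrow> sets (filt M T N s) \<subseteq> sets (null_augmented M N t)"
  unfolding sets_filt by (metis INF_lower greaterThan_iff min.absorb1)

lemma NA_subset_filt: "s \<le> T \<Longrightarrow> sets (null_augmented M N s) \<subseteq> sets (filt M T N s)"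
  unfolding sets_filt by (intro INT_greatest NA_mono) auto

lemma sets_filt_T: "sets (filt M T N T) = sets (null_augmented M N T)"
  unfolding sets_filt by (auto simp: min_def)

lemma filt_mono: "s \<le> t \<Longrightarrow> sets (filt M T N s) \<subseteq> sets (filt M T N t)"
  unfolding sets_filt by auto

lemma filt_subset: "sets (filt M T N t) \<subseteq> sets M"
proof -
  have "sets (filt M T N t) \<subseteq> sets (null_augmented M N (min (t + 1) T))"
    unfolding sets_filt by auto
  then show ?thesis using NA_subset[of "min (t + 1) T"] by auto
qed

lemma subalgebra_filt: "subalgebra M (filt M T N t)"
  using filt_subset space_filt by (auto simp: subalgebra_def)

lemma subalgebra_NA: "t \<le> T \<Longrightarrow> subalgebra M (null_augmented M N t)"
  using NA_subset space_NA by (auto simp: subalgebra_def)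

lemma measurable_N_filt:
  assumes "0 \<le> s" "s \<le> t" "t \<le> T"
  shows "(\<lambda>\<omega>. real (N s \<omega>)) \<in> borel_measurable (filt M T N t)"
proof -
  have "N s \<in> measurable (null_augmented M N t) (count_space UNIV)"
  proof (rule measurableI)
    fix A :: "nat set" assume "A \<in> sets (count_space UNIV)"
    show "N s -` A \<inter> space (null_augmented M N t) \<in> sets (null_augmented M N t)"
      unfolding space_NA sets_NA using assms by (intro sigma_sets.Basic) auto
  qed auto
  then have "(\<lambda>\<omega>. real (N s \<omega>)) \<in> borel_measurable (null_augmented M N t)"
    by (rule measurable_compose) auto
  then show ?thesis
    by (rule measurable_from_subalg[rotated])
      (use NA_subset_filt[of t] assms in \<open>auto simp: subalgebra_def space_NA space_filt\<close>)
qed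

end

section \<open>The Mecke formula on events prescribing finitely many counts\<close>

lemma finite_set_as_grid:
  fixes S :: "real set"
  assumes "finite S" "S \<noteq> {}"
  obtains n ts where "\<And>i. i < n \<Longrightarrow> ts i < ts (Suc i)" "S = ts ` {..n}"
proof -
  define xs where "xs = sorted_list_of_set S"
  have len: "0 < length xs" using assms unfolding xs_def by (auto simp: card_gt_0_iff)
  have "sorted_wrt (<) xs" unfolding xs_def by (rule strict_sorted_list_of_set)
  then have "xs ! i < xs ! Suc i" if "i < length xs - 1" for i
    using that sorted_wrt_nth_less[of "(<)" xs i "Suc i"] by auto
  moreover have "S = (!) xs ` {..length xs - 1}"
  proof -
    have "{..length xs - 1} = {..<length xs}" using len by (metis Suc_diff_1 lessThan_Suc_atMost)
    then show ?thesis using assms nth_image[of "length xs" xs] by (simp add: xs_def lessThan_atLeast0)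
  qed
  ultimately show thesis using that[of "length xs - 1" "(!) xs"] by blast
qed

lemma grid_less:
  fixes ts :: "nat \<Rightarrow> real"
  assumes "\<And>i. i < n \<Longrightarrow> ts i < ts (Suc i)" "i < j" "j \<le> n"
  shows "ts i < ts j"
  using assms(2,3)
proof (induction j)
  case (Suc j)
  then have "ts j < ts (Suc j)" using assms(1) by simp
  with Suc show ?case by (cases "i = j") (auto intro: less_trans)
qed simp

lemma eq_iff_increments_eq:
  fixes w v :: "nat \<Rightarrow> nat"
  assumes "w 0 = v 0" "\<And>i. i < n \<Longrightarrow> w i \<le> w (Suc i)" "\<And>i. i < n \<Longrightarrow> v i \<le> v (Suc i)"
  shows "(\<forall>i\<le>n. w i = v i) \<longleftrightarrow> (\<forall>i<n. w (Suc i) - w i = v (Suc i) - v i)"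
proof
  assume R: "\<forall>i<n. w (Suc i) - w i = v (Suc i) - v i"
  show "\<forall>i\<le>n. w i = v i"
  proof (intro allI impI)
    fix i assume "i \<le> n"
    then show "w i = v i"
    proof (induction i)
      case (Suc i)
      then have "w (Suc i) - w i = v (Suc i) - v i" "w i = v i" using R[rule_format, of i] by auto
      moreover have "w i \<le> w (Suc i)" "v i \<le> v (Suc i)" using Suc assms(2)[of i] assms(3)[of i] by auto
      ultimately show ?case by linarith
    qed (use assms in simp)
  qed
next
  assume L: "\<forall>i\<le>n. w i = v i"
  show "\<forall>i<n. w (Suc i) - w i = v (Suc i) - v i"
  proof (intro allI impI)
    fix i assume "i < n"
    then show "w (Suc i) - w i = v (Suc i) - v i"
      using L[rule_format, of i] L[rule_format, of "Suc i"] by simp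
  qed
qed

context poisson_setting
begin

lemma measurable_insert_conf [measurable]:
  "(\<lambda>x. insert (fst x) (conf (snd x))) \<in> measurable prodM (config_space T)"
proof -
  have "(\<lambda>x. (fst x, conf (snd x))) \<in> measurable prodM (time_measure T \<Otimes>\<^sub>M config_space T)"
    by measurable
  from measurable_compose[OF this measurable_insert_config] show ?thesis by simp
qed

lemma emeasure_time: "0 \<le> x \<Longrightarrow> x \<le> y \<Longrightarrow> y \<le> T \<Longrightarrow> emeasure (time_measure T) {x<..y} = ennreal (y - x)"
  unfolding time_measure_def by (subst emeasure_restrict_space) auto

lemma sets_time: "0 \<le> x \<Longrightarrow> y \<le> T \<Longrightarrow> {x<..y} \<in> sets (time_measure T)"
  unfolding time_measure_def by (subst sets_restrict_space_iff) auto

lemma prob_increments: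
  assumes ts: "0 \<le> ts 0" "\<And>i. i < n \<Longrightarrow> ts i < ts (Suc i)" "ts n \<le> T"
  shows "prob {\<omega> \<in> space M. \<forall>i<n. N (ts (Suc i)) \<omega> - N (ts i) \<omega> = k i} =
    (\<Prod>i<n. pmf (poisson_pmf (lam * (ts (Suc i) - ts i))) (k i))"
proof (cases "n = 0")
  case True then show ?thesis using prob_space by simp
next
  case False
  have "prob (\<Inter>i\<in>{..<n}. (\<lambda>\<omega>. N (ts (Suc i)) \<omega> - N (ts i) \<omega>) -` {k i} \<inter> space M) =
      (\<Prod>i<n. prob ((\<lambda>\<omega>. N (ts (Suc i)) \<omega> - N (ts i) \<omega>) -` {k i} \<inter> space M))"
    using False ts by (intro indep_varsD_finite[OF increments_indep]) auto
  also have "(\<Inter>i\<in>{..<n}. (\<lambda>\<omega>. N (ts (Suc i)) \<omega> - N (ts i) \<omega>) -` {k i} \<inter> space M) =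
      {\<omega> \<in> space M. \<forall>i<n. N (ts (Suc i)) \<omega> - N (ts i) \<omega> = k i}" using False by auto
  also have "(\<Prod>i<n. prob ((\<lambda>\<omega>. N (ts (Suc i)) \<omega> - N (ts i) \<omega>) -` {k i} \<inter> space M)) =
      (\<Prod>i<n. pmf (poisson_pmf (lam * (ts (Suc i) - ts i))) (k i))"
  proof (rule prod.cong[OF refl])
    fix i assume i: "i \<in> {..<n}"
    have "ts 0 \<le> ts i" "ts (Suc i) \<le> ts n"
      using grid_less[of n ts 0 i] grid_less[of n ts "Suc i" n] ts(2) i
      by (cases "i = 0"; cases "Suc i = n"; force)+
    then have "prob {\<omega> \<in> space M. N (ts (Suc i)) \<omega> - N (ts i) \<omega> \<in> {k i}} =
        measure (measure_pmf (poisson_pmf (lam * (ts (Suc i) - ts i)))) {k i}"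
      using ts i by (intro prob_increment) auto
    moreover have "(\<lambda>\<omega>. N (ts (Suc i)) \<omega> - N (ts i) \<omega>) -` {k i} \<inter> space M =
        {\<omega> \<in> space M. N (ts (Suc i)) \<omega> - N (ts i) \<omega> \<in> {k i}}" by auto
    ultimately show "prob ((\<lambda>\<omega>. N (ts (Suc i)) \<omega> - N (ts i) \<omega>) -` {k i} \<inter> space M) =
        pmf (poisson_pmf (lam * (ts (Suc i) - ts i))) (k i)" by (simp add: measure_pmf_single)
  qed
  finally show ?thesis .
qed

text \<open>
  The elementary fact behind the whole argument: if \<open>p\<close> is the Poisson weight with
  parameter \<open>\<mu>\<close>, then \<open>k p(k) = \<mu> p(k - 1)\<close>. Weighting an event by one increment is the same as
  adding one point to the corresponding interval.
\<close>

lemma prob_increments_shift: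
  assumes ts: "0 \<le> ts 0" "\<And>i. i < n \<Longrightarrow> ts i < ts (Suc i)" "ts n \<le> T" and j: "j < n"
  shows "lam * (ts (Suc j) - ts j) * prob {\<omega> \<in> space M. 1 \<le> m j \<and>
      (\<forall>i<n. N (ts (Suc i)) \<omega> - N (ts i) \<omega> = m i - (if i = j then 1 else 0))} =
    real (m j) * prob {\<omega> \<in> space M. \<forall>i<n. N (ts (Suc i)) \<omega> - N (ts i) \<omega> = m i}"
proof (cases "m j")
  case 0 then show ?thesis by simp
next
  case (Suc k)
  let ?r = "\<lambda>i. lam * (ts (Suc i) - ts i)"
  let ?P = "\<Prod>i\<in>{..<n} - {j}. pmf (poisson_pmf (?r i)) (m i)"
  have r: "0 < ?r j" using ts j lam_pos by simp
  have "(\<Prod>i<n. pmf (poisson_pmf (?r i)) (m i - (if i = j then 1 else 0))) =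
      pmf (poisson_pmf (?r j)) k * ?P"
    using j Suc by (subst prod.remove[of _ j]) (auto intro!: prod.cong)
  then have "prob {\<omega> \<in> space M. \<forall>i<n. N (ts (Suc i)) \<omega> - N (ts i) \<omega> = m i - (if i = j then 1 else 0)} =
      pmf (poisson_pmf (?r j)) k * ?P"
    using prob_increments[of ts n "\<lambda>i. m i - (if i = j then 1 else 0)", OF ts] by metis
  moreover have "(\<Prod>i<n. pmf (poisson_pmf (?r i)) (m i)) = pmf (poisson_pmf (?r j)) (Suc k) * ?P"
    using j Suc by (subst prod.remove[of _ j]) auto
  then have "prob {\<omega> \<in> space M. \<forall>i<n. N (ts (Suc i)) \<omega> - N (ts i) \<omega> = m i} =
      pmf (poisson_pmf (?r j)) (Suc k) * ?P"
    using prob_increments[of ts n m, OF ts] by metis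
  moreover have "?r j * pmf (poisson_pmf (?r j)) k = real (Suc k) * pmf (poisson_pmf (?r j)) (Suc k)"
    using r by (simp add: field_simps del: of_nat_Suc)
  ultimately show ?thesis using Suc by (simp add: mult.assoc[symmetric] del: pmf_poisson of_nat_Suc)
qed

text \<open>
  The two sides of the Mecke formula, read as measures on configurations.
\<close>

definition weighted_law :: "real \<Rightarrow> real \<Rightarrow> real set measure" where
  "weighted_law a b = distr (density M (\<lambda>\<omega>. ennreal (real (N b \<omega>) - real (N a \<omega>)))) (config_space T) conf"

definition added_law :: "real \<Rightarrow> real \<Rightarrow> real set measure" where
  "added_law a b = distr (density prodM (\<lambda>x. ennreal (lam * indicator {a<..b} (fst x))))
     (config_space T) (\<lambda>x. insert (fst x) (conf (snd x)))"

lemma emeasure_weighted_law: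
  assumes "0 \<le> a" "a \<le> b" "b \<le> T" "C \<in> sets (config_space T)"
  shows "emeasure (weighted_law a b) C =
    (\<integral>\<^sup>+\<omega>. ennreal (real (N b \<omega>) - real (N a \<omega>)) * indicator C (conf \<omega>) \<partial>M)"
proof -
  have [measurable]: "(\<lambda>\<omega>. real (N b \<omega>)) \<in> borel_measurable M" "(\<lambda>\<omega>. real (N a \<omega>)) \<in> borel_measurable M"
    using assms by auto
  have C: "conf -` C \<inter> space M \<in> sets M" using assms by measurable
  have "emeasure (weighted_law a b) C = emeasure (density M (\<lambda>\<omega>. ennreal (real (N b \<omega>) - real (N a \<omega>)))) (conf -` C \<inter> space M)"
    unfolding weighted_law_def using assms by (subst emeasure_distr) auto
  also have "\<dots> = (\<integral>\<^sup>+\<omega>. ennreal (real (N b \<omega>) - real (N a \<omega>)) * indicator (conf -` C \<inter> space M) \<omega> \<partial>M)"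
    using C by (subst emeasure_density) auto
  also have "\<dots> = (\<integral>\<^sup>+\<omega>. ennreal (real (N b \<omega>) - real (N a \<omega>)) * indicator C (conf \<omega>) \<partial>M)"
    by (intro nn_integral_cong) (auto simp: indicator_def)
  finally show ?thesis .
qed

lemma emeasure_added_law:
  assumes "C \<in> sets (config_space T)"
  shows "emeasure (added_law a b) C =
    (\<integral>\<^sup>+x. ennreal (lam * indicator {a<..b} (fst x)) * indicator C (insert (fst x) (conf (snd x))) \<partial>prodM)"
proof -
  have [measurable]: "(\<lambda>x. ennreal (lam * indicator {a<..b} (fst x))) \<in> borel_measurable prodM" by measurable
  have C: "(\<lambda>x. insert (fst x) (conf (snd x))) -` C \<inter> space prodM \<in> sets prodM"
    using assms by measurable
  have "emeasure (added_law a b) C = emeasure (density prodM (\<lambda>x. ennreal (lam * indicator {a<..b} (fst x))))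
     ((\<lambda>x. insert (fst x) (conf (snd x))) -` C \<inter> space prodM)"
    unfolding added_law_def using assms by (subst emeasure_distr) auto
  also have "\<dots> = (\<integral>\<^sup>+x. ennreal (lam * indicator {a<..b} (fst x)) *
      indicator ((\<lambda>x. insert (fst x) (conf (snd x))) -` C \<inter> space prodM) x \<partial>prodM)"
    using C by (subst emeasure_density) auto
  also have "\<dots> = (\<integral>\<^sup>+x. ennreal (lam * indicator {a<..b} (fst x)) * indicator C (insert (fst x) (conf (snd x))) \<partial>prodM)"
    by (intro nn_integral_cong) (auto simp: indicator_def)
  finally show ?thesis .
qed

lemma sets_count_eq:
  "finite S \<Longrightarrow> {\<eta> \<in> configurations T. \<forall>s\<in>S. card (\<eta> \<inter> {0..s}) = v s} \<in> sets (config_space T)"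
proof -
  assume "finite S"
  have "{\<eta> \<in> configurations T. card (\<eta> \<inter> {0..s}) = k} \<in> sets (config_space T)" for s k
  proof -
    have "(\<lambda>\<eta>. card (\<eta> \<inter> {0..s})) -` {k} \<inter> space (config_space T) \<in> sets (config_space T)"
      using measurable_count[where t=s and T=T] by (rule measurable_sets) simp
    moreover have "(\<lambda>\<eta>. card (\<eta> \<inter> {0..s})) -` {k} \<inter> space (config_space T) = {\<eta> \<in> configurations T. card (\<eta> \<inter> {0..s}) = k}"
      by (auto simp: space_config_space)
    ultimately show ?thesis by simp
  qed
  then have "{\<eta> \<in> space (config_space T). \<forall>s\<in>S. card (\<eta> \<inter> {0..s}) = v s} \<in> sets (config_space T)"
    using \<open>finite S\<close> by (intro sets.sets_Collect_finite_All) (auto simp: space_config_space)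
  then show ?thesis by (simp add: space_config_space)
qed

text \<open>
  Prescribing the counts by those of a configuration \<open>\<eta>0\<close> makes them monotone, so that they
  are equivalent to prescribed increments on the grid \<open>S\<close>. The weight \<open>N b - N a\<close> is constant on the
  event. A point added in a cell of the grid belongs to the event exactly if the increment over that cell
  was smaller by one before; summing \<open>prob_increments_shift\<close> over the cells between \<open>a\<close> and \<open>b\<close> gives
  the claim.
\<close>

lemma weighted_eq_added_on_cylinder:
  assumes ab: "0 \<le> a" "a < b" "b \<le> T"
    and S: "finite S" "{0, a, b, T} \<subseteq> S" "S \<subseteq> {0..T}"
    and \<eta>0: "\<eta>0 \<in> configurations T"
    and C_def: "C = {\<eta> \<in> configurations T. \<forall>s\<in>S. card (\<eta> \<inter> {0..s}) = card (\<eta>0 \<inter> {0..s})}"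
  shows "emeasure (weighted_law a b) C = emeasure (added_law a b) C"
    and "emeasure (weighted_law a b) C < \<infinity>"
proof -
  have C: "C \<in> sets (config_space T)" unfolding C_def by (rule sets_count_eq[OF S(1)])
  obtain n ts where ts: "\<And>i. i < n \<Longrightarrow> ts i < ts (Suc i)" "S = ts ` {..n}"
    using finite_set_as_grid[OF S(1)] S(2) by blast
  have less: "ts i < ts j" if "i < j" "j \<le> n" for i j using grid_less[of n ts i j] ts(1) that by blast
  have le: "ts i \<le> ts j" if "i \<le> j" "j \<le> n" for i j using less[of i j] that by (cases "i = j") auto
  have inS: "ts i \<in> {0..T}" if "i \<le> n" for i using that ts(2) S(3) by auto
  obtain i0 where i0: "i0 \<le> n" "ts i0 = 0" using S(2) ts(2) by auto
  have ts0: "ts 0 = 0" using le[of 0 i0] i0 inS[of 0] by auto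
  have tsn: "ts n \<le> T" using inS[of n] by simp
  obtain p where p: "p \<le> n" "ts p = a" using S(2) ts(2) by auto
  obtain q where q: "q \<le> n" "ts q = b" using S(2) ts(2) by auto
  have pq: "p < q" using le[of q p] p q ab by (cases "p < q") auto
  define v where "v i = card (\<eta>0 \<inter> {0..ts i})" for i
  have fin0: "finite \<eta>0" using \<eta>0 by (auto simp: configurations_def)
  have vmono: "v i \<le> v j" if "i \<le> j" "j \<le> n" for i j
    unfolding v_def using le[OF that] fin0 by (intro card_mono) auto
  define m where "m i = v (Suc i) - v i" for i
  have C_iff: "\<eta> \<in> C \<longleftrightarrow> (\<forall>i\<le>n. card (\<eta> \<inter> {0..ts i}) = v i)" if "\<eta> \<in> configurations T" for \<eta>
    using that unfolding C_def ts(2) v_def by auto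
  \<comment> \<open>\<open>E\<close>: the path lies in the event; \<open>E' j\<close>: it does after a point was added in cell \<open>j\<close>. Both are empty
    if \<open>\<eta>0\<close> has a point at time zero.\<close>
  define E where "E = {\<omega> \<in> space M. v 0 = 0 \<and> (\<forall>i<n. N (ts (Suc i)) \<omega> - N (ts i) \<omega> = m i)}"
  define E' where "E' j = {\<omega> \<in> space M. v 0 = 0 \<and> 1 \<le> m j \<and>
      (\<forall>i<n. N (ts (Suc i)) \<omega> - N (ts i) \<omega> = m i - (if i = j then 1 else 0))}" for j
  have incr: "{\<omega> \<in> space M. \<forall>i<n. N (ts (Suc i)) \<omega> - N (ts i) \<omega> = k i} \<in> sets M" for k
  proof (rule sets.sets_Collect_countable_All)
    fix i
    have "{\<omega> \<in> space M. N (ts (Suc i)) \<omega> - N (ts i) \<omega> = k i} \<in> sets M" if "i < n"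
    proof -
      have "(\<lambda>\<omega>. N (ts (Suc i)) \<omega> - N (ts i) \<omega>) -` {k i} \<inter> space M \<in> sets M"
        using that inS[of i] inS[of "Suc i"] ts(1)[OF that] by (intro measurable_sets[OF measurable_increment]) auto
      moreover have "(\<lambda>\<omega>. N (ts (Suc i)) \<omega> - N (ts i) \<omega>) -` {k i} \<inter> space M = {\<omega> \<in> space M. N (ts (Suc i)) \<omega> - N (ts i) \<omega> = k i}"
        by auto
      ultimately show ?thesis by simp
    qed
    then show "{\<omega> \<in> space M. i < n \<longrightarrow> N (ts (Suc i)) \<omega> - N (ts i) \<omega> = k i} \<in> sets M"
      by (cases "i < n") auto
  qed
  have E: "E \<in> sets M" unfolding E_def by (rule sets.sets_Collect_conj[OF incr sets.sets_Collect_const])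
  have E': "E' j \<in> sets M" for j
    unfolding E'_def
    by (rule sets.sets_Collect_conj[OF sets.sets_Collect_conj[OF incr sets.sets_Collect_const]
          sets.sets_Collect_const])
  have shift: "lam * (ts (Suc j) - ts j) * prob (E' j) = real (m j) * prob E" if "j < n" for j
    using prob_increments_shift[of ts n j m] ts0 ts(1) tsn that
    unfolding E_def E'_def by (cases "v 0 = 0") auto
  have AE_E: "AE \<omega> in M. conf \<omega> \<in> C \<longleftrightarrow> \<omega> \<in> E"
    using AE_count AE_space
  proof eventually_elim
    case (elim \<omega>)
    have "conf \<omega> \<in> C \<longleftrightarrow> (\<forall>i\<le>n. N (ts i) \<omega> = v i)"
      using C_iff[OF conf_in_configurations[OF elim(2)]] elim(1) inS by auto
    also have "\<dots> \<longleftrightarrow> \<omega> \<in> E"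
    proof (cases "v 0 = 0")
      case True
      then show ?thesis
        using eq_iff_increments_eq[of "\<lambda>i. N (ts i) \<omega>" v n] vmono ts0 N_zero[OF elim(2)] N_mono[OF elim(2)]
          inS le elim(2)
        unfolding E_def m_def by auto
    next
      case False
      then have "N (ts 0) \<omega> \<noteq> v 0" using ts0 N_zero[OF elim(2)] by simp
      then show ?thesis using False unfolding E_def by auto
    qed
    finally show ?case .
  qed
  have AE_E': "AE x in prodM. \<forall>j<n. fst x \<in> {ts j<..ts (Suc j)} \<longrightarrow>
      (insert (fst x) (conf (snd x)) \<in> C \<longleftrightarrow> snd x \<in> E' j)"
  proof -
    have "AE x in prodM. \<forall>t\<in>{0..T}. card (conf (snd x) \<inter> {0..t}) = N t (snd x)"
      using AE_prod_snd[OF AE_count] .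
    then show ?thesis using AE_not_in_conf AE_space
    proof eventually_elim
      case (elim x)
      obtain r \<omega> where x: "x = (r, \<omega>)" by (cases x)
      have \<omega>: "\<omega> \<in> space M" and r: "r \<in> {0..T}" using elim(3) by (auto simp: x space_pair_measure space_time_measure)
      show ?case
      proof (intro allI impI)
        fix j assume j: "j < n" "fst x \<in> {ts j<..ts (Suc j)}"
        define w where "w i = N (ts i) \<omega> + (if j < i then 1 else 0)" for i
        have rle: "r \<le> ts i \<longleftrightarrow> j < i" if "i \<le> n" for i
        proof (cases "j < i")
          case True then show ?thesis using le[of "Suc j" i] that j x by auto
        next
          case False then show ?thesis using le[of i j] that j x by auto
        qed
        have "card (insert r (conf \<omega>) \<inter> {0..ts i}) = w i" if "i \<le> n" for i
          using card_insert_count[OF finite_conf[OF \<omega>], of r "ts i"] r elim(1,2) rle[OF that] inS[OF that]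
          by (auto simp: x w_def)
        then have "insert r (conf \<omega>) \<in> C \<longleftrightarrow> (\<forall>i\<le>n. w i = v i)"
          using C_iff[OF insert_configurations[OF r conf_in_configurations[OF \<omega>]]] by auto
        also have "\<dots> \<longleftrightarrow> \<omega> \<in> E' j"
        proof (cases "v 0 = 0")
          case False
          then have "w 0 \<noteq> v 0" using ts0 N_zero[OF \<omega>] by (simp add: w_def)
          then show ?thesis using False unfolding E'_def by auto
        next
          case True
          have Nm: "N (ts i) \<omega> \<le> N (ts (Suc i)) \<omega>" if "i < n" for i
            using N_mono[OF \<omega>, of "ts i" "ts (Suc i)"] inS[of i] inS[of "Suc i"] ts(1)[OF that] that by auto
          have "(\<forall>i\<le>n. w i = v i) \<longleftrightarrow> (\<forall>i<n. w (Suc i) - w i = m i)"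
            unfolding m_def
          proof (rule eq_iff_increments_eq)
            show "w 0 = v 0" using True ts0 N_zero[OF \<omega>] by (simp add: w_def)
            show "w i \<le> w (Suc i)" if "i < n" for i using Nm[OF that] by (auto simp: w_def)
          qed (use vmono in auto)
          also have "\<dots> \<longleftrightarrow> (\<forall>i<n. N (ts (Suc i)) \<omega> - N (ts i) \<omega> + (if i = j then 1 else 0) = m i)"
          proof (intro all_cong1 imp_cong refl)
            fix i assume "i < n"
            then have "w (Suc i) - w i = N (ts (Suc i)) \<omega> - N (ts i) \<omega> + (if i = j then 1 else 0)"
              using Nm[of i] by (auto simp: w_def)
            then show "(w (Suc i) - w i = m i) =
                (N (ts (Suc i)) \<omega> - N (ts i) \<omega> + (if i = j then 1 else 0) = m i)" by simp
          qed
          also have "\<dots> \<longleftrightarrow> \<omega> \<in> E' j"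
            unfolding E'_def using j(1) True \<omega> by (force split: if_splits)
          finally show ?thesis .
        qed
        finally show "insert (fst x) (conf (snd x)) \<in> C \<longleftrightarrow> snd x \<in> E' j" by (simp add: x)
      qed
    qed
  qed
  have "emeasure (weighted_law a b) C = (\<integral>\<^sup>+\<omega>. ennreal (real (N b \<omega>) - real (N a \<omega>)) * indicator C (conf \<omega>) \<partial>M)"
    using ab C by (intro emeasure_weighted_law) auto
  also have "\<dots> = (\<integral>\<^sup>+\<omega>. ennreal (real (v q - v p)) * indicator E \<omega> \<partial>M)"
  proof (rule nn_integral_cong_AE)
    show "AE \<omega> in M. ennreal (real (N b \<omega>) - real (N a \<omega>)) * indicator C (conf \<omega>) = ennreal (real (v q - v p)) * indicator E \<omega>"
      using AE_E AE_count AE_space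
    proof eventually_elim
      case (elim \<omega>)
      have "N b \<omega> = v q \<and> N a \<omega> = v p" if "conf \<omega> \<in> C"
        using C_iff[OF conf_in_configurations[OF elim(3)]] that p q elim(2) inS by auto
      then show ?case using elim(1) vmono[of p q] pq q by (auto simp: indicator_def of_nat_diff)
    qed
  qed
  also have "\<dots> = ennreal (real (v q - v p)) * emeasure M E"
    using E by (rule nn_integral_cmult_indicator)
  also have "\<dots> = ennreal (real (v q - v p) * prob E)"
    by (simp add: emeasure_eq_measure ennreal_mult)
  finally have L: "emeasure (weighted_law a b) C = ennreal (real (v q - v p) * prob E)" .
  then show "emeasure (weighted_law a b) C < \<infinity>" by simp
  have "emeasure (added_law a b) C =
      (\<integral>\<^sup>+x. ennreal (lam * indicator {a<..b} (fst x)) * indicator C (insert (fst x) (conf (snd x))) \<partial>prodM)"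
    using C by (rule emeasure_added_law)
  also have "\<dots> = (\<integral>\<^sup>+x. (\<Sum>j\<in>{p..<q}. ennreal lam * indicator ({ts j<..ts (Suc j)} \<times> E' j) x) \<partial>prodM)"
  proof (rule nn_integral_cong_AE)
    show "AE x in prodM. ennreal (lam * indicator {a<..b} (fst x)) * indicator C (insert (fst x) (conf (snd x))) =
        (\<Sum>j\<in>{p..<q}. ennreal lam * indicator ({ts j<..ts (Suc j)} \<times> E' j) x)"
      using AE_E'
    proof eventually_elim
      case (elim x)
      show ?case
      proof (cases "fst x \<in> {a<..b}")
        case False
        have "fst x \<notin> {ts j<..ts (Suc j)}" if "j \<in> {p..<q}" for j
          using False le[of p j] le[of "Suc j" q] that p q by auto
        then have "(\<Sum>j\<in>{p..<q}. ennreal lam * indicator ({ts j<..ts (Suc j)} \<times> E' j) x) = 0"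
          by (intro sum.neutral) (auto simp: indicator_def mem_Times_iff)
        then show ?thesis using False by simp
      next
        case True
        have "\<exists>j\<in>{p..<q}. fst x \<in> {ts j<..ts (Suc j)}"
        proof -
          \<comment> \<open>the cell that contains the added point\<close>
          define Q where "Q i \<longleftrightarrow> i \<le> n \<and> ts i < fst x" for i
          define j where "j = Greatest Q"
          have ex: "Q p" unfolding Q_def using p True by auto
          have bound: "\<And>y. Q y \<Longrightarrow> y \<le> n" unfolding Q_def by simp
          have j: "j \<le> n \<and> ts j < fst x" using GreatestI_nat[of Q, OF ex bound] unfolding j_def Q_def by auto
          have pj: "p \<le> j" unfolding j_def using ex bound by (rule Greatest_le_nat)
          have jq: "j < q" using le[of q j] j q True by (cases "j < q") auto
          have "\<not> ts (Suc j) < fst x"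
          proof
            assume "ts (Suc j) < fst x"
            then have "Q (Suc j)" using jq q(1) unfolding Q_def by auto
            then have "Suc j \<le> j" using bound unfolding j_def by (rule Greatest_le_nat)
            then show False by simp
          qed
          then show ?thesis using j pj jq by auto
        qed
        then obtain j where j: "j \<in> {p..<q}" "fst x \<in> {ts j<..ts (Suc j)}" by auto
        have uniq: "fst x \<notin> {ts i<..ts (Suc i)}" if "i \<in> {p..<q}" "i \<noteq> j" for i
          using j that le[of "Suc i" j] le[of "Suc j" i] q(1) by (cases "i < j") auto
        have "(\<Sum>i\<in>{p..<q}. ennreal lam * indicator ({ts i<..ts (Suc i)} \<times> E' i) x) =
            ennreal lam * indicator ({ts j<..ts (Suc j)} \<times> E' j) x"
        proof -
          have "(\<Sum>i\<in>{p..<q} - {j}. ennreal lam * indicator ({ts i<..ts (Suc i)} \<times> E' i) x) = 0"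
          proof (intro sum.neutral ballI)
            fix i assume "i \<in> {p..<q} - {j}"
            then show "ennreal lam * indicator ({ts i<..ts (Suc i)} \<times> E' i) x = 0"
              using uniq[of i] by (auto simp: indicator_def mem_Times_iff)
          qed
          then show ?thesis using j(1) by (subst sum.remove[of _ j]) auto
        qed
        moreover have "insert (fst x) (conf (snd x)) \<in> C \<longleftrightarrow> snd x \<in> E' j"
          using elim j q(1) by auto
        ultimately show ?thesis using j True by (auto simp: indicator_def mem_Times_iff)
      qed
    qed
  qed
  also have "\<dots> = (\<Sum>j\<in>{p..<q}. \<integral>\<^sup>+x. ennreal lam * indicator ({ts j<..ts (Suc j)} \<times> E' j) x \<partial>prodM)"
    using E' inS q(1) by (intro nn_integral_sum borel_measurable_times_ennreal borel_measurable_indicator)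
      (auto intro!: pair_measureI sets_time simp: Suc_le_eq)
  also have "\<dots> = (\<Sum>j\<in>{p..<q}. ennreal (lam * (ts (Suc j) - ts j) * prob (E' j)))"
  proof (rule sum.cong[OF refl])
    fix j assume j: "j \<in> {p..<q}"
    have b: "0 \<le> ts j" "ts j \<le> ts (Suc j)" "ts (Suc j) \<le> T"
      using inS[of j] inS[of "Suc j"] le[of j "Suc j"] j q(1) by auto
    have s: "{ts j<..ts (Suc j)} \<times> E' j \<in> sets prodM"
      using E' b by (intro pair_measureI sets_time) auto
    have "(\<integral>\<^sup>+x. ennreal lam * indicator ({ts j<..ts (Suc j)} \<times> E' j) x \<partial>prodM) =
        ennreal lam * emeasure prodM ({ts j<..ts (Suc j)} \<times> E' j)"
      using s by (rule nn_integral_cmult_indicator)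
    also have "emeasure prodM ({ts j<..ts (Suc j)} \<times> E' j) = ennreal (ts (Suc j) - ts j) * ennreal (prob (E' j))"
      using E' b sets_time emeasure_time by (subst emeasure_pair_measure_Times) (auto simp: emeasure_eq_measure)
    also have "ennreal lam * (ennreal (ts (Suc j) - ts j) * ennreal (prob (E' j))) =
        ennreal (lam * (ts (Suc j) - ts j) * prob (E' j))"
      using lam_pos b by (simp add: ennreal_mult mult.assoc)
    finally show "(\<integral>\<^sup>+x. ennreal lam * indicator ({ts j<..ts (Suc j)} \<times> E' j) x \<partial>prodM) =
        ennreal (lam * (ts (Suc j) - ts j) * prob (E' j))" .
  qed
  also have "\<dots> = (\<Sum>j\<in>{p..<q}. ennreal (real (m j) * prob E))"
    using shift q(1) by (intro sum.cong refl) auto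
  also have "\<dots> = ennreal ((\<Sum>j\<in>{p..<q}. real (m j)) * prob E)"
    by (subst sum_ennreal) (auto simp: sum_distrib_right)
  also have "(\<Sum>j\<in>{p..<q}. real (m j)) = real (v q - v p)"
  proof -
    have "(\<Sum>j\<in>{p..<q}. real (m j)) = (\<Sum>j\<in>{p..<q}. real (v (Suc j)) - real (v j))"
      using vmono q(1) by (intro sum.cong) (auto simp: m_def of_nat_diff)
    also have "\<dots> = real (v q) - real (v p)" using pq by (intro sum_Suc_diff') simp
    finally show ?thesis using vmono[of p q] pq q by (simp add: of_nat_diff)
  qed
  finally show "emeasure (weighted_law a b) C = emeasure (added_law a b) C" using L by simp
qed

section \<open>The Mecke formula\<close>

definition config_cylinder :: "(real \<times> nat) list \<Rightarrow> real set set" where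
  "config_cylinder L = {\<eta> \<in> configurations T. \<forall>p\<in>set L. card (\<eta> \<inter> {0..fst p}) = snd p}"

lemma config_cylinder_append: "config_cylinder L \<inter> config_cylinder L' = config_cylinder (L @ L')"
  unfolding config_cylinder_def set_append ball_Un by blast

text \<open>
  The generating cylinders may be required to prescribe the counts at given times \<open>A\<close>, for an event
  about one count is a countable union of such cylinders. This allows one to assume that the interval ends
  of the Mecke formula are among the prescribed times.
\<close>

lemma sets_config_space_cylinders:
  assumes "A \<subseteq> {0..T}" "finite A"
  shows "sets (config_space T) =
    sigma_sets (configurations T) {config_cylinder L | L. A \<subseteq> fst ` set L \<and> fst ` set L \<subseteq> {0..T}}"
    (is "_ = sigma_sets _ ?E")
proof
  obtain xs where xs: "set xs = A" using finite_list[OF assms(2)] by blast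
  show "sets (config_space T) \<subseteq> sigma_sets (configurations T) ?E"
    unfolding sets_config_space
  proof (rule sigma_sets_mono, safe)
    fix t :: real and k assume t: "t \<in> {0..T}"
    define U where "U ks = config_cylinder ((t, k) # zip xs ks)" for ks
    have "{\<eta> \<in> configurations T. card (\<eta> \<inter> {0..t}) = k} = (\<Union>ks\<in>{ks. length ks = length xs}. U ks)"
    proof safe
      fix \<eta> assume \<eta>: "\<eta> \<in> configurations T" "k = card (\<eta> \<inter> {0..t})"
      have "\<eta> \<in> U (map (\<lambda>s. card (\<eta> \<inter> {0..s})) xs)"
        using \<eta> unfolding U_def config_cylinder_def by (auto simp: in_set_zip)
      moreover have "length (map (\<lambda>s. card (\<eta> \<inter> {0..s})) xs) = length xs" by simp
      ultimately show "\<eta> \<in> (\<Union>ks\<in>{ks. length ks = length xs}. U ks)" by blast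
    qed (auto simp: U_def config_cylinder_def)
    also have "\<dots> \<in> sigma_sets (configurations T) ?E"
    proof (rule sigma_sets_UNION)
      show "countable (U ` {ks. length ks = length xs})" by (rule countable_image) simp
      fix B assume "B \<in> U ` {ks. length ks = length xs}"
      then obtain ks where ks: "length ks = length xs" "B = U ks" by auto
      have "fst ` set (zip xs ks) = A" using ks xs by (metis map_fst_zip set_map)
      then have eq: "fst ` set ((t, k) # zip xs ks) = insert t A" by simp
      have h: "A \<subseteq> fst ` set ((t, k) # zip xs ks) \<and> fst ` set ((t, k) # zip xs ks) \<subseteq> {0..T}"
        unfolding eq using t assms(1) by auto
      then show "B \<in> sigma_sets (configurations T) ?E"
        unfolding ks U_def by (intro sigma_sets.Basic) (use h in blast)
    qed
    finally show "{\<eta> \<in> configurations T. card (\<eta> \<inter> {0..t}) = k} \<in> sigma_sets (configurations T) ?E" .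
  qed
  have "config_cylinder L \<in> sets (config_space T)" for L
  proof -
    have "Measurable.pred (config_space T) (\<lambda>\<eta>. card (\<eta> \<inter> {0..s}) = k)" for s k
      using sets_count_eq[of "{s}" "\<lambda>_. k"] by (simp add: pred_def space_config_space)
    then have "{\<eta> \<in> space (config_space T). \<forall>p\<in>set L. card (\<eta> \<inter> {0..fst p}) = snd p} \<in> sets (config_space T)"
      by (intro sets.sets_Collect_finite_All) (auto simp: pred_def)
    then show ?thesis by (simp add: config_cylinder_def space_config_space case_prod_unfold)
  qed
  then show "sigma_sets (configurations T) ?E \<subseteq> sets (config_space T)"
    using sets.sigma_sets_subset[of ?E "config_space T"] by (auto simp: space_config_space)
qed

theorem weighted_law_eq_added_law:
  assumes ab: "0 \<le> a" "a < b" "b \<le> T"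
  shows "weighted_law a b = added_law a b"
proof -
  let ?A = "{0, a, b, T}"
  let ?E = "{config_cylinder L | L. ?A \<subseteq> fst ` set L \<and> fst ` set L \<subseteq> {0..T}}"
  let ?C = "{config_cylinder [(0, i), (a, j), (b, k), (T, l)] | i j k l. True}"
  have A: "?A \<subseteq> {0..T}" using ab by auto
  have s: "sets (weighted_law a b) = sigma_sets (configurations T) ?E"
     "sets (added_law a b) = sigma_sets (configurations T) ?E"
    using sets_config_space_cylinders[OF A] by (auto simp: weighted_law_def added_law_def)
  have eq: "emeasure (weighted_law a b) X = emeasure (added_law a b) X"
    and fin: "emeasure (weighted_law a b) X \<noteq> \<infinity>" if X: "X \<in> ?E" for X
  proof -
    obtain L where L: "X = config_cylinder L" "?A \<subseteq> fst ` set L" "fst ` set L \<subseteq> {0..T}" using X by auto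
    have "emeasure (weighted_law a b) X = emeasure (added_law a b) X \<and> emeasure (weighted_law a b) X \<noteq> \<infinity>"
    proof (cases "X = {}")
      case False
      then obtain \<eta>0 where \<eta>0: "\<eta>0 \<in> X" by auto
      have X_eq: "X = {\<eta> \<in> configurations T. \<forall>s\<in>fst ` set L. card (\<eta> \<inter> {0..s}) = card (\<eta>0 \<inter> {0..s})}"
        using \<eta>0 unfolding L(1) config_cylinder_def by fastforce
      have "\<eta>0 \<in> configurations T" using \<eta>0 L(1) by (auto simp: config_cylinder_def)
      from weighted_eq_added_on_cylinder[OF ab _ L(2,3) this X_eq] show ?thesis by auto
    qed simp
    then show "emeasure (weighted_law a b) X = emeasure (added_law a b) X"
      "emeasure (weighted_law a b) X \<noteq> \<infinity>" by auto
  qed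
  have CE: "?C \<subseteq> ?E"
  proof safe
    fix i j k l
    show "\<exists>L. config_cylinder [(0, i), (a, j), (b, k), (T, l)] = config_cylinder L \<and>
        ?A \<subseteq> fst ` set L \<and> fst ` set L \<subseteq> {0..T}"
      using ab by (intro exI[of _ "[(0, i), (a, j), (b, k), (T, l)]"]) auto
  qed
  show ?thesis
  proof (rule measure_eqI_generator_eq_countable[OF _ _ eq s CE])
    show "Int_stable ?E"
    proof (rule Int_stableI)
      fix X Y assume "X \<in> ?E" "Y \<in> ?E"
      then obtain L L' where L: "X = config_cylinder L" "?A \<subseteq> fst ` set L" "fst ` set L \<subseteq> {0..T}"
        and L': "Y = config_cylinder L'" "?A \<subseteq> fst ` set L'" "fst ` set L' \<subseteq> {0..T}" by auto
      have "?A \<subseteq> fst ` set (L @ L')" "fst ` set (L @ L') \<subseteq> {0..T}"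
        using L(2,3) L'(3) unfolding set_append image_Un by auto
      then show "X \<inter> Y \<in> ?E" unfolding L(1) L'(1) config_cylinder_append by blast
    qed
    show "?E \<subseteq> Pow (configurations T)" by (auto simp: config_cylinder_def)
    show "\<Union> ?C = configurations T"
    proof (intro equalityI subsetI)
      fix \<eta> assume "\<eta> \<in> configurations T"
      then have "\<eta> \<in> config_cylinder [(0, card (\<eta> \<inter> {0..0})), (a, card (\<eta> \<inter> {0..a})),
          (b, card (\<eta> \<inter> {0..b})), (T, card (\<eta> \<inter> {0..T}))]"
        by (simp add: config_cylinder_def)
      then show "\<eta> \<in> \<Union> ?C" by blast
    next
      fix \<eta> assume "\<eta> \<in> \<Union> ?C"
      then show "\<eta> \<in> configurations T" unfolding config_cylinder_def by blast
    qed
    have "?C \<subseteq> range (\<lambda>(i, j, k, l). config_cylinder [(0, i), (a, j), (b, k), (T, l)])"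
      by blast
    then show "countable ?C" by (rule countable_subset) simp
    show "emeasure (weighted_law a b) X \<noteq> \<infinity>" if "X \<in> ?C" for X
      using that by (rule fin[OF subsetD[OF CE]])
  qed
qed

text \<open>
  The equality of measures also transfers integrability; this is where the integrability of
  the gradient comes from.
\<close>

lemma mecke:
  assumes ab: "0 \<le> a" "a < b" "b \<le> T" and h [measurable]: "h \<in> borel_measurable (config_space T)"
  shows "integrable M (\<lambda>\<omega>. (real (N b \<omega>) - real (N a \<omega>)) * h (conf \<omega>)) \<longleftrightarrow>
      integrable prodM (\<lambda>x. lam * indicator {a<..b} (fst x) * h (insert (fst x) (conf (snd x))))"
    and "(\<integral>\<omega>. (real (N b \<omega>) - real (N a \<omega>)) * h (conf \<omega>) \<partial>M) =
      (\<integral>x. lam * indicator {a<..b} (fst x) * h (insert (fst x) (conf (snd x))) \<partial>prodM)"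
proof -
  have [measurable]: "(\<lambda>\<omega>. real (N b \<omega>)) \<in> borel_measurable M" "(\<lambda>\<omega>. real (N a \<omega>)) \<in> borel_measurable M"
    using ab by auto
  have nn: "AE \<omega> in M. 0 \<le> real (N b \<omega>) - real (N a \<omega>)"
    using AE_space by eventually_elim (use N_mono ab in auto)
  have nn': "AE x in prodM. 0 \<le> lam * indicator {a<..b} (fst x)" using lam_pos by auto
  have "integrable (weighted_law a b) h \<longleftrightarrow> integrable M (\<lambda>\<omega>. (real (N b \<omega>) - real (N a \<omega>)) * h (conf \<omega>))"
    unfolding weighted_law_def using nn by (subst integrable_distr_eq) (auto simp: integrable_density)
  moreover have "integrable (added_law a b) h \<longleftrightarrow>
      integrable prodM (\<lambda>x. lam * indicator {a<..b} (fst x) * h (insert (fst x) (conf (snd x))))"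
    unfolding added_law_def using nn' by (subst integrable_distr_eq) (auto simp: integrable_density)
  ultimately show "integrable M (\<lambda>\<omega>. (real (N b \<omega>) - real (N a \<omega>)) * h (conf \<omega>)) \<longleftrightarrow>
      integrable prodM (\<lambda>x. lam * indicator {a<..b} (fst x) * h (insert (fst x) (conf (snd x))))"
    using weighted_law_eq_added_law[OF ab] by simp
  have "integral\<^sup>L (weighted_law a b) h = (\<integral>\<omega>. (real (N b \<omega>) - real (N a \<omega>)) * h (conf \<omega>) \<partial>M)"
    unfolding weighted_law_def using nn by (subst integral_distr) (auto simp: integral_density)
  moreover have "integral\<^sup>L (added_law a b) h =
      (\<integral>x. lam * indicator {a<..b} (fst x) * h (insert (fst x) (conf (snd x))) \<partial>prodM)"
    unfolding added_law_def using nn' by (subst integral_distr) (auto simp: integral_density)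
  ultimately show "(\<integral>\<omega>. (real (N b \<omega>) - real (N a \<omega>)) * h (conf \<omega>) \<partial>M) =
      (\<integral>x. lam * indicator {a<..b} (fst x) * h (insert (fst x) (conf (snd x))) \<partial>prodM)"
    using weighted_law_eq_added_law[OF ab] by simp
qed

end

section \<open>Integrals over generated sigma-algebras, and moments of the increments\<close>

text \<open>
  Dynkin's argument for a signed integrand. The whole space need not belong to the
  pi-system, so the total integral appears as a separate assumption.
\<close>

lemma set_integral_zero_generate:
  fixes Z :: "'b \<Rightarrow> real"
  assumes Z: "integrable K Z" and G: "Int_stable G" "G \<subseteq> sets K"
    and zero: "\<And>A. A \<in> G \<Longrightarrow> (LINT x:A|K. Z x) = 0" and total: "(\<integral>x. Z x \<partial>K) = 0"
    and A: "A \<in> sigma_sets (space K) G"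
  shows "(LINT x:A|K. Z x) = 0"
proof -
  have sub: "sigma_sets (space K) G \<subseteq> sets K" using G(2) by (rule sets.sigma_sets_subset)
  have int: "set_integrable K B Z" if "B \<in> sigma_sets (space K) G" for B
    using that sub Z unfolding set_integrable_def by (intro integrable_mult_indicator) auto
  have "G \<subseteq> Pow (space K)" using G(2) sets.sets_into_space by blast
  from G(1) this A show ?thesis
  proof (induction rule: sigma_sets_induct_disjoint)
    case (compl A)
    have "A \<subseteq> space K" using compl(1) sub sets.sets_into_space by blast
    then have "(LINT x:space K - A|K. Z x) + (LINT x:A|K. Z x) = (LINT x:space K|K. Z x)"
      using int[OF compl(1)] int[OF sigma_sets.Compl[OF compl(1)]]
      by (subst set_integral_Un[symmetric]) (auto simp: Un_absorb2)
    also have "(LINT x:space K|K. Z x) = 0" using total by (simp add: set_integral_space Z)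
    finally show ?case using compl by simp
  next
    case (union A)
    have U: "(\<Union>i. A i) \<in> sigma_sets (space K) G" using union(2) by (intro sigma_sets.Union) auto
    have "(LINT x:(\<Union>i. A i)|K. Z x) = (\<Sum>i. (LINT x:A i|K. Z x))"
      using union(1) subset_trans[OF union(2) sub] int[OF U]
      by (intro lebesgue_integral_countable_add) (auto simp: disjoint_family_on_def)
    then show ?case using union(3) by simp
  qed (use zero in \<open>auto simp: set_lebesgue_integral_def\<close>)
qed

text \<open>
  The conditional expectation of \<open>Z\<close> vanishes, which spares an approximation of \<open>\<xi>\<close> by step functions and
  covers unbounded \<open>\<xi>\<close> as well.
\<close>

lemma (in finite_measure) integral_mult_eq_zero:
  fixes Z :: "'a \<Rightarrow> real"
  assumes sub: "subalgebra M F" and Z: "integrable M Z"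
    and zero: "\<And>A. A \<in> sets F \<Longrightarrow> (LINT x:A|M. Z x) = 0"
    and \<xi>: "\<xi> \<in> borel_measurable F" and int: "integrable M (\<lambda>x. \<xi> x * Z x)"
  shows "(\<integral>x. \<xi> x * Z x \<partial>M) = 0"
proof -
  interpret S: finite_measure_subalgebra M F by unfold_locales (rule sub)
  have "AE x in M. real_cond_exp M F Z x = 0"
    using zero Z by (intro S.real_cond_exp_charact) (auto simp: set_lebesgue_integral_def)
  then have "(\<integral>x. \<xi> x * real_cond_exp M F Z x \<partial>M) = (\<integral>x. 0 \<partial>M)"
    using measurable_from_subalg[OF sub \<xi>] by (intro integral_cong_AE) auto
  then show ?thesis using S.real_cond_exp_intg(2)[OF int \<xi>] Z by auto
qed

lemma integrable_mult_square:
  fixes f g :: "'b \<Rightarrow> real"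
  assumes [measurable]: "f \<in> borel_measurable K" "g \<in> borel_measurable K"
    and "integrable K (\<lambda>x. (f x)\<^sup>2)" "integrable K (\<lambda>x. (g x)\<^sup>2)"
  shows "integrable K (\<lambda>x. f x * g x)"
proof (rule Bochner_Integration.integrable_bound)
  show "integrable K (\<lambda>x. (f x)\<^sup>2 + (g x)\<^sup>2)" using assms by auto
  have "\<bar>a * b\<bar> \<le> a\<^sup>2 + b\<^sup>2" for a b :: real
  proof -
    have "0 \<le> \<bar>a\<bar> * \<bar>b\<bar>" by simp
    moreover have "2 * (\<bar>a\<bar> * \<bar>b\<bar>) \<le> a\<^sup>2 + b\<^sup>2"
      using sum_squares_bound[of "\<bar>a\<bar>" "\<bar>b\<bar>"] by (simp add: mult.assoc)
    ultimately show ?thesis unfolding abs_mult by linarith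
  qed
  then show "AE x in K. norm (f x * g x) \<le> norm ((f x)\<^sup>2 + (g x)\<^sup>2)" by simp
qed simp

lemma (in finite_measure) integrable_bounded_mult:
  fixes \<xi> g :: "'a \<Rightarrow> real"
  assumes "\<xi> \<in> borel_measurable M" "\<And>x. x \<in> space M \<Longrightarrow> \<bar>\<xi> x\<bar> \<le> C" "integrable M g"
  shows "integrable M (\<lambda>x. \<xi> x * g x)"
proof (rule Bochner_Integration.integrable_bound)
  show "integrable M (\<lambda>x. C * g x)" using assms by auto
  show "AE x in M. norm (\<xi> x * g x) \<le> norm (C * g x)"
    using AE_space
  proof eventually_elim
    case (elim x)
    have "\<bar>\<xi> x\<bar> * \<bar>g x\<bar> \<le> \<bar>C\<bar> * \<bar>g x\<bar>" using assms(2)[OF elim] by (intro mult_right_mono) auto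
    then show ?case by (simp add: abs_mult)
  qed
qed (use assms in auto)

context poisson_setting
begin

lemma integrable_snd_prod:
  fixes g :: "'a \<Rightarrow> real"
  assumes g: "integrable M g"
  shows "integrable prodM (\<lambda>x. g (snd x))"
proof -
  have "integrable prodM (\<lambda>(t, \<omega>). g \<omega>)"
    by (rule tm.Fubini_integrable) (use g in auto)
  then show ?thesis by (simp add: case_prod_unfold)
qed

lemma measure_time_interval: "0 \<le> a \<Longrightarrow> a \<le> b \<Longrightarrow> b \<le> T \<Longrightarrow> (\<integral>r. indicator {a<..b} r \<partial>time_measure T) = b - a"
  using emeasure_time[of a b] sets_time[of a b] by (simp add: measure_def space_time_measure Int_absorb2 subset_iff)

lemma integral_rect:
  fixes g :: "'a \<Rightarrow> real"
  assumes g: "integrable M g" and ab: "0 \<le> a" "a \<le> b" "b \<le> T"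
  shows "integrable prodM (\<lambda>x. indicator {a<..b} (fst x) * g (snd x))"
    and "(\<integral>x. indicator {a<..b} (fst x) * g (snd x) \<partial>prodM) = (b - a) * (\<integral>\<omega>. g \<omega> \<partial>M)"
proof -
  show i: "integrable prodM (\<lambda>x. indicator {a<..b} (fst x) * g (snd x))"
    by (rule prod.integrable_bounded_mult[of _ 1]) (use integrable_snd_prod[OF g] in \<open>auto simp: indicator_def\<close>)
  have "(\<integral>x. indicator {a<..b} (fst x) * g (snd x) \<partial>prodM) = (\<integral>r. (\<integral>\<omega>. indicator {a<..b} r * g \<omega> \<partial>M) \<partial>time_measure T)"
    using tm.integral_fst'[OF i] by simp
  also have "\<dots> = (b - a) * (\<integral>\<omega>. g \<omega> \<partial>M)" using measure_time_interval[OF ab] by simp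
  finally show "(\<integral>x. indicator {a<..b} (fst x) * g (snd x) \<partial>prodM) = (b - a) * (\<integral>\<omega>. g \<omega> \<partial>M)" .
qed

text \<open>
  The Mecke formula with \<open>h = 1\<close>.
\<close>

lemma integrable_increment:
  assumes ab: "0 \<le> a" "a \<le> b" "b \<le> T"
  shows "integrable M (\<lambda>\<omega>. real (N b \<omega>) - real (N a \<omega>))"
proof (cases "a = b")
  case False
  have "integrable prodM (\<lambda>x. lam * (indicator {a<..b} (fst x) * 1))"
    using integral_rect(1)[of "\<lambda>_. 1", OF _ ab] by auto
  then show ?thesis using mecke(1)[of a b "\<lambda>_. 1"] ab False by simp
qed simp

text \<open>
  The Mecke formula with \<open>h\<close> the increment itself: an added point changes the increment by at most
  one, so the second moment is controlled by the first.
\<close>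

lemma integrable_increment_sq:
  assumes ab: "0 \<le> a" "a \<le> b" "b \<le> T"
  shows "integrable M (\<lambda>\<omega>. (real (N b \<omega>) - real (N a \<omega>))\<^sup>2)"
proof (cases "a = b")
  case False
  define h :: "real set \<Rightarrow> real" where "h \<eta> = real (card (\<eta> \<inter> {0..b})) - real (card (\<eta> \<inter> {0..a}))" for \<eta>
  have [measurable]: "h \<in> borel_measurable (config_space T)" unfolding h_def by measurable
  have [measurable]: "(\<lambda>\<omega>. real (N b \<omega>)) \<in> borel_measurable M" "(\<lambda>\<omega>. real (N a \<omega>)) \<in> borel_measurable M"
    using ab by auto
  have bd: "AE x in prodM. norm (lam * indicator {a<..b} (fst x) * h (insert (fst x) (conf (snd x)))) \<le>
      norm (lam * (real (N b (snd x)) - real (N 0 (snd x)) + 1))"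
    using AE_prod_snd[OF AE_count] AE_space
  proof eventually_elim
    case (elim x)
    have x: "0 \<le> fst x" "snd x \<in> space M" using elim by (auto simp: space_pair_measure space_time_measure)
    have "\<bar>h (insert (fst x) (conf (snd x)))\<bar> \<le> real (N b (snd x)) + 1"
      unfolding h_def using card_insert_count[OF finite_conf[OF x(2)] x(1), of a] elim(1) ab
        card_insert_count[OF finite_conf[OF x(2)] x(1), of b] N_mono[OF x(2), of a b] by auto
    then show ?case using lam_pos N_zero[OF x(2)]
      by (auto simp: indicator_def abs_mult intro!: mult_left_mono)
  qed
  have "integrable prodM (\<lambda>x. lam * (real (N b (snd x)) - real (N 0 (snd x)) + 1))"
    using integrable_snd_prod[OF integrable_increment[of 0 b]] ab by auto
  then have "integrable prodM (\<lambda>x. lam * indicator {a<..b} (fst x) * h (insert (fst x) (conf (snd x))))"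
    by (rule Bochner_Integration.integrable_bound[OF _ _ bd]) measurable
  then have "integrable M (\<lambda>\<omega>. (real (N b \<omega>) - real (N a \<omega>)) * h (conf \<omega>))"
    using mecke(1)[of a b h] ab False by simp
  then show ?thesis
  proof (rule integrable_cong_AE_imp)
    show "AE \<omega> in M. (real (N b \<omega>) - real (N a \<omega>)) * h (conf \<omega>) = (real (N b \<omega>) - real (N a \<omega>))\<^sup>2"
      using AE_count by eventually_elim (use ab in \<open>auto simp: h_def power2_eq_square\<close>)
  qed measurable
qed simp

abbreviation incr :: "real \<Rightarrow> real \<Rightarrow> 'a \<Rightarrow> real" where
  "incr a b \<omega> \<equiv> compensated lam N b \<omega> - compensated lam N a \<omega>"

lemma measurable_incr: "0 \<le> a \<Longrightarrow> a \<le> b \<Longrightarrow> b \<le> T \<Longrightarrow> incr a b \<in> borel_measurable M"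
  unfolding compensated_def using measurable_real_N[of a] measurable_real_N[of b] by measurable

lemma integrable_incr_sq:
  assumes ab: "0 \<le> a" "a \<le> b" "b \<le> T"
  shows "integrable M (\<lambda>\<omega>. (incr a b \<omega>)\<^sup>2)"
proof -
  have "integrable M (\<lambda>\<omega>. (real (N b \<omega>) - real (N a \<omega>))\<^sup>2
      - 2 * (lam * (b - a)) * (real (N b \<omega>) - real (N a \<omega>)) + (lam * (b - a))\<^sup>2)"
    using integrable_increment_sq[OF ab] integrable_increment[OF ab] by auto
  moreover have "(incr a b \<omega>)\<^sup>2 = (real (N b \<omega>) - real (N a \<omega>))\<^sup>2
      - 2 * (lam * (b - a)) * (real (N b \<omega>) - real (N a \<omega>)) + (lam * (b - a))\<^sup>2" for \<omega>
    unfolding compensated_def by (simp add: power2_eq_square algebra_simps)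
  ultimately show ?thesis by simp
qed

lemma integrable_L2: "F \<in> L2 M \<Longrightarrow> integrable M F"
  using integrable_mult_square[of F M "\<lambda>_. 1"] by (auto simp: L2_def)

lemma integrable_L2_mult: "F \<in> L2 M \<Longrightarrow> G \<in> L2 M \<Longrightarrow> integrable M (\<lambda>\<omega>. F \<omega> * G \<omega>)"
  using integrable_mult_square[of F M G] by (auto simp: L2_def)

lemma incr_L2: "0 \<le> a \<Longrightarrow> a \<le> b \<Longrightarrow> b \<le> T \<Longrightarrow> incr a b \<in> L2 M"
  using measurable_incr integrable_incr_sq by (auto simp: L2_def)

section \<open>Integration by parts\<close>

abbreviation grad :: "(real set \<Rightarrow> real) \<Rightarrow> real \<times> 'a \<Rightarrow> real" where
  "grad f \<equiv> \<lambda>x. discrete_gradient T N f (fst x) (snd x)"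

definition path_cylinder :: "(real \<times> nat) list \<Rightarrow> 'a set" where
  "path_cylinder L = {\<omega> \<in> space M. \<forall>p\<in>set L. N (fst p) \<omega> = snd p}"

lemma path_cylinder_append: "path_cylinder L \<inter> path_cylinder L' = path_cylinder (L @ L')"
  unfolding path_cylinder_def set_append ball_Un by blast

lemma sets_path_cylinder: "fst ` set L \<subseteq> {0..t} \<Longrightarrow> path_cylinder L \<in> sets (null_augmented M N t)"
proof -
  assume L: "fst ` set L \<subseteq> {0..t}"
  have "{\<omega> \<in> space (null_augmented M N t). \<forall>p\<in>set L. N (fst p) \<omega> = snd p} \<in> sets (null_augmented M N t)"
  proof (rule sets.sets_Collect_finite_All)
    fix p assume "p \<in> set L"
    then have "N (fst p) -` {snd p} \<inter> space M \<in> sets (null_augmented M N t)"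
      using L unfolding sets_NA by (intro sigma_sets.Basic UnI1 CollectI exI[of _ "fst p"] exI[of _ "{snd p}"]) auto
    moreover have "N (fst p) -` {snd p} \<inter> space M = {\<omega> \<in> space (null_augmented M N t). N (fst p) \<omega> = snd p}"
      unfolding space_NA by auto
    ultimately show "{\<omega> \<in> space (null_augmented M N t). N (fst p) \<omega> = snd p} \<in> sets (null_augmented M N t)" by simp
  qed simp
  then show ?thesis by (simp add: path_cylinder_def space_NA)
qed

text \<open>
  Restricting the times to a set \<open>D\<close> covers both the natural filtration at time \<open>t\<close>, with
  \<open>D = {0..t}\<close>, and countable generators, with \<open>D\<close> a set of rationals.
\<close>

definition cylinders_and_null :: "real set \<Rightarrow> 'a set set" where
  "cylinders_and_null D = path_cylinder ` {L. fst ` set L \<subseteq> D} \<union> null_sets M"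

lemma cylinders_and_null_subset: "D \<subseteq> {0..T} \<Longrightarrow> cylinders_and_null D \<subseteq> sets M"
  unfolding cylinders_and_null_def using sets_path_cylinder[of _ T] NA_subset[of T] by auto

lemma Int_stable_cylinders_and_null: "D \<subseteq> {0..T} \<Longrightarrow> Int_stable (cylinders_and_null D)"
proof (rule Int_stableI)
  fix A B assume D: "D \<subseteq> {0..T}" and AB: "A \<in> cylinders_and_null D" "B \<in> cylinders_and_null D"
  have m: "A \<in> sets M" "B \<in> sets M" using AB cylinders_and_null_subset[OF D] by auto
  show "A \<inter> B \<in> cylinders_and_null D"
  proof (cases "A \<in> null_sets M \<or> B \<in> null_sets M")
    case True
    then have "A \<inter> B \<in> null_sets M" using m by (auto intro: null_set_Int1 null_set_Int2)
    then show ?thesis by (simp add: cylinders_and_null_def)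
  next
    case False
    then obtain L L' where L: "A = path_cylinder L" "fst ` set L \<subseteq> D" "B = path_cylinder L'" "fst ` set L' \<subseteq> D"
      using AB by (auto simp: cylinders_and_null_def)
    then have "fst ` set (L @ L') \<subseteq> D" by (simp add: image_Un)
    then show ?thesis using L path_cylinder_append[of L L'] by (auto simp: cylinders_and_null_def)
  qed
qed

lemma sets_NA_cylinders:
  "sets (null_augmented M N t) \<subseteq> sigma_sets (space M) (cylinders_and_null {0..t})"
  unfolding sets_NA
proof (rule sigma_sets_mono, safe)
  fix s and B :: "nat set" assume s: "s \<in> {0..t}"
  have "N s -` B \<inter> space M = (\<Union>k\<in>B. path_cylinder [(s, k)])"
    by (auto simp: path_cylinder_def)
  also have "\<dots> \<in> sigma_sets (space M) (cylinders_and_null {0..t})"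
    using s by (intro sigma_sets_UNION) (auto simp: cylinders_and_null_def intro!: sigma_sets.Basic)
  finally show "N s -` B \<inter> space M \<in> sigma_sets (space M) (cylinders_and_null {0..t})" .
next
  fix A assume "A \<in> null_sets M"
  then show "A \<in> sigma_sets (space M) (cylinders_and_null {0..t})"
    by (intro sigma_sets.Basic) (simp add: cylinders_and_null_def)
qed

end

locale config_functional = poisson_setting +
  fixes F :: "'a \<Rightarrow> real" and f :: "real set \<Rightarrow> real"
  assumes F_L2: "F \<in> L2 M" and f: "is_config_functional M T N F f"
begin

lemma f_meas [measurable]: "f \<in> borel_measurable (config_space T)"
  and F_eq: "AE \<omega> in M. F \<omega> = f (conf \<omega>)"
  using f by (auto simp: is_config_functional_def)

lemma F_meas [measurable]: "F \<in> borel_measurable M" and F_sq: "integrable M (\<lambda>\<omega>. (F \<omega>)\<^sup>2)"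
  using F_L2 by (auto simp: L2_def)

lemma grad_meas [measurable]: "grad f \<in> borel_measurable prodM"
  unfolding discrete_gradient_def add_point_def by measurable

lemma integrable_F_increment:
  assumes "0 \<le> a" "a \<le> b" "b \<le> T"
  shows "integrable M (\<lambda>\<omega>. F \<omega> * (real (N b \<omega>) - real (N a \<omega>)))"
  using assms by (intro integrable_mult_square integrable_increment_sq F_sq) auto

text \<open>
  By the Mecke formula with \<open>h = f\<close>, the expected integral of \<open>\<bar>f(\<eta> + \<epsilon>\<^sub>r)\<bar>\<close> over \<open>r\<close> is
  \<open>E[N\<^sub>T \<bar>F\<bar>] / lam\<close>, which is finite for square integrable \<open>F\<close>.
\<close>

lemma integrable_f_insert: "integrable prodM (\<lambda>x. f (insert (fst x) (conf (snd x))))"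
proof -
  have "integrable M (\<lambda>\<omega>. (real (N T \<omega>) - real (N 0 \<omega>)) * f (conf \<omega>))"
  proof (rule integrable_cong_AE_imp[OF integrable_F_increment[of 0 T]])
    show "AE \<omega> in M. F \<omega> * (real (N T \<omega>) - real (N 0 \<omega>)) = (real (N T \<omega>) - real (N 0 \<omega>)) * f (conf \<omega>)"
      using F_eq by eventually_elim auto
  qed (use T_pos in \<open>auto intro!: borel_measurable_times borel_measurable_diff\<close>)
  then have i: "integrable prodM (\<lambda>x. lam * indicator {0<..T} (fst x) * f (insert (fst x) (conf (snd x))))"
    using mecke(1)[of 0 T f] T_pos by simp
  have "integrable prodM (\<lambda>x. lam * f (insert (fst x) (conf (snd x))))"
  proof (rule integrable_cong_AE_imp[OF i])
    show "AE x in prodM. lam * indicator {0<..T} (fst x) * f (insert (fst x) (conf (snd x))) =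
        lam * f (insert (fst x) (conf (snd x)))"
      using AE_fst_pos by eventually_elim simp
  qed measurable
  then show ?thesis using lam_pos by simp
qed

lemma integrable_f_conf: "integrable M (\<lambda>\<omega>. f (conf \<omega>))"
  by (rule integrable_cong_AE_imp[OF integrable_L2[OF F_L2]]) (use F_eq in auto)

lemma integrable_grad: "integrable prodM (grad f)"
  unfolding discrete_gradient_def add_point_def
  by (intro Bochner_Integration.integrable_diff integrable_f_insert integrable_snd_prod integrable_f_conf)

lemma integrable_grad_mult:
  assumes "\<xi> \<in> borel_measurable M" "\<And>\<omega>. \<omega> \<in> space M \<Longrightarrow> \<bar>\<xi> \<omega>\<bar> \<le> C" "A \<in> sets (time_measure T)"
  shows "integrable prodM (\<lambda>x. indicator A (fst x) * \<xi> (snd x) * grad f x)"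
proof (rule prod.integrable_bounded_mult[OF _ _ integrable_grad])
  show "(\<lambda>x. indicator A (fst x) * \<xi> (snd x)) \<in> borel_measurable prodM"
    using assms by measurable
  fix x assume "x \<in> space prodM"
  then have "\<bar>\<xi> (snd x)\<bar> \<le> C" using assms(2) by (auto simp: space_pair_measure)
  then show "\<bar>indicator A (fst x) * \<xi> (snd x)\<bar> \<le> C" by (auto simp: indicator_def)
qed

text \<open>
  The difference of the two sides of integration by parts, before multiplication with \<open>\<xi>\<close> and
  expectation. For this random variable the claim is that its integrals over the events at time \<open>a\<close>
  vanish, which can be checked on generators.
\<close>

definition defect :: "real \<Rightarrow> real \<Rightarrow> 'a \<Rightarrow> real" where
  "defect a b \<omega> = F \<omega> * incr a b \<omega> -
     lam * (\<integral>r. indicator {a<..b} r * discrete_gradient T N f r \<omega> \<partial>time_measure T)"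

lemma integrable_F_incr: "0 \<le> a \<Longrightarrow> a \<le> b \<Longrightarrow> b \<le> T \<Longrightarrow> integrable M (\<lambda>\<omega>. F \<omega> * incr a b \<omega>)"
  using incr_L2 F_L2 by (rule integrable_L2_mult[rotated])

lemma integrable_inner_grad:
  assumes ab: "0 \<le> a" "a \<le> b" "b \<le> T"
  shows "integrable M (\<lambda>\<omega>. \<integral>r. indicator {a<..b} r * discrete_gradient T N f r \<omega> \<partial>time_measure T)"
  using integrable_grad_mult[of "\<lambda>_. 1" 1 "{a<..b}"] sets_time[of a b] ab
  by (intro tm.integrable_snd) (auto simp: case_prod_unfold)

lemma integrable_defect:
  assumes ab: "0 \<le> a" "a \<le> b" "b \<le> T"
  shows "integrable M (defect a b)"
  unfolding defect_def
  by (intro Bochner_Integration.integrable_diff integrable_mult_right integrable_F_incr integrable_inner_grad ab)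

lemma integral_mult_defect:
  assumes ab: "0 \<le> a" "a \<le> b" "b \<le> T" and \<xi>: "\<xi> \<in> borel_measurable M" "\<And>\<omega>. \<omega> \<in> space M \<Longrightarrow> \<bar>\<xi> \<omega>\<bar> \<le> C"
  shows "(\<integral>\<omega>. \<xi> \<omega> * defect a b \<omega> \<partial>M) = (\<integral>\<omega>. \<xi> \<omega> * (F \<omega> * incr a b \<omega>) \<partial>M) -
    lam * (\<integral>x. indicator {a<..b} (fst x) * \<xi> (snd x) * grad f x \<partial>prodM)"
proof -
  have i1: "integrable M (\<lambda>\<omega>. \<xi> \<omega> * (F \<omega> * incr a b \<omega>))"
    using integrable_bounded_mult[OF \<xi> integrable_F_incr[OF ab]] .
  have i2: "integrable M (\<lambda>\<omega>. \<xi> \<omega> * (\<integral>r. indicator {a<..b} r * discrete_gradient T N f r \<omega> \<partial>time_measure T))"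
    using integrable_bounded_mult[OF \<xi> integrable_inner_grad[OF ab]] .
  have "(\<integral>\<omega>. \<xi> \<omega> * defect a b \<omega> \<partial>M) = (\<integral>\<omega>. \<xi> \<omega> * (F \<omega> * incr a b \<omega>) \<partial>M) -
      lam * (\<integral>\<omega>. \<xi> \<omega> * (\<integral>r. indicator {a<..b} r * discrete_gradient T N f r \<omega> \<partial>time_measure T) \<partial>M)"
    using i1 i2 unfolding defect_def by (simp add: right_diff_distrib mult.left_commute[of _ lam])
  also have "(\<integral>\<omega>. \<xi> \<omega> * (\<integral>r. indicator {a<..b} r * discrete_gradient T N f r \<omega> \<partial>time_measure T) \<partial>M) =
      (\<integral>\<omega>. (\<integral>r. indicator {a<..b} r * \<xi> \<omega> * discrete_gradient T N f r \<omega> \<partial>time_measure T) \<partial>M)"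
    by (intro Bochner_Integration.integral_cong refl) (simp flip: integral_mult_right_zero add: ac_simps)
  also have "\<dots> = (\<integral>x. indicator {a<..b} (fst x) * \<xi> (snd x) * grad f x \<partial>prodM)"
    using tm.integral_snd[of "\<lambda>r \<omega>. indicator {a<..b} r * \<xi> \<omega> * discrete_gradient T N f r \<omega>"]
      integrable_grad_mult[OF \<xi> sets_time[of a b]] ab by (simp add: case_prod_unfold)
  finally show ?thesis .
qed

text \<open>
  The Mecke formula for \<open>f\<close> times the indicator of the cylinder, minus the contribution of the
  compensator.
\<close>

lemma defect_cylinder:
  assumes ab: "0 \<le> a" "a < b" "b \<le> T" and L: "fst ` set L \<subseteq> {0..a}"
  shows "(LINT \<omega>:path_cylinder L|M. defect a b \<omega>) = 0"
proof -
  let ?A = "path_cylinder L"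
  define h where "h \<eta> = f \<eta> * indicator (config_cylinder L) \<eta>" for \<eta>
  have C: "config_cylinder L \<in> sets (config_space T)"
  proof -
    have "fst ` set L \<subseteq> {0..T}" using L ab by auto
    then have "config_cylinder L \<in> {config_cylinder L | L. {} \<subseteq> fst ` set L \<and> fst ` set L \<subseteq> {0..T}}" by blast
    then show ?thesis by (subst sets_config_space_cylinders[of "{}"]) (auto intro: sigma_sets.Basic)
  qed
  have h [measurable]: "h \<in> borel_measurable (config_space T)" unfolding h_def using C by measurable
  have A: "?A \<in> sets M" using sets_path_cylinder[OF L] NA_subset[of a] ab by auto
  have [measurable]: "(\<lambda>\<omega>. real (N b \<omega>)) \<in> borel_measurable M" "(\<lambda>\<omega>. real (N a \<omega>)) \<in> borel_measurable M"
    using ab by auto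
  have FA: "integrable M (\<lambda>\<omega>. indicator ?A \<omega> * F \<omega>)"
    using integrable_mult_indicator[OF A integrable_L2[OF F_L2]] by simp
  have mem: "AE \<omega> in M. indicator (config_cylinder L) (conf \<omega>) = (indicator ?A \<omega> :: real)"
    using AE_count AE_space
  proof eventually_elim
    case (elim \<omega>)
    have "conf \<omega> \<in> config_cylinder L \<longleftrightarrow> \<omega> \<in> ?A"
      using elim L ab conf_in_configurations[OF elim(2)]
      unfolding config_cylinder_def path_cylinder_def by (force simp: image_subset_iff)
    then show ?case by (auto simp: indicator_def)
  qed
  \<comment> \<open>adding a point after time \<open>a\<close> does not change the counts up to time \<open>a\<close>\<close>
  have mem': "AE x in prodM. lam * indicator {a<..b} (fst x) * h (insert (fst x) (conf (snd x))) =
      lam * (indicator {a<..b} (fst x) * indicator ?A (snd x) * f (insert (fst x) (conf (snd x))))"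
    using AE_prod_snd[OF mem] AE_space
  proof eventually_elim
    case (elim x)
    have x: "fst x \<in> {0..T}" "snd x \<in> space M" using elim by (auto simp: space_pair_measure space_time_measure)
    have "indicator (config_cylinder L) (insert (fst x) (conf (snd x))) = (indicator (config_cylinder L) (conf (snd x)) :: real)"
      if "a < fst x"
    proof -
      have "insert (fst x) (conf (snd x)) \<inter> {0..s} = conf (snd x) \<inter> {0..s}" if "s \<le> a" for s
        using that \<open>a < fst x\<close> by auto
      then have "insert (fst x) (conf (snd x)) \<in> config_cylinder L \<longleftrightarrow> conf (snd x) \<in> config_cylinder L"
        using L insert_configurations[OF x(1) conf_in_configurations[OF x(2)]] conf_in_configurations[OF x(2)]
        unfolding config_cylinder_def by (auto simp: image_subset_iff)
      then show ?thesis by (auto simp: indicator_def)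
    qed
    then show ?case using elim(1) unfolding h_def by (auto simp: indicator_def)
  qed
  have f1: "integrable prodM (\<lambda>x. indicator {a<..b} (fst x) * indicator ?A (snd x) * f (insert (fst x) (conf (snd x))))"
    using A sets_time[of a b] ab
    by (intro prod.integrable_bounded_mult[OF _ _ integrable_f_insert, of _ 1]) (auto simp: indicator_def)
  have f2: "integrable prodM (\<lambda>x. indicator {a<..b} (fst x) * (indicator ?A (snd x) * F (snd x)))"
    using integral_rect(1)[OF FA] ab by simp
  have "(\<integral>\<omega>. indicator ?A \<omega> * (F \<omega> * (real (N b \<omega>) - real (N a \<omega>))) \<partial>M) =
      (\<integral>\<omega>. (real (N b \<omega>) - real (N a \<omega>)) * h (conf \<omega>) \<partial>M)"
  proof (rule integral_cong_AE)
    show "AE \<omega> in M. indicator ?A \<omega> * (F \<omega> * (real (N b \<omega>) - real (N a \<omega>))) =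
        (real (N b \<omega>) - real (N a \<omega>)) * h (conf \<omega>)"
      using mem F_eq by eventually_elim (simp add: h_def)
  qed (use A in measurable)
  also have "\<dots> = (\<integral>x. lam * indicator {a<..b} (fst x) * h (insert (fst x) (conf (snd x))) \<partial>prodM)"
    by (rule mecke(2)[OF ab h])
  also have "\<dots> = (\<integral>x. lam * (indicator {a<..b} (fst x) * indicator ?A (snd x) * f (insert (fst x) (conf (snd x)))) \<partial>prodM)"
    by (rule integral_cong_AE[OF _ _ mem']) (use A in measurable)
  also have "\<dots> = lam * (\<integral>x. indicator {a<..b} (fst x) * indicator ?A (snd x) * f (insert (fst x) (conf (snd x))) \<partial>prodM)"
    by simp
  finally have 1: "(\<integral>\<omega>. indicator ?A \<omega> * (F \<omega> * (real (N b \<omega>) - real (N a \<omega>))) \<partial>M) =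
      lam * (\<integral>x. indicator {a<..b} (fst x) * indicator ?A (snd x) * f (insert (fst x) (conf (snd x))) \<partial>prodM)" .
  have "(\<integral>x. indicator {a<..b} (fst x) * indicator ?A (snd x) * grad f x \<partial>prodM) =
      (\<integral>x. indicator {a<..b} (fst x) * indicator ?A (snd x) * f (insert (fst x) (conf (snd x))) -
            indicator {a<..b} (fst x) * (indicator ?A (snd x) * F (snd x)) \<partial>prodM)"
  proof (rule integral_cong_AE)
    show "AE x in prodM. indicator {a<..b} (fst x) * indicator ?A (snd x) * grad f x =
        indicator {a<..b} (fst x) * indicator ?A (snd x) * f (insert (fst x) (conf (snd x))) -
            indicator {a<..b} (fst x) * (indicator ?A (snd x) * F (snd x))"
      using AE_prod_snd[OF F_eq]
      by eventually_elim (simp add: discrete_gradient_def add_point_def right_diff_distrib)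
  qed (use A in measurable)
  also have "\<dots> = (\<integral>x. indicator {a<..b} (fst x) * indicator ?A (snd x) * f (insert (fst x) (conf (snd x))) \<partial>prodM) -
      (b - a) * (\<integral>\<omega>. indicator ?A \<omega> * F \<omega> \<partial>M)"
    using f1 f2 integral_rect(2)[OF FA] ab by simp
  finally have 2: "(\<integral>x. indicator {a<..b} (fst x) * indicator ?A (snd x) * grad f x \<partial>prodM) =
      (\<integral>x. indicator {a<..b} (fst x) * indicator ?A (snd x) * f (insert (fst x) (conf (snd x))) \<partial>prodM) -
      (b - a) * (\<integral>\<omega>. indicator ?A \<omega> * F \<omega> \<partial>M)" .
  have "(\<integral>\<omega>. indicator ?A \<omega> * (F \<omega> * incr a b \<omega>) \<partial>M) =
      (\<integral>\<omega>. indicator ?A \<omega> * (F \<omega> * (real (N b \<omega>) - real (N a \<omega>))) - lam * (b - a) * (indicator ?A \<omega> * F \<omega>) \<partial>M)"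
    by (intro Bochner_Integration.integral_cong refl) (simp add: compensated_def algebra_simps)
  also have "\<dots> = (\<integral>\<omega>. indicator ?A \<omega> * (F \<omega> * (real (N b \<omega>) - real (N a \<omega>))) \<partial>M) - lam * (b - a) * (\<integral>\<omega>. indicator ?A \<omega> * F \<omega> \<partial>M)"
    using FA integrable_mult_indicator[OF A integrable_F_increment[of a b]] ab by simp
  finally have 3: "(\<integral>\<omega>. indicator ?A \<omega> * (F \<omega> * incr a b \<omega>) \<partial>M) =
      (\<integral>\<omega>. indicator ?A \<omega> * (F \<omega> * (real (N b \<omega>) - real (N a \<omega>))) \<partial>M) - lam * (b - a) * (\<integral>\<omega>. indicator ?A \<omega> * F \<omega> \<partial>M)" .
  have "(LINT \<omega>:?A|M. defect a b \<omega>) = (\<integral>\<omega>. indicator ?A \<omega> * defect a b \<omega> \<partial>M)"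
    by (simp add: set_lebesgue_integral_def)
  also have "\<dots> = (\<integral>\<omega>. indicator ?A \<omega> * (F \<omega> * incr a b \<omega>) \<partial>M) -
      lam * (\<integral>x. indicator {a<..b} (fst x) * indicator ?A (snd x) * grad f x \<partial>prodM)"
    using ab A by (intro integral_mult_defect[where C=1]) (auto simp: indicator_def)
  also have "\<dots> = 0" unfolding 1 2 3 by (simp add: algebra_simps)
  finally show ?thesis .
qed

lemma defect_NA:
  assumes ab: "0 \<le> a" "a < b" "b \<le> T" and A: "A \<in> sets (null_augmented M N a)"
  shows "(LINT \<omega>:A|M. defect a b \<omega>) = 0"
proof (rule set_integral_zero_generate[of M "defect a b" "cylinders_and_null {0..a}"])
  show "integrable M (defect a b)" using integrable_defect ab by simp
  have D: "{0..a} \<subseteq> {0..T}" using ab by auto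
  show "Int_stable (cylinders_and_null {0..a})" "cylinders_and_null {0..a} \<subseteq> sets M"
    using Int_stable_cylinders_and_null[OF D] cylinders_and_null_subset[OF D] by auto
  show "(LINT \<omega>:A|M. defect a b \<omega>) = 0" if "A \<in> cylinders_and_null {0..a}" for A
    using that unfolding cylinders_and_null_def
  proof
    assume "A \<in> null_sets M"
    then have "AE \<omega> in M. indicator A \<omega> *\<^sub>R defect a b \<omega> = 0"
      using AE_not_in[of A M] by auto
    then show ?thesis unfolding set_lebesgue_integral_def by (rule integral_eq_zero_AE)
  qed (use defect_cylinder[OF ab] in auto)
  have "(LINT \<omega>:path_cylinder []|M. defect a b \<omega>) = 0" by (rule defect_cylinder[OF ab]) simp
  then show "(\<integral>\<omega>. defect a b \<omega> \<partial>M) = 0"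
    using integrable_defect[of a b] ab by (simp add: path_cylinder_def set_integral_space)
  show "A \<in> sigma_sets (space M) (cylinders_and_null {0..a})" using A sets_NA_cylinders by auto
qed

text \<open>
  A function that is measurable at time \<open>a\<close> for the right-continuous filtration is measurable for the
  null-augmented natural filtration at every later time \<open>s n\<close>. The formula on \<open>(s n, b]\<close> is known from
  the cylinders, and by right-continuity of the paths one can let \<open>s n\<close> decrease to \<open>a\<close>.
\<close>

theorem integration_by_parts:
  assumes ab: "0 \<le> a" "a \<le> b" "b \<le> T" and \<xi>: "\<xi> \<in> borel_measurable (filt M T N a)"
    and C: "\<And>\<omega>. \<omega> \<in> space M \<Longrightarrow> \<bar>\<xi> \<omega>\<bar> \<le> C"
  shows "(\<integral>\<omega>. \<xi> \<omega> * (F \<omega> * incr a b \<omega>) \<partial>M) =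
    lam * (\<integral>x. indicator {a<..b} (fst x) * \<xi> (snd x) * grad f x \<partial>prodM)"
proof (cases "a = b")
  case True
  then show ?thesis by (simp add: compensated_def)
next
  case False
  then have "a < b" using ab by simp
  have \<xi>M [measurable]: "\<xi> \<in> borel_measurable M" by (rule measurable_from_subalg[OF subalgebra_filt \<xi>])
  define s where "s n = a + (b - a) / real (Suc (Suc n))" for n
  have s: "a < s n" "s n < b" for n
  proof -
    have "0 < b - a" using \<open>a < b\<close> by simp
    then have "(b - a) / real (Suc (Suc n)) < (b - a) / 1" "0 < (b - a) / real (Suc (Suc n))"
      by (intro divide_strict_left_mono divide_pos_pos; simp)+
    then show "a < s n" "s n < b" unfolding s_def by simp_all
  qed
  have "(\<lambda>n. a + (b - a) / real (Suc (Suc n))) \<longlonglongrightarrow> a + 0"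
    by (intro tendsto_intros LIMSEQ_Suc lim_const_over_n)
  then have s_lim: "s \<longlonglongrightarrow> a" unfolding s_def by simp
  have s_right: "filterlim s (at_right a) sequentially"
    unfolding filterlim_at using s_lim s(1) by (auto simp: less_imp_neq[THEN not_sym])
  have eq: "(\<integral>\<omega>. \<xi> \<omega> * (F \<omega> * incr (s n) b \<omega>) \<partial>M) =
      lam * (\<integral>x. indicator {s n<..b} (fst x) * \<xi> (snd x) * grad f x \<partial>prodM)" for n
  proof -
    have sn: "0 \<le> s n" "s n \<le> b" using s[of n] ab by auto
    have "subalgebra (null_augmented M N (s n)) (filt M T N a)"
      using filt_subset_NA[of a "s n"] s[of n] ab by (auto simp: subalgebra_def space_NA space_filt)
    then have \<xi>n: "\<xi> \<in> borel_measurable (null_augmented M N (s n))" using \<xi> by (rule measurable_from_subalg)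
    have "(\<integral>\<omega>. \<xi> \<omega> * defect (s n) b \<omega> \<partial>M) = 0"
    proof (rule integral_mult_eq_zero[OF subalgebra_NA])
      show "s n \<le> T" using s[of n] ab by simp
      show "integrable M (defect (s n) b)" using integrable_defect[OF sn] ab by simp
      from integrable_bounded_mult[OF \<xi>M C this]
      show "integrable M (\<lambda>\<omega>. \<xi> \<omega> * defect (s n) b \<omega>)" .
      show "(LINT \<omega>:A|M. defect (s n) b \<omega>) = 0" if "A \<in> sets (null_augmented M N (s n))" for A
        using defect_NA[OF sn(1) s(2) ab(3) that] .
    qed (rule \<xi>n)
    then show ?thesis using integral_mult_defect[OF sn ab(3) \<xi>M C] by simp
  qed
  have C0: "0 \<le> C" using C not_empty by fastforce
  have L: "(\<lambda>n. \<integral>\<omega>. \<xi> \<omega> * (F \<omega> * incr (s n) b \<omega>) \<partial>M) \<longlonglongrightarrow> (\<integral>\<omega>. \<xi> \<omega> * (F \<omega> * incr a b \<omega>) \<partial>M)"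
  proof (rule integral_dominated_convergence)
    have [measurable]: "incr a b \<in> borel_measurable M" "incr (s n) b \<in> borel_measurable M" for n
      using measurable_incr[of a b] measurable_incr[of "s n" b] s[of n] ab by auto
    show "(\<lambda>\<omega>. \<xi> \<omega> * (F \<omega> * incr a b \<omega>)) \<in> borel_measurable M"
      "\<And>n. (\<lambda>\<omega>. \<xi> \<omega> * (F \<omega> * incr (s n) b \<omega>)) \<in> borel_measurable M" by measurable
    show "integrable M (\<lambda>\<omega>. C * \<bar>F \<omega> * (real (N T \<omega>) - real (N 0 \<omega>))\<bar> + C * (lam * T) * \<bar>F \<omega>\<bar>)"
      using integrable_F_increment[of 0 T] integrable_L2[OF F_L2] T_pos by auto
    show "AE \<omega> in M. (\<lambda>n. \<xi> \<omega> * (F \<omega> * incr (s n) b \<omega>)) \<longlonglongrightarrow> \<xi> \<omega> * (F \<omega> * incr a b \<omega>)"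
      using AE_space
    proof eventually_elim
      case (elim \<omega>)
      have "(\<lambda>n. real (N (s n) \<omega>)) \<longlonglongrightarrow> real (N a \<omega>)"
        using N_right_cont[OF elim, of a] ab \<open>a < b\<close> by (intro filterlim_compose[OF _ s_right]) auto
      then show ?case unfolding compensated_def by (intro tendsto_intros s_lim)
    qed
    show "AE \<omega> in M. norm (\<xi> \<omega> * (F \<omega> * incr (s n) b \<omega>)) \<le>
        C * \<bar>F \<omega> * (real (N T \<omega>) - real (N 0 \<omega>))\<bar> + C * (lam * T) * \<bar>F \<omega>\<bar>" for n
      using AE_space
    proof eventually_elim
      case (elim \<omega>)
      have "N (s n) \<omega> \<le> N b \<omega>" "N b \<omega> \<le> N T \<omega>" using s[of n] ab N_mono[OF elim] by auto
      moreover have "0 \<le> lam * (b - s n)" "lam * (b - s n) \<le> lam * T"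
        using lam_pos s[of n] ab by (auto intro!: mult_left_mono)
      ultimately have "\<bar>incr (s n) b \<omega>\<bar> \<le> (real (N T \<omega>) - real (N 0 \<omega>)) + lam * T"
        unfolding compensated_def using N_zero[OF elim] by (auto simp: algebra_simps abs_le_iff)
      then have "\<bar>\<xi> \<omega>\<bar> * (\<bar>F \<omega>\<bar> * \<bar>incr (s n) b \<omega>\<bar>) \<le>
          C * (\<bar>F \<omega>\<bar> * ((real (N T \<omega>) - real (N 0 \<omega>)) + lam * T))"
        using C[OF elim] C0 by (intro mult_mono) auto
      moreover have "norm (\<xi> \<omega> * (F \<omega> * incr (s n) b \<omega>)) = \<bar>\<xi> \<omega>\<bar> * (\<bar>F \<omega>\<bar> * \<bar>incr (s n) b \<omega>\<bar>)"
        by (simp only: real_norm_def abs_mult)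
      moreover have "C * (\<bar>F \<omega>\<bar> * ((real (N T \<omega>) - real (N 0 \<omega>)) + lam * T)) =
          C * \<bar>F \<omega> * (real (N T \<omega>) - real (N 0 \<omega>))\<bar> + C * (lam * T) * \<bar>F \<omega>\<bar>"
        using N_zero[OF elim] by (simp add: abs_mult algebra_simps)
      ultimately show ?case by linarith
    qed
  qed
  have R: "(\<lambda>n. \<integral>x. indicator {s n<..b} (fst x) * \<xi> (snd x) * grad f x \<partial>prodM) \<longlonglongrightarrow>
      (\<integral>x. indicator {a<..b} (fst x) * \<xi> (snd x) * grad f x \<partial>prodM)"
  proof (rule integral_dominated_convergence)
    show "(\<lambda>x. indicator {a<..b} (fst x) * \<xi> (snd x) * grad f x) \<in> borel_measurable prodM"
      "\<And>n. (\<lambda>x. indicator {s n<..b} (fst x) * \<xi> (snd x) * grad f x) \<in> borel_measurable prodM" by measurable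
    show "integrable prodM (\<lambda>x. C * \<bar>grad f x\<bar>)" using integrable_grad by auto
    show "AE x in prodM. (\<lambda>n. indicator {s n<..b} (fst x) * \<xi> (snd x) * grad f x) \<longlonglongrightarrow>
        indicator {a<..b} (fst x) * \<xi> (snd x) * grad f x"
    proof (intro AE_I2 tendsto_mult_right)
      fix x :: "real \<times> 'a"
      have "eventually (\<lambda>n. indicator {s n<..b} (fst x) = (indicator {a<..b} (fst x) :: real)) sequentially"
      proof (cases "a < fst x")
        case True
        then have "eventually (\<lambda>n. s n < fst x) sequentially" using s_lim by (simp add: order_tendstoD)
        then show ?thesis by eventually_elim (use True in \<open>auto simp: indicator_def\<close>)
      next
        case False
        have "indicator {s n<..b} (fst x) = (indicator {a<..b} (fst x) :: real)" for n
          using False s(1)[of n] by (auto simp: indicator_def)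
        then show ?thesis by simp
      qed
      then show "(\<lambda>n. indicator {s n<..b} (fst x)) \<longlonglongrightarrow> (indicator {a<..b} (fst x) :: real)"
        by (rule tendsto_eventually)
    qed
    show "AE x in prodM. norm (indicator {s n<..b} (fst x) * \<xi> (snd x) * grad f x) \<le> C * \<bar>grad f x\<bar>" for n
      using AE_space
    proof eventually_elim
      case (elim x)
      have "\<bar>\<xi> (snd x)\<bar> \<le> C" using C elim by (auto simp: space_pair_measure)
      then show ?case using C0 by (auto simp: indicator_def abs_mult intro!: mult_right_mono)
    qed
  qed
  show ?thesis
    using LIMSEQ_unique[OF L] tendsto_mult_left[OF R, of lam] unfolding eq by blast
qed

end

context poisson_setting
begin

lemma config_functional_const: "config_functional M N lam T (\<lambda>_. 1) (\<lambda>_. 1)"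
  by unfold_locales (auto simp: L2_def is_config_functional_def)

lemma config_functional_incr:
  assumes ab: "0 \<le> a" "a \<le> b" "b \<le> T"
  shows "config_functional M N lam T (incr a b)
    (\<lambda>\<eta>. real (card (\<eta> \<inter> {0..b})) - real (card (\<eta> \<inter> {0..a})) - lam * (b - a))"
proof unfold_locales
  show "incr a b \<in> L2 M" by (rule incr_L2[OF ab])
  show "is_config_functional M T N (incr a b)
      (\<lambda>\<eta>. real (card (\<eta> \<inter> {0..b})) - real (card (\<eta> \<inter> {0..a})) - lam * (b - a))"
    unfolding is_config_functional_def
  proof
    show "AE \<omega> in M. incr a b \<omega> = real (card (conf \<omega> \<inter> {0..b})) - real (card (conf \<omega> \<inter> {0..a})) - lam * (b - a)"
      using AE_count by eventually_elim (use ab in \<open>auto simp: compensated_def algebra_simps\<close>)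
  qed measurable
qed

text \<open>
  Integration by parts for the constant functional, whose gradient vanishes.
\<close>

lemma incr_mean_zero:
  assumes ab: "0 \<le> a" "a \<le> b" "b \<le> T" and \<zeta>: "\<zeta> \<in> borel_measurable (filt M T N a)"
    and int: "integrable M (\<lambda>\<omega>. \<zeta> \<omega> * incr a b \<omega>)"
  shows "(\<integral>\<omega>. \<zeta> \<omega> * incr a b \<omega> \<partial>M) = 0"
proof (rule integral_mult_eq_zero[OF subalgebra_filt _ _ \<zeta> int])
  interpret one: config_functional M N lam T "\<lambda>_. 1" "\<lambda>_. 1" by (rule config_functional_const)
  show "integrable M (incr a b)" by (rule integrable_L2[OF incr_L2[OF ab]])
  show "(LINT \<omega>:A|M. incr a b \<omega>) = 0" if "A \<in> sets (filt M T N a)" for A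
    using one.integration_by_parts[OF ab, of "indicator A" 1] that
    by (simp add: set_lebesgue_integral_def discrete_gradient_def add_point_def)
qed

text \<open>
  Integration by parts for the increment as functional: off the jump times its gradient is one on the
  interval.
\<close>

lemma incr_second_moment:
  assumes ab: "0 \<le> a" "a \<le> b" "b \<le> T" and \<xi>: "\<xi> \<in> borel_measurable (filt M T N a)"
    and C: "\<And>\<omega>. \<omega> \<in> space M \<Longrightarrow> \<bar>\<xi> \<omega>\<bar> \<le> C"
  shows "(\<integral>\<omega>. \<xi> \<omega> * (incr a b \<omega>)\<^sup>2 \<partial>M) = lam * (b - a) * (\<integral>\<omega>. \<xi> \<omega> \<partial>M)"
proof -
  let ?f = "\<lambda>\<eta>. real (card (\<eta> \<inter> {0..b})) - real (card (\<eta> \<inter> {0..a})) - lam * (b - a)"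
  interpret i: config_functional M N lam T "incr a b" ?f by (rule config_functional_incr[OF ab])
  have \<xi>M [measurable]: "\<xi> \<in> borel_measurable M" by (rule measurable_from_subalg[OF subalgebra_filt \<xi>])
  have "integrable M \<xi>" using integrable_bounded_mult[OF \<xi>M C, of "\<lambda>_. 1"] by simp
  note rect = integral_rect[OF this ab]
  have "(\<integral>\<omega>. \<xi> \<omega> * (incr a b \<omega>)\<^sup>2 \<partial>M) =
      lam * (\<integral>x. indicator {a<..b} (fst x) * \<xi> (snd x) * grad ?f x \<partial>prodM)"
    using i.integration_by_parts[OF ab \<xi> C] by (simp add: power2_eq_square)
  also have "(\<integral>x. indicator {a<..b} (fst x) * \<xi> (snd x) * grad ?f x \<partial>prodM) =
      (\<integral>x. indicator {a<..b} (fst x) * \<xi> (snd x) \<partial>prodM)"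
  proof (rule integral_cong_AE)
    show "AE x in prodM. indicator {a<..b} (fst x) * \<xi> (snd x) * grad ?f x = indicator {a<..b} (fst x) * \<xi> (snd x)"
      using AE_not_in_conf AE_space
    proof eventually_elim
      case (elim x)
      then have "finite (conf (snd x))" "0 \<le> fst x" using finite_conf
        by (auto simp: space_pair_measure space_time_measure)
      then show ?case using elim ab
        by (auto simp: discrete_gradient_def add_point_def card_insert_count indicator_def)
    qed
  qed measurable
  finally show ?thesis using rect by simp
qed

definition elementary :: "real \<Rightarrow> real \<Rightarrow> ('a \<Rightarrow> real) \<Rightarrow> bool" where
  "elementary a b \<xi> \<longleftrightarrow> 0 \<le> a \<and> a \<le> b \<and> b \<le> T \<and> \<xi> \<in> borel_measurable (filt M T N a) \<and>
     (\<exists>C. \<forall>\<omega>\<in>space M. \<bar>\<xi> \<omega>\<bar> \<le> C)"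

lemma elementary_meas: "elementary a b \<xi> \<Longrightarrow> \<xi> \<in> borel_measurable M"
  using measurable_from_subalg[OF subalgebra_filt] by (auto simp: elementary_def)

lemma bounded_mult_L2:
  assumes "\<xi> \<in> borel_measurable M" "\<And>\<omega>. \<omega> \<in> space M \<Longrightarrow> \<bar>\<xi> \<omega>\<bar> \<le> C" "G \<in> L2 M"
  shows "(\<lambda>\<omega>. \<xi> \<omega> * G \<omega>) \<in> L2 M"
proof -
  have "integrable M (\<lambda>\<omega>. (\<xi> \<omega>)\<^sup>2 * (G \<omega>)\<^sup>2)"
  proof (rule integrable_bounded_mult)
    show "\<bar>(\<xi> \<omega>)\<^sup>2\<bar> \<le> C\<^sup>2" if "\<omega> \<in> space M" for \<omega>
      using power_mono[OF assms(2)[OF that], of 2] by simp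
  qed (use assms in \<open>auto simp: L2_def\<close>)
  then show ?thesis using assms by (auto simp: L2_def power_mult_distrib)
qed

lemma elementary_L2: "elementary a b \<xi> \<Longrightarrow> (\<lambda>\<omega>. \<xi> \<omega> * incr a b \<omega>) \<in> L2 M"
proof -
  assume e: "elementary a b \<xi>"
  obtain C where "\<And>\<omega>. \<omega> \<in> space M \<Longrightarrow> \<bar>\<xi> \<omega>\<bar> \<le> C" using e unfolding elementary_def by blast
  then show ?thesis
    using e by (intro bounded_mult_L2[OF elementary_meas[OF e]] incr_L2) (auto simp: elementary_def)
qed

lemma filt_measurable_mono:
  "a \<le> c \<Longrightarrow> \<xi> \<in> borel_measurable (filt M T N a) \<Longrightarrow> \<xi> \<in> borel_measurable (filt M T N c)"
  by (rule measurable_from_subalg[of "filt M T N c" "filt M T N a"])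
    (use filt_mono in \<open>auto simp: subalgebra_def space_filt\<close>)

lemma incr_measurable_filt:
  "0 \<le> a \<Longrightarrow> a \<le> b \<Longrightarrow> b \<le> c \<Longrightarrow> c \<le> T \<Longrightarrow> incr a b \<in> borel_measurable (filt M T N c)"
  unfolding compensated_def using measurable_N_filt[of a c] measurable_N_filt[of b c] by measurable

text \<open>
  The first increment and both weights are known at time \<open>c\<close>, and the increment after \<open>c\<close> is centred
  given that past.
\<close>

lemma orthogonal_incr:
  assumes "elementary a b \<xi>" "elementary c d \<zeta>" "b \<le> c"
  shows "(\<integral>\<omega>. (\<xi> \<omega> * incr a b \<omega>) * (\<zeta> \<omega> * incr c d \<omega>) \<partial>M) = 0"
proof -
  have "(\<integral>\<omega>. (\<xi> \<omega> * incr a b \<omega> * \<zeta> \<omega>) * incr c d \<omega> \<partial>M) = 0"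
  proof (rule incr_mean_zero)
    show "(\<lambda>\<omega>. \<xi> \<omega> * incr a b \<omega> * \<zeta> \<omega>) \<in> borel_measurable (filt M T N c)"
      using assms by (auto simp: elementary_def intro!: borel_measurable_times incr_measurable_filt
          intro: filt_measurable_mono)
    show "integrable M (\<lambda>\<omega>. \<xi> \<omega> * incr a b \<omega> * \<zeta> \<omega> * incr c d \<omega>)"
      using integrable_L2_mult[OF elementary_L2[OF assms(1)] elementary_L2[OF assms(2)]] by (simp add: mult.assoc)
  qed (use assms in \<open>auto simp: elementary_def\<close>)
  then show ?thesis by (simp add: mult.assoc)
qed

lemma elementary_subinterval:
  "elementary a b \<xi> \<Longrightarrow> a \<le> c \<Longrightarrow> c \<le> d \<Longrightarrow> d \<le> T \<Longrightarrow> elementary c d \<xi>"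
  using filt_measurable_mono by (auto simp: elementary_def)

lemma elementary_mult: "elementary a b \<xi> \<Longrightarrow> elementary a b \<zeta> \<Longrightarrow> elementary a b (\<lambda>\<omega>. \<xi> \<omega> * \<zeta> \<omega>)"
proof -
  assume *: "elementary a b \<xi>" "elementary a b \<zeta>"
  obtain C where C: "\<And>\<omega>. \<omega> \<in> space M \<Longrightarrow> \<bar>\<xi> \<omega>\<bar> \<le> C" using *(1) unfolding elementary_def by blast
  obtain D where D: "\<And>\<omega>. \<omega> \<in> space M \<Longrightarrow> \<bar>\<zeta> \<omega>\<bar> \<le> D" using *(2) unfolding elementary_def by blast
  have "\<bar>\<xi> \<omega> * \<zeta> \<omega>\<bar> \<le> C * D" if "\<omega> \<in> space M" for \<omega>
  proof -
    have "0 \<le> C" using C[OF that] abs_ge_zero order_trans by blast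
    then show ?thesis unfolding abs_mult using C[OF that] D[OF that] by (intro mult_mono) auto
  qed
  then show ?thesis using * by (auto simp: elementary_def)
qed

text \<open>
  Let \<open>a \<le> c\<close>. The part of the first interval before \<open>c\<close> is orthogonal to the second one. What remains are
  two increments that both start at \<open>c\<close>; the longer one exceeds the shorter one by a later increment,
  which is orthogonal again, and the square of the shorter one is given by the second moment.
\<close>

lemma elementary_isometry:
  assumes "elementary a b \<xi>" "elementary c d \<zeta>"
  shows "(\<integral>\<omega>. (\<xi> \<omega> * incr a b \<omega>) * (\<zeta> \<omega> * incr c d \<omega>) \<partial>M) =
    lam * (\<integral>x. (\<xi> (snd x) * indicator {a<..b} (fst x)) * (\<zeta> (snd x) * indicator {c<..d} (fst x)) \<partial>prodM)"
proof -
  have *: "(\<integral>\<omega>. (\<xi> \<omega> * incr a b \<omega>) * (\<zeta> \<omega> * incr c d \<omega>) \<partial>M) =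
    lam * (\<integral>x. (\<xi> (snd x) * indicator {a<..b} (fst x)) * (\<zeta> (snd x) * indicator {c<..d} (fst x)) \<partial>prodM)"
    if e: "elementary a b \<xi>" "elementary c d \<zeta>" and ac: "a \<le> c" for a b \<xi> c d \<zeta>
  proof (cases "b \<le> c")
    case True
    then have z: "(\<lambda>x :: real \<times> 'a. (\<xi> (snd x) * indicator {a<..b} (fst x)) * (\<zeta> (snd x) * indicator {c<..d} (fst x))) =
        (\<lambda>_. 0 :: real)" by (auto simp: indicator_def fun_eq_iff)
    show ?thesis unfolding z orthogonal_incr[OF e True] by simp
  next
    case False
    define m where "m = min b d"
    define n where "n = max b d"
    have b: "0 \<le> a" "c \<le> b" "b \<le> T" "c \<le> d" "d \<le> T" using e False by (auto simp: elementary_def)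
    have m: "c \<le> m" "m \<le> n" "n \<le> T" "m \<le> T" using b by (auto simp: m_def n_def)
    have e1: "elementary a c \<xi>" using e ac b unfolding elementary_def by auto
    have \<xi>c: "elementary c d \<xi>" using elementary_subinterval[OF e(1)] ac b by auto
    have \<xi>\<zeta>: "elementary c d (\<lambda>\<omega>. \<xi> \<omega> * \<zeta> \<omega>)" by (rule elementary_mult[OF \<xi>c e(2)])
    have \<xi>\<zeta>m: "elementary c m (\<lambda>\<omega>. \<xi> \<omega> * \<zeta> \<omega>)" using elementary_subinterval[OF \<xi>\<zeta>] m by auto
    have one: "elementary m n (\<lambda>_. 1)" using m b ac by (auto simp: elementary_def)
    obtain C where C: "\<And>\<omega>. \<omega> \<in> space M \<Longrightarrow> \<bar>\<xi> \<omega> * \<zeta> \<omega>\<bar> \<le> C" using \<xi>\<zeta> unfolding elementary_def by blast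
    have int\<xi>\<zeta>: "integrable M (\<lambda>\<omega>. \<xi> \<omega> * \<zeta> \<omega>)"
      using integrable_bounded_mult[OF elementary_meas[OF \<xi>\<zeta>] C, of "\<lambda>_. 1"] by simp
    have i0: "integrable M (\<lambda>\<omega>. (\<xi> \<omega> * incr a c \<omega>) * (\<zeta> \<omega> * incr c d \<omega>))"
      using integrable_L2_mult[OF elementary_L2[OF e1] elementary_L2[OF e(2)]] .
    have i1: "integrable M (\<lambda>\<omega>. (\<xi> \<omega> * \<zeta> \<omega>) * (incr c m \<omega>)\<^sup>2)"
      using integrable_bounded_mult[OF elementary_meas[OF \<xi>\<zeta>] C integrable_incr_sq[of c m]] m b ac by auto
    have i2: "integrable M (\<lambda>\<omega>. (\<xi> \<omega> * \<zeta> \<omega> * incr c m \<omega>) * (1 * incr m n \<omega>))"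
      using integrable_L2_mult[OF elementary_L2[OF \<xi>\<zeta>m] elementary_L2[OF one]] .
    \<comment> \<open>of the two intervals from \<open>c\<close>, the shorter one ends at \<open>m\<close> and the longer one at \<open>n\<close>\<close>
    have split: "(\<xi> \<omega> * incr a b \<omega>) * (\<zeta> \<omega> * incr c d \<omega>) =
        (\<xi> \<omega> * incr a c \<omega>) * (\<zeta> \<omega> * incr c d \<omega>) + ((\<xi> \<omega> * \<zeta> \<omega>) * (incr c m \<omega>)\<^sup>2 +
        (\<xi> \<omega> * \<zeta> \<omega> * incr c m \<omega>) * (1 * incr m n \<omega>))" for \<omega>
      unfolding m_def n_def by (cases "b \<le> d") (simp_all add: min_def max_def power2_eq_square algebra_simps)
    have "(\<integral>\<omega>. (\<xi> \<omega> * incr a b \<omega>) * (\<zeta> \<omega> * incr c d \<omega>) \<partial>M) = lam * ((m - c) * (\<integral>\<omega>. \<xi> \<omega> * \<zeta> \<omega> \<partial>M))"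
      unfolding split
      using i0 i1 i2 orthogonal_incr[OF e1 e(2) order_refl] orthogonal_incr[OF \<xi>\<zeta>m one order_refl]
        incr_second_moment[of c m "\<lambda>\<omega>. \<xi> \<omega> * \<zeta> \<omega>" C] C \<xi>\<zeta> m by (simp add: elementary_def)
    also have "(m - c) * (\<integral>\<omega>. \<xi> \<omega> * \<zeta> \<omega> \<partial>M) = (\<integral>x. indicator {c<..m} (fst x) * (\<xi> (snd x) * \<zeta> (snd x)) \<partial>prodM)"
      using integral_rect(2)[OF int\<xi>\<zeta>, of c m] m b ac by auto
    also have "\<dots> = (\<integral>x. (\<xi> (snd x) * indicator {a<..b} (fst x)) * (\<zeta> (snd x) * indicator {c<..d} (fst x)) \<partial>prodM)"
      using ac by (intro Bochner_Integration.integral_cong refl) (auto simp: indicator_def m_def)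
    finally show ?thesis by (simp add: mult.assoc)
  qed
  show ?thesis
  proof (cases "a \<le> c")
    case True then show ?thesis using *[OF assms] by simp
  next
    case False
    then have "c \<le> a" by simp
    from *[OF assms(2,1) this] show ?thesis by (simp add: mult.commute)
  qed
qed

section \<open>Predictable rectangles and simple integrands\<close>

abbreviation "predM \<equiv> predictable_sigma M T N"

definition predictable_rectangles :: "(real \<times> 'a) set set" where
  "predictable_rectangles = {{0} \<times> A | A. A \<in> sets (filt M T N 0)} \<union>
      {{s<..t} \<times> A | s t A. 0 \<le> s \<and> s \<le> t \<and> t \<le> T \<and> A \<in> sets (filt M T N s)}"

lemma predictable_rectangles_subset: "predictable_rectangles \<subseteq> sets prodM"
proof -
  have "{0} \<in> sets (time_measure T)"
    unfolding time_measure_def using T_pos by (subst sets_restrict_space_iff) auto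
  then show ?thesis using filt_subset sets_time
    unfolding predictable_rectangles_def by (auto intro!: pair_measureI)
qed

lemma space_prod: "space prodM = {0..T} \<times> space M"
  by (simp add: space_pair_measure space_time_measure)

lemma predictable_rectangles_Pow: "predictable_rectangles \<subseteq> Pow ({0..T} \<times> space M)"
  using predictable_rectangles_subset sets.sets_into_space space_prod by blast

lemma space_pred: "space predM = {0..T} \<times> space M"
  unfolding predictable_sigma_def predictable_rectangles_def[symmetric]
  using predictable_rectangles_Pow by (rule space_measure_of)

lemma sets_pred: "sets predM = sigma_sets ({0..T} \<times> space M) predictable_rectangles"
  unfolding predictable_sigma_def predictable_rectangles_def[symmetric]
  using predictable_rectangles_Pow by (rule sets_measure_of)

lemma subalgebra_pred: "subalgebra prodM predM"
  unfolding subalgebra_def space_pred space_prod sets_pred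
  using sets.sigma_sets_subset[OF predictable_rectangles_subset] by (simp add: space_prod)

lemma Int_stable_predictable_rectangles: "Int_stable predictable_rectangles"
proof -
  have e: "{} \<in> predictable_rectangles"
    unfolding predictable_rectangles_def by (rule UnI1) (auto intro!: exI[of _ "{}"])
  have z: "({0} \<times> A) \<inter> ({0} \<times> B) \<in> predictable_rectangles"
    if "A \<in> sets (filt M T N 0)" "B \<in> sets (filt M T N 0)" for A B
    unfolding predictable_rectangles_def using that by (intro UnI1 CollectI exI[of _ "A \<inter> B"]) auto
  have i: "({s<..t} \<times> A) \<inter> ({s'<..t'} \<times> B) \<in> predictable_rectangles"
    if "0 \<le> s" "s \<le> t" "t \<le> T" "A \<in> sets (filt M T N s)"
      "0 \<le> s'" "s' \<le> t'" "t' \<le> T" "B \<in> sets (filt M T N s')" for s t A s' t' B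
  proof (cases "max s s' \<le> min t t'")
    case True
    have "A \<inter> B \<in> sets (filt M T N (max s s'))"
      using that filt_mono[of s "max s s'"] filt_mono[of s' "max s s'"] by auto
    then show ?thesis unfolding predictable_rectangles_def using that True
      by (intro UnI2 CollectI exI[of _ "max s s'"] exI[of _ "min t t'"] exI[of _ "A \<inter> B"]) auto
  next
    case False
    then have "({s<..t} \<times> A) \<inter> ({s'<..t'} \<times> B) = {}" by auto
    then show ?thesis using e by simp
  qed
  have m: "({0} \<times> A) \<inter> ({s<..t} \<times> B) = {}" "({s<..t} \<times> B) \<inter> ({0} \<times> A) = {}"
    if "0 \<le> s" for s t :: real and A B :: "'a set" using that by auto
  show ?thesis
  proof (rule Int_stableI)
    fix X Y assume "X \<in> predictable_rectangles" "Y \<in> predictable_rectangles"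
    then show "X \<inter> Y \<in> predictable_rectangles"
      by (subst (asm) (1 2) predictable_rectangles_def) (elim UnE CollectE exE conjE; simp only: z i m e)
  qed
qed

text \<open>
  Rectangles at time zero are null sets for \<open>prodM\<close>, so only those over intervals have to be tested.
\<close>

lemma predictable_integral_zero:
  fixes Z :: "real \<times> 'a \<Rightarrow> real"
  assumes Z: "integrable prodM Z"
    and zero: "\<And>a b A. 0 \<le> a \<Longrightarrow> a \<le> b \<Longrightarrow> b \<le> T \<Longrightarrow> A \<in> sets (filt M T N a) \<Longrightarrow>
      (\<integral>x. indicator {a<..b} (fst x) * indicator A (snd x) * Z x \<partial>prodM) = 0"
    and P: "P \<in> sets predM"
  shows "(LINT x:P|prodM. Z x) = 0"
proof (rule set_integral_zero_generate[OF Z Int_stable_predictable_rectangles predictable_rectangles_subset])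
  have m [measurable]: "Z \<in> borel_measurable prodM" using Z by auto
  show "(LINT x:X|prodM. Z x) = 0" if "X \<in> predictable_rectangles" for X
    using that unfolding predictable_rectangles_def
  proof (elim UnE CollectE exE conjE)
    fix A assume X: "X = {0} \<times> A"
    have "AE x in prodM. indicator X x *\<^sub>R Z x = 0"
      using AE_fst_pos by eventually_elim (auto simp: X indicator_def)
    then show ?thesis unfolding set_lebesgue_integral_def by (rule integral_eq_zero_AE)
  next
    fix s t A assume X: "X = {s<..t} \<times> A" and a: "0 \<le> s" "s \<le> t" "t \<le> T" "A \<in> sets (filt M T N s)"
    have "(LINT x:X|prodM. Z x) = (\<integral>x. indicator {s<..t} (fst x) * indicator A (snd x) * Z x \<partial>prodM)"
      unfolding set_lebesgue_integral_def X
      by (intro Bochner_Integration.integral_cong refl) (auto simp: indicator_def)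
    then show ?thesis using zero[OF a] by simp
  qed
  have "(\<integral>x. Z x \<partial>prodM) = (\<integral>x. indicator {0<..T} (fst x) * indicator (space M) (snd x) * Z x \<partial>prodM)"
  proof (rule integral_cong_AE)
    show "AE x in prodM. Z x = indicator {0<..T} (fst x) * indicator (space M) (snd x) * Z x"
      using AE_fst_pos AE_space by eventually_elim (auto simp: space_prod)
  qed measurable
  also have "space M \<in> sets (filt M T N 0)" using sets.top[of "filt M T N 0"] by (simp add: space_filt)
  then have "(\<integral>x. indicator {0<..T} (fst x) * indicator (space M) (snd x) * Z x \<partial>prodM) = 0"
    using T_pos by (intro zero) auto
  finally show "(\<integral>x. Z x \<partial>prodM) = 0" .
  show "P \<in> sigma_sets (space prodM) predictable_rectangles"
    using P sets_pred space_prod by simp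
qed

sublocale pred: finite_measure_subalgebra prodM predM
  by unfold_locales (rule subalgebra_pred)

lemma elementary_process_predictable:
  assumes "elementary a b \<xi>"
  shows "(\<lambda>x. \<xi> (snd x) * indicator {a<..b} (fst x)) \<in> borel_measurable predM"
proof -
  let ?S = "{a<..b} \<times> space M"
  have e: "0 \<le> a" "a \<le> b" "b \<le> T" "\<xi> \<in> borel_measurable (filt M T N a)"
    using assms by (auto simp: elementary_def)
  have rect: "{a<..b} \<times> A \<in> sets predM" if "A \<in> sets (filt M T N a)" for A
    unfolding sets_pred predictable_rectangles_def using that e by (intro sigma_sets.Basic UnI2) blast
  have S: "?S \<in> sets predM" using rect[of "space M"] sets.top[of "filt M T N a"] by (simp add: space_filt)
  have S': "?S \<inter> space predM = ?S" using sets.sets_into_space[OF S] by auto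
  have "snd \<in> measurable (restrict_space predM ?S) (filt M T N a)"
  proof (rule measurableI)
    fix A assume A: "A \<in> sets (filt M T N a)"
    then have "A \<subseteq> space M" using sets.sets_into_space space_filt by blast
    then have "snd -` A \<inter> space (restrict_space predM ?S) = {a<..b} \<times> A"
      using S' by (auto simp: space_restrict_space)
    also have "\<dots> \<in> sets (restrict_space predM ?S)"
      using S rect[OF A] \<open>A \<subseteq> space M\<close> by (subst sets_restrict_space_iff) auto
    finally show "snd -` A \<inter> space (restrict_space predM ?S) \<in> sets (restrict_space predM ?S)" .
  qed (auto simp: space_restrict_space space_filt)
  then have "(\<lambda>x. \<xi> (snd x)) \<in> borel_measurable (restrict_space predM ?S)"
    using e(4) by (rule measurable_compose)
  then have "(\<lambda>x. indicator ?S x *\<^sub>R \<xi> (snd x)) \<in> borel_measurable predM"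
    using S S' by (subst (asm) borel_measurable_restrict_space_iff) auto
  then show ?thesis
    by (rule measurable_cong[THEN iffD1, rotated]) (auto simp: indicator_def space_pred)
qed

text \<open>
  Pairs of a simple integrand and its stochastic integral. The intervals of different summands
  may overlap, so that the pairs form a vector space without refining partitions.
\<close>

inductive simple_pair :: "(real \<times> 'a \<Rightarrow> real) \<Rightarrow> ('a \<Rightarrow> real) \<Rightarrow> bool" where
  zero: "simple_pair (\<lambda>_. 0) (\<lambda>_. 0)"
| step: "simple_pair u I \<Longrightarrow> elementary a b \<xi> \<Longrightarrow>
    simple_pair (\<lambda>x. u x + \<xi> (snd x) * indicator {a<..b} (fst x)) (\<lambda>\<omega>. I \<omega> + \<xi> \<omega> * incr a b \<omega>)"

lemma simple_pair_elementary:
  "elementary a b \<xi> \<Longrightarrow> simple_pair (\<lambda>x. \<xi> (snd x) * indicator {a<..b} (fst x)) (\<lambda>\<omega>. \<xi> \<omega> * incr a b \<omega>)"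
  using simple_pair.step[OF simple_pair.zero] by simp

lemma simple_pair_add:
  "simple_pair v J \<Longrightarrow> simple_pair u I \<Longrightarrow> simple_pair (\<lambda>x. u x + v x) (\<lambda>\<omega>. I \<omega> + J \<omega>)"
proof (induction rule: simple_pair.induct)
  case (step v J a b \<xi>)
  from simple_pair.step[OF step.IH[OF step.prems] step.hyps(2)] show ?case by (simp add: add.assoc)
qed simp

lemma simple_pair_scale: "simple_pair u I \<Longrightarrow> simple_pair (\<lambda>x. c * u x) (\<lambda>\<omega>. c * I \<omega>)"
proof (induction rule: simple_pair.induct)
  case (step u I a b \<xi>)
  have one: "elementary a b (\<lambda>_. c)" using step.hyps(2) by (auto simp: elementary_def)
  from simple_pair.step[OF step.IH elementary_mult[OF one step.hyps(2)]]
  show ?case by (simp add: algebra_simps)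
qed (use simple_pair.zero in simp)

lemma simple_pair_bounded: "simple_pair u I \<Longrightarrow> \<exists>C. \<forall>x\<in>space prodM. \<bar>u x\<bar> \<le> C"
proof (induction rule: simple_pair.induct)
  case (step u I a b \<xi>)
  then obtain C where C: "\<And>x. x \<in> space prodM \<Longrightarrow> \<bar>u x\<bar> \<le> C" by auto
  obtain D where D: "\<And>\<omega>. \<omega> \<in> space M \<Longrightarrow> \<bar>\<xi> \<omega>\<bar> \<le> D" using step.hyps(2) unfolding elementary_def by blast
  have "\<bar>u x + \<xi> (snd x) * indicator {a<..b} (fst x)\<bar> \<le> C + D" if "x \<in> space prodM" for x
  proof -
    have "\<bar>\<xi> (snd x)\<bar> \<le> D" "\<bar>u x\<bar> \<le> C" using that C D by (auto simp: space_prod)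
    then show ?thesis by (auto simp: indicator_def)
  qed
  then show ?case by blast
qed auto

lemma simple_pair_measurable: "simple_pair u I \<Longrightarrow> u \<in> borel_measurable predM"
proof (induction rule: simple_pair.induct)
  case (step u I a b \<xi>)
  then show ?case using elementary_process_predictable by (intro borel_measurable_add) auto
qed simp

lemma simple_pair_measurable_prod: "simple_pair u I \<Longrightarrow> u \<in> borel_measurable prodM"
  using measurable_from_subalg[OF subalgebra_pred] simple_pair_measurable by blast

lemma L2_add: "F \<in> L2 M \<Longrightarrow> G \<in> L2 M \<Longrightarrow> (\<lambda>\<omega>. F \<omega> + G \<omega>) \<in> L2 M"
  using integrable_L2_mult[of F G] by (auto simp: L2_def power2_sum mult.assoc)

lemma simple_pair_L2: "simple_pair u I \<Longrightarrow> I \<in> L2 M"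
proof (induction rule: simple_pair.induct)
  case zero then show ?case by (simp add: L2_def)
next
  case (step u I a b \<xi>)
  then show ?case using elementary_L2 by (intro L2_add) auto
qed

lemma simple_pair_integrable_mult:
  "simple_pair u I \<Longrightarrow> integrable prodM Z \<Longrightarrow> integrable prodM (\<lambda>x. u x * Z x)"
  using simple_pair_bounded[of u I] prod.integrable_bounded_mult[OF simple_pair_measurable_prod[of u I]] by blast

lemma simple_pair_integrable: "simple_pair u I \<Longrightarrow> integrable prodM u"
  using simple_pair_integrable_mult[of u I "\<lambda>_. 1"] by simp

theorem simple_pair_isometry:
  assumes "simple_pair u I" "simple_pair v J"
  shows "(\<integral>\<omega>. I \<omega> * J \<omega> \<partial>M) = lam * (\<integral>x. u x * v x \<partial>prodM)"
proof -
  have e: "(\<integral>\<omega>. I \<omega> * (\<zeta> \<omega> * incr c d \<omega>) \<partial>M) = lam * (\<integral>x. u x * (\<zeta> (snd x) * indicator {c<..d} (fst x)) \<partial>prodM)"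
    if "simple_pair u I" and z: "elementary c d \<zeta>" for u I c d \<zeta>
    using that(1)
  proof (induction rule: simple_pair.induct)
    case (step u I a b \<xi>)
    have 1: "integrable M (\<lambda>\<omega>. I \<omega> * (\<zeta> \<omega> * incr c d \<omega>))" "integrable M (\<lambda>\<omega>. (\<xi> \<omega> * incr a b \<omega>) * (\<zeta> \<omega> * incr c d \<omega>))"
      using step.hyps z by (auto intro!: integrable_L2_mult simple_pair_L2 elementary_L2)
    have 2: "integrable prodM (\<lambda>x. u x * (\<zeta> (snd x) * indicator {c<..d} (fst x)))"
      "integrable prodM (\<lambda>x. (\<xi> (snd x) * indicator {a<..b} (fst x)) * (\<zeta> (snd x) * indicator {c<..d} (fst x)))"
      by (rule simple_pair_integrable_mult[OF step.hyps(1) simple_pair_integrable[OF simple_pair_elementary[OF z]]],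
        rule simple_pair_integrable_mult[OF simple_pair_elementary[OF step.hyps(2)]
          simple_pair_integrable[OF simple_pair_elementary[OF z]]])
    show ?case using 1 2 step.IH elementary_isometry[OF step.hyps(2) z]
      by (simp add: distrib_right distrib_left)
  qed simp
  show ?thesis using assms(2)
  proof (induction rule: simple_pair.induct)
    case (step v J a b \<xi>)
    have 1: "integrable M (\<lambda>\<omega>. I \<omega> * J \<omega>)" "integrable M (\<lambda>\<omega>. I \<omega> * (\<xi> \<omega> * incr a b \<omega>))"
      using assms(1) step.hyps by (auto intro!: integrable_L2_mult simple_pair_L2 elementary_L2)
    have 2: "integrable prodM (\<lambda>x. u x * v x)" "integrable prodM (\<lambda>x. u x * (\<xi> (snd x) * indicator {a<..b} (fst x)))"
      by (rule simple_pair_integrable_mult[OF assms(1) simple_pair_integrable[OF step.hyps(1)]],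
        rule simple_pair_integrable_mult[OF assms(1)
          simple_pair_integrable[OF simple_pair_elementary[OF step.hyps(2)]]])
    show ?case using 1 2 step.IH e[OF assms(1) step.hyps(2)]
      by (simp add: distrib_left)
  qed simp
qed

end

context config_functional
begin

lemma simple_pair_duality:
  "simple_pair u I \<Longrightarrow> (\<integral>\<omega>. F \<omega> * I \<omega> \<partial>M) = lam * (\<integral>x. u x * grad f x \<partial>prodM)"
proof (induction rule: simple_pair.induct)
  case (step u I a b \<xi>)
  obtain C where C: "\<And>\<omega>. \<omega> \<in> space M \<Longrightarrow> \<bar>\<xi> \<omega>\<bar> \<le> C" using step.hyps(2) unfolding elementary_def by blast
  have e: "0 \<le> a" "a \<le> b" "b \<le> T" "\<xi> \<in> borel_measurable (filt M T N a)"
    using step.hyps by (auto simp: elementary_def)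
  have 1: "integrable M (\<lambda>\<omega>. F \<omega> * I \<omega>)" "integrable M (\<lambda>\<omega>. F \<omega> * (\<xi> \<omega> * incr a b \<omega>))"
    using step.hyps F_L2 by (auto intro!: integrable_L2_mult simple_pair_L2 elementary_L2)
  have 2: "integrable prodM (\<lambda>x. u x * grad f x)"
    "integrable prodM (\<lambda>x. \<xi> (snd x) * indicator {a<..b} (fst x) * grad f x)"
    using simple_pair_integrable_mult[OF step.hyps(1) integrable_grad]
      simple_pair_integrable_mult[OF simple_pair_elementary[OF step.hyps(2)] integrable_grad] by auto
  show ?case using 1 2 step.IH integration_by_parts[OF e C]
    by (simp add: distrib_left distrib_right mult.left_commute mult.commute)
qed simp

end

section \<open>Density of the simple integrands\<close>

lemma square_sum_le: "(a + b)\<^sup>2 \<le> 2 * a\<^sup>2 + 2 * (b::real)\<^sup>2"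
  using sum_squares_bound[of a b] by (simp add: power2_sum)

lemma nn_integral_square_sum_le:
  fixes a b w :: "'b \<Rightarrow> real"
  assumes [measurable]: "a \<in> borel_measurable K" "b \<in> borel_measurable K" "w \<in> borel_measurable K"
    and w: "\<And>x. 0 \<le> w x"
  shows "(\<integral>\<^sup>+x. ennreal ((a x + b x)\<^sup>2 * w x) \<partial>K) \<le>
    2 * (\<integral>\<^sup>+x. ennreal ((a x)\<^sup>2 * w x) \<partial>K) + 2 * (\<integral>\<^sup>+x. ennreal ((b x)\<^sup>2 * w x) \<partial>K)"
proof -
  have "ennreal ((a x + b x)\<^sup>2 * w x) \<le> 2 * ennreal ((a x)\<^sup>2 * w x) + 2 * ennreal ((b x)\<^sup>2 * w x)" for x
  proof -
    have "(a x + b x)\<^sup>2 * w x \<le> 2 * ((a x)\<^sup>2 * w x) + 2 * ((b x)\<^sup>2 * w x)"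
      using mult_right_mono[OF square_sum_le w, of "a x" "b x" x] by (simp add: algebra_simps)
    then have "ennreal ((a x + b x)\<^sup>2 * w x) \<le> ennreal (2 * ((a x)\<^sup>2 * w x) + 2 * ((b x)\<^sup>2 * w x))"
      by (rule ennreal_leI)
    also have "\<dots> = 2 * ennreal ((a x)\<^sup>2 * w x) + 2 * ennreal ((b x)\<^sup>2 * w x)"
      using w by (simp add: ennreal_plus ennreal_mult)
    finally show ?thesis .
  qed
  then have "(\<integral>\<^sup>+x. ennreal ((a x + b x)\<^sup>2 * w x) \<partial>K) \<le>
      (\<integral>\<^sup>+x. 2 * ennreal ((a x)\<^sup>2 * w x) + 2 * ennreal ((b x)\<^sup>2 * w x) \<partial>K)"
    by (intro nn_integral_mono)
  also have "\<dots> = 2 * (\<integral>\<^sup>+x. ennreal ((a x)\<^sup>2 * w x) \<partial>K) + 2 * (\<integral>\<^sup>+x. ennreal ((b x)\<^sup>2 * w x) \<partial>K)"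
    by (simp add: nn_integral_add nn_integral_cmult)
  finally show ?thesis .
qed

context poisson_setting
begin

text \<open>
  Approximation of \<open>h\<close> by simple integrands in \<open>L\<^sup>2\<close> with a weight \<open>w\<close>. The weight makes it
  possible to pass to the limit in a pairing with a process that is only known to be integrable.
\<close>

definition approximable :: "(real \<times> 'a \<Rightarrow> real) \<Rightarrow> (real \<times> 'a \<Rightarrow> real) \<Rightarrow> bool" where
  "approximable w h \<longleftrightarrow>
     (\<forall>\<epsilon>>0. \<exists>u I. simple_pair u I \<and> (\<integral>\<^sup>+x. ennreal ((h x - u x)\<^sup>2 * w x) \<partial>prodM) < ennreal \<epsilon>)"

lemma approximableE:
  assumes "approximable w h" "0 < \<epsilon>"
  obtains u I where "simple_pair u I" "(\<integral>\<^sup>+x. ennreal ((h x - u x)\<^sup>2 * w x) \<partial>prodM) < ennreal \<epsilon>"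
  using assms unfolding approximable_def by blast

lemma sets_pred_prod: "A \<in> sets predM \<Longrightarrow> A \<in> sets prodM"
  using subalgebra_pred by (auto simp: subalgebra_def)

lemma elementary_indicator:
  assumes "0 \<le> a" "a \<le> b" "b \<le> T" "A \<in> sets (filt M T N a)"
  shows "elementary a b (indicator A)"
proof -
  have "\<forall>\<omega>\<in>space M. \<bar>indicator A \<omega> :: real\<bar> \<le> 1" by (simp add: indicator_def)
  then show ?thesis using assms unfolding elementary_def by auto
qed

context
  fixes w :: "real \<times> 'a \<Rightarrow> real"
  assumes w: "integrable prodM w" and w_nonneg: "\<And>x. 0 \<le> w x"
begin

lemma w_meas [measurable]: "w \<in> borel_measurable prodM"
  using w by auto

lemma double_eps: "a < ennreal (\<epsilon> / 4) \<Longrightarrow> b < ennreal (\<epsilon> / 4) \<Longrightarrow> 0 < \<epsilon> \<Longrightarrow> 2 * a + 2 * b < ennreal \<epsilon>"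
proof -
  assume "a < ennreal (\<epsilon> / 4)" "b < ennreal (\<epsilon> / 4)" "0 < \<epsilon>"
  then obtain p q where pq: "a = ennreal p" "b = ennreal q" "0 \<le> p" "0 \<le> q"
    by (metis ennreal_cases ennreal_less_top less_irrefl less_trans top.not_eq_extremum)
  then have "p < \<epsilon> / 4" "q < \<epsilon> / 4"
    using \<open>a < ennreal (\<epsilon> / 4)\<close> \<open>b < ennreal (\<epsilon> / 4)\<close> by (auto simp: ennreal_less_iff)
  then have "ennreal (2 * p + 2 * q) < ennreal \<epsilon>" using pq by (intro ennreal_lessI) (use \<open>0 < \<epsilon>\<close> in auto)
  then show ?thesis using pq by (simp add: ennreal_plus ennreal_mult)
qed

lemma approximable_add:
  assumes [measurable]: "h \<in> borel_measurable prodM" "k \<in> borel_measurable prodM"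
    and "approximable w h" "approximable w k"
  shows "approximable w (\<lambda>x. h x + k x)"
  unfolding approximable_def
proof (intro allI impI)
  fix \<epsilon> :: real assume e: "0 < \<epsilon>"
  obtain u I where u: "simple_pair u I" "(\<integral>\<^sup>+x. ennreal ((h x - u x)\<^sup>2 * w x) \<partial>prodM) < ennreal (\<epsilon> / 4)"
    using approximableE[OF assms(3), of "\<epsilon> / 4"] e by auto
  obtain v J where v: "simple_pair v J" "(\<integral>\<^sup>+x. ennreal ((k x - v x)\<^sup>2 * w x) \<partial>prodM) < ennreal (\<epsilon> / 4)"
    using approximableE[OF assms(4), of "\<epsilon> / 4"] e by auto
  note [measurable] = simple_pair_measurable_prod[OF u(1)] simple_pair_measurable_prod[OF v(1)]
  have "(\<integral>\<^sup>+x. ennreal ((h x + k x - (u x + v x))\<^sup>2 * w x) \<partial>prodM) =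
      (\<integral>\<^sup>+x. ennreal (((h x - u x) + (k x - v x))\<^sup>2 * w x) \<partial>prodM)"
    by (simp add: algebra_simps)
  also have "\<dots> \<le> 2 * (\<integral>\<^sup>+x. ennreal ((h x - u x)\<^sup>2 * w x) \<partial>prodM) + 2 * (\<integral>\<^sup>+x. ennreal ((k x - v x)\<^sup>2 * w x) \<partial>prodM)"
    by (rule nn_integral_square_sum_le) (use w_nonneg in auto)
  also have "\<dots> < ennreal \<epsilon>" using u(2) v(2) e by (rule double_eps)
  finally show "\<exists>u I. simple_pair u I \<and> (\<integral>\<^sup>+x. ennreal ((h x + k x - u x)\<^sup>2 * w x) \<partial>prodM) < ennreal \<epsilon>"
    using simple_pair_add[OF v(1) u(1)] by blast
qed

lemma approximable_scale:
  assumes [measurable]: "h \<in> borel_measurable prodM" and h: "approximable w h"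
  shows "approximable w (\<lambda>x. c * h x)"
proof (cases "c = 0")
  case True
  then show ?thesis unfolding approximable_def using simple_pair.zero
    by (auto intro!: exI[of _ "\<lambda>_. 0"])
next
  case False
  show ?thesis unfolding approximable_def
  proof (intro allI impI)
    fix \<epsilon> :: real assume e: "0 < \<epsilon>"
    obtain u I where u: "simple_pair u I" "(\<integral>\<^sup>+x. ennreal ((h x - u x)\<^sup>2 * w x) \<partial>prodM) < ennreal (\<epsilon> / c\<^sup>2)"
      using approximableE[OF h, of "\<epsilon> / c\<^sup>2"] e False by auto
    note [measurable] = simple_pair_measurable_prod[OF u(1)]
    have "(c * h x - c * u x)\<^sup>2 * w x = c\<^sup>2 * ((h x - u x)\<^sup>2 * w x)" for x
      by (simp add: power2_eq_square algebra_simps)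
    then have "ennreal ((c * h x - c * u x)\<^sup>2 * w x) = ennreal (c\<^sup>2) * ennreal ((h x - u x)\<^sup>2 * w x)" for x
      using w_nonneg by (simp only: ennreal_mult zero_le_power2 mult_nonneg_nonneg)
    then have "(\<integral>\<^sup>+x. ennreal ((c * h x - c * u x)\<^sup>2 * w x) \<partial>prodM) =
        ennreal (c\<^sup>2) * (\<integral>\<^sup>+x. ennreal ((h x - u x)\<^sup>2 * w x) \<partial>prodM)"
      by (simp only:) (rule nn_integral_cmult, measurable)
    also have "\<dots> < ennreal (c\<^sup>2) * ennreal (\<epsilon> / c\<^sup>2)"
      using u(2) False by (intro ennreal_mult_strict_left_mono) auto
    also have "\<dots> = ennreal \<epsilon>" using False e by (simp flip: ennreal_mult)
    finally show "\<exists>u I. simple_pair u I \<and> (\<integral>\<^sup>+x. ennreal ((c * h x - u x)\<^sup>2 * w x) \<partial>prodM) < ennreal \<epsilon>"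
      using simple_pair_scale[OF u(1)] by blast
  qed
qed

lemma approximable_limit:
  assumes [measurable]: "h \<in> borel_measurable prodM" "\<And>n. k n \<in> borel_measurable prodM"
    and k: "\<And>n. approximable w (k n)"
    and lim: "(\<lambda>n. \<integral>\<^sup>+x. ennreal ((h x - k n x)\<^sup>2 * w x) \<partial>prodM) \<longlonglongrightarrow> 0"
  shows "approximable w h"
  unfolding approximable_def
proof (intro allI impI)
  fix \<epsilon> :: real assume e: "0 < \<epsilon>"
  have "eventually (\<lambda>n. (\<integral>\<^sup>+x. ennreal ((h x - k n x)\<^sup>2 * w x) \<partial>prodM) < ennreal (\<epsilon> / 4)) sequentially"
    by (rule order_tendstoD(2)[OF lim]) (use e in simp)
  then obtain n where n: "(\<integral>\<^sup>+x. ennreal ((h x - k n x)\<^sup>2 * w x) \<partial>prodM) < ennreal (\<epsilon> / 4)"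
    by (auto simp: eventually_sequentially)
  obtain u I where u: "simple_pair u I" "(\<integral>\<^sup>+x. ennreal ((k n x - u x)\<^sup>2 * w x) \<partial>prodM) < ennreal (\<epsilon> / 4)"
    using approximableE[OF k, of "\<epsilon> / 4" n] e by auto
  note [measurable] = simple_pair_measurable_prod[OF u(1)]
  have "(\<integral>\<^sup>+x. ennreal ((h x - u x)\<^sup>2 * w x) \<partial>prodM) =
      (\<integral>\<^sup>+x. ennreal (((h x - k n x) + (k n x - u x))\<^sup>2 * w x) \<partial>prodM)"
    by simp
  also have "\<dots> \<le> 2 * (\<integral>\<^sup>+x. ennreal ((h x - k n x)\<^sup>2 * w x) \<partial>prodM) + 2 * (\<integral>\<^sup>+x. ennreal ((k n x - u x)\<^sup>2 * w x) \<partial>prodM)"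
    by (rule nn_integral_square_sum_le) (use w_nonneg in auto)
  also have "\<dots> < ennreal \<epsilon>" using n u(2) e by (rule double_eps)
  finally show "\<exists>u I. simple_pair u I \<and> (\<integral>\<^sup>+x. ennreal ((h x - u x)\<^sup>2 * w x) \<partial>prodM) < ennreal \<epsilon>"
    using u(1) by blast
qed

lemma approximable_AE_eq:
  assumes u: "simple_pair u I" and eq: "AE x in prodM. h x = u x"
  shows "approximable w h"
  unfolding approximable_def
proof (intro allI impI)
  fix \<epsilon> :: real assume "0 < \<epsilon>"
  have "(\<integral>\<^sup>+x. ennreal ((h x - u x)\<^sup>2 * w x) \<partial>prodM) = (\<integral>\<^sup>+x. 0 \<partial>prodM)"
    by (rule nn_integral_cong_AE) (use eq in auto)
  then show "\<exists>u I. simple_pair u I \<and> (\<integral>\<^sup>+x. ennreal ((h x - u x)\<^sup>2 * w x) \<partial>prodM) < ennreal \<epsilon>"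
    using u \<open>0 < \<epsilon>\<close> by auto
qed

lemma approximable_dominated:
  assumes [measurable]: "h \<in> borel_measurable prodM" "\<And>n. k n \<in> borel_measurable prodM"
    and k: "\<And>n. approximable w (k n)"
    and lim: "\<And>x. x \<in> space prodM \<Longrightarrow> (\<lambda>n. k n x) \<longlonglongrightarrow> h x"
    and bd: "\<And>n x. x \<in> space prodM \<Longrightarrow> \<bar>h x - k n x\<bar> \<le> b x"
    and [measurable]: "b \<in> borel_measurable prodM" and b: "(\<integral>\<^sup>+x. ennreal ((b x)\<^sup>2 * w x) \<partial>prodM) < \<infinity>"
  shows "approximable w h"
proof (rule approximable_limit[OF _ _ k])
  have "(\<lambda>n. \<integral>\<^sup>+x. ennreal ((h x - k n x)\<^sup>2 * w x) \<partial>prodM) \<longlonglongrightarrow> (\<integral>\<^sup>+x. 0 \<partial>prodM)"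
  proof (rule nn_integral_dominated_convergence[where w="\<lambda>x. ennreal ((b x)\<^sup>2 * w x)"])
    show "AE x in prodM. ennreal ((h x - k n x)\<^sup>2 * w x) \<le> ennreal ((b x)\<^sup>2 * w x)" for n
      using AE_space
    proof eventually_elim
      case (elim x)
      have "(h x - k n x)\<^sup>2 \<le> (b x)\<^sup>2" using bd[OF elim, of n] by (simp add: abs_le_square_iff[symmetric])
      then show ?case using w_nonneg by (intro ennreal_leI mult_right_mono)
    qed
    show "AE x in prodM. (\<lambda>n. ennreal ((h x - k n x)\<^sup>2 * w x)) \<longlonglongrightarrow> 0"
      using AE_space
    proof eventually_elim
      case (elim x)
      have "(\<lambda>n. ennreal ((h x - k n x)\<^sup>2 * w x)) \<longlonglongrightarrow> ennreal ((h x - h x)\<^sup>2 * w x)"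
        by (intro tendsto_intros lim[OF elim])
      then show ?case by simp
    qed
  qed (use b in auto)
  then show "(\<lambda>n. \<integral>\<^sup>+x. ennreal ((h x - k n x)\<^sup>2 * w x) \<partial>prodM) \<longlonglongrightarrow> 0" by simp
qed measurable

lemma w_finite: "(\<integral>\<^sup>+x. ennreal (c\<^sup>2 * w x) \<partial>prodM) < \<infinity>"
proof -
  have "integrable prodM (\<lambda>x. c\<^sup>2 * w x)" using w by simp
  then show ?thesis using w_nonneg by (subst nn_integral_eq_integral) auto
qed

text \<open>
  Rectangles are elementary integrands up to a null set, and the approximable sets form a Dynkin
  system.
\<close>

lemma approximable_indicator:
  assumes "P \<in> sets predM"
  shows "approximable w (indicator P)"
proof -
  have one: "approximable w (\<lambda>_. 1)"
  proof (rule approximable_AE_eq)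
    show "simple_pair (\<lambda>x. 1 * indicator {0<..T} (fst x)) (\<lambda>\<omega>. 1 * incr 0 T \<omega>)"
      by (rule simple_pair_elementary) (use T_pos in \<open>auto simp: elementary_def\<close>)
    show "AE x in prodM. (1 :: real) = 1 * indicator {0<..T} (fst x)"
      using AE_fst_pos by eventually_elim simp
  qed
  have sub: "sigma_sets ({0..T} \<times> space M) predictable_rectangles \<subseteq> sets prodM"
    using sets_pred sets_pred_prod by auto
  from Int_stable_predictable_rectangles predictable_rectangles_Pow assms[unfolded sets_pred]
  show ?thesis
  proof (induction rule: sigma_sets_induct_disjoint)
    case (basic A)
    from basic show ?case unfolding predictable_rectangles_def
    proof (elim UnE CollectE exE conjE)
      fix B assume A: "A = {0} \<times> B"
      show ?thesis
        by (rule approximable_AE_eq[OF simple_pair.zero])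
          (use AE_fst_pos in eventually_elim, auto simp: A indicator_def)
    next
      fix s t B assume A: "A = {s<..t} \<times> B" "0 \<le> s" "s \<le> t" "t \<le> T" "B \<in> sets (filt M T N s)"
      show ?thesis
        by (rule approximable_AE_eq[OF simple_pair_elementary[OF elementary_indicator[OF A(2-)]]])
          (auto simp: A(1) indicator_def)
    qed
  next
    case empty
    show ?case by (rule approximable_AE_eq[OF simple_pair.zero]) simp
  next
    case (compl A)
    have A [measurable]: "A \<in> sets prodM" using compl(1) sub by auto
    have "approximable w (\<lambda>x. 1 + (- 1) * indicator A x)"
      by (intro approximable_add approximable_scale one compl) auto
    then obtain "approximable w (\<lambda>x. 1 - indicator A x)" by simp
    then show ?case
    proof (rule approximable_limit[rotated 2, of "\<lambda>_ x. 1 - indicator A x"])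
      have "(\<integral>\<^sup>+x. ennreal ((indicator ({0..T} \<times> space M - A) x - (1 - indicator A x))\<^sup>2 * w x) \<partial>prodM) = (\<integral>\<^sup>+x. 0 \<partial>prodM)"
        by (rule nn_integral_cong) (auto simp: indicator_def space_prod)
      then show "(\<lambda>n. \<integral>\<^sup>+x. ennreal ((indicator ({0..T} \<times> space M - A) x - (1 - indicator A x))\<^sup>2 * w x) \<partial>prodM) \<longlonglongrightarrow> 0"
        by simp
      show "indicator ({0..T} \<times> space M - A) \<in> borel_measurable prodM"
        using sets.compl_sets[OF A] space_prod by simp
    qed measurable
  next
    case (union A)
    have A [measurable]: "A i \<in> sets prodM" for i using union(2) sub by auto
    have part: "approximable w (\<lambda>x. \<Sum>i<n. indicator (A i) x)" for n
    proof (induction n)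
      case 0
      show ?case by (rule approximable_AE_eq[OF simple_pair.zero]) simp
    next
      case (Suc n)
      then show ?case using union(3)[of n] by (simp add: approximable_add)
    qed
    have sum_eq: "(\<Sum>i<n. indicator (A i) x) = (indicator (\<Union>i<n. A i) x :: real)" for n x
      using union(1) by (subst indicator_UN_disjoint) (auto simp: disjoint_family_on_def)
    show ?case
    proof (rule approximable_dominated[where b="\<lambda>_. 1", OF _ _ part])
      fix x :: "real \<times> 'a"
      show "(\<lambda>n. \<Sum>i<n. indicator (A i) x) \<longlonglongrightarrow> (indicator (\<Union>i. A i) x :: real)"
        unfolding sum_eq by (rule LIMSEQ_indicator_UN)
      show "\<bar>indicator (\<Union>i. A i) x - (\<Sum>i<n. indicator (A i) x)\<bar> \<le> (1 :: real)" for n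
        unfolding sum_eq by (simp add: indicator_def)
      show "(\<integral>\<^sup>+x. ennreal (1\<^sup>2 * w x) \<partial>prodM) < \<infinity>" by (rule w_finite)
    qed measurable
  qed
qed

lemma approximable_nonneg:
  assumes "h \<in> borel_measurable predM" "\<And>x. 0 \<le> h x" "(\<integral>\<^sup>+x. ennreal ((h x)\<^sup>2 * w x) \<partial>prodM) < \<infinity>"
  shows "approximable w h"
  using assms
proof (induction rule: borel_measurable_induct_real)
  case (set A)
  then show ?case by (intro approximable_indicator)
next
  case (mult u c)
  have [measurable]: "u \<in> borel_measurable prodM" by (rule measurable_from_subalg[OF subalgebra_pred mult.hyps(2)])
  show ?case
  proof (cases "c = 0")
    case True
    show ?thesis by (rule approximable_AE_eq[OF simple_pair.zero]) (simp add: True)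
  next
    case False
    have "ennreal ((c * u x)\<^sup>2 * w x) = ennreal (c\<^sup>2) * ennreal ((u x)\<^sup>2 * w x)" for x
      using w_nonneg by (simp only: power_mult_distrib mult.assoc ennreal_mult zero_le_power2 mult_nonneg_nonneg)
    then have "(\<integral>\<^sup>+x. ennreal ((c * u x)\<^sup>2 * w x) \<partial>prodM) = ennreal (c\<^sup>2) * (\<integral>\<^sup>+x. ennreal ((u x)\<^sup>2 * w x) \<partial>prodM)"
      by (simp only:) (rule nn_integral_cmult, measurable)
    then have "(\<integral>\<^sup>+x. ennreal ((u x)\<^sup>2 * w x) \<partial>prodM) < \<infinity>"
      using mult.prems False by (auto simp: ennreal_mult_less_top)
    then show ?thesis using mult by (intro approximable_scale) auto
  qed
next
  case (add u v)
  have [measurable]: "u \<in> borel_measurable prodM" "v \<in> borel_measurable prodM"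
    by (rule measurable_from_subalg[OF subalgebra_pred add.hyps(1)],
      rule measurable_from_subalg[OF subalgebra_pred add.hyps(3)])
  have "(\<integral>\<^sup>+x. ennreal ((u x)\<^sup>2 * w x) \<partial>prodM) \<le> (\<integral>\<^sup>+x. ennreal ((v x + u x)\<^sup>2 * w x) \<partial>prodM)"
    "(\<integral>\<^sup>+x. ennreal ((v x)\<^sup>2 * w x) \<partial>prodM) \<le> (\<integral>\<^sup>+x. ennreal ((v x + u x)\<^sup>2 * w x) \<partial>prodM)"
    using add.hyps(2,4) w_nonneg
    by (auto intro!: nn_integral_mono ennreal_leI mult_right_mono power_mono)
  then show ?case using add by (intro approximable_add) auto
next
  case (seq U)
  have [measurable]: "U i \<in> borel_measurable prodM" for i
    by (rule measurable_from_subalg[OF subalgebra_pred seq.hyps(1)])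
  have hm [measurable]: "h \<in> borel_measurable prodM"
    by (rule measurable_from_subalg[OF subalgebra_pred assms(1)])
  have le: "U i x \<le> h x" if "x \<in> space prodM" for i x
    using seq.hyps(3) seq.hyps(4)[of x] that by (intro incseq_le[of "\<lambda>i. U i x"])
      (auto simp: incseq_def le_fun_def space_pred space_prod)
  have "approximable w (U i)" for i
  proof (rule seq.IH)
    have "(\<integral>\<^sup>+x. ennreal ((U i x)\<^sup>2 * w x) \<partial>prodM) \<le> (\<integral>\<^sup>+x. ennreal ((h x)\<^sup>2 * w x) \<partial>prodM)"
      using le seq.hyps(2) w_nonneg by (intro nn_integral_mono ennreal_leI mult_right_mono power_mono) auto
    then show "(\<integral>\<^sup>+x. ennreal ((U i x)\<^sup>2 * w x) \<partial>prodM) < \<infinity>" using seq.prems by simp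
  qed
  then show ?case
  proof (rule approximable_dominated[where b=h, rotated 2])
    show "(\<lambda>n. U n x) \<longlonglongrightarrow> h x" if "x \<in> space prodM" for x
      using seq.hyps(4) that by (auto simp: space_pred space_prod)
    show "\<bar>h x - U n x\<bar> \<le> h x" if "x \<in> space prodM" for n x
      using le[OF that, of n] seq.hyps(2)[of n x] by auto
  qed (use seq.prems in auto)
qed

theorem predictable_approximable:
  assumes "h \<in> borel_measurable predM" "(\<integral>\<^sup>+x. ennreal ((h x)\<^sup>2 * w x) \<partial>prodM) < \<infinity>"
  shows "approximable w h"
proof -
  have hm [measurable]: "h \<in> borel_measurable prodM"
    by (rule measurable_from_subalg[OF subalgebra_pred assms(1)])
  have "approximable w (\<lambda>x. max (c * h x) 0)" if c: "c = 1 \<or> c = - 1" for c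
  proof (rule approximable_nonneg)
    have "(\<integral>\<^sup>+x. ennreal ((max (c * h x) 0)\<^sup>2 * w x) \<partial>prodM) \<le> (\<integral>\<^sup>+x. ennreal ((h x)\<^sup>2 * w x) \<partial>prodM)"
      using w_nonneg c by (intro nn_integral_mono ennreal_leI mult_right_mono) (auto simp: max_def)
    then show "(\<integral>\<^sup>+x. ennreal ((max (c * h x) 0)\<^sup>2 * w x) \<partial>prodM) < \<infinity>" using assms(2) by simp
  qed (use assms(1) in auto)
  from this[of 1] this[of "- 1"] have "approximable w (\<lambda>x. max (1 * h x) 0 + (- 1) * max (- 1 * h x) 0)"
    by (intro approximable_add approximable_scale) auto
  moreover have "(\<lambda>x. max (1 * h x) 0 + (- 1) * max (- 1 * h x) 0) = h" by (auto simp: max_def)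
  ultimately show ?thesis by simp
qed

end
end

section \<open>Square integrability of the projected gradient\<close>

lemma Cauchy_Schwarz_integral:
  fixes f g :: "'b \<Rightarrow> real"
  assumes [measurable]: "f \<in> borel_measurable K" "g \<in> borel_measurable K"
    and f: "integrable K (\<lambda>x. (f x)\<^sup>2)" and g: "integrable K (\<lambda>x. (g x)\<^sup>2)"
  shows "(\<integral>x. f x * g x \<partial>K)\<^sup>2 \<le> (\<integral>x. (f x)\<^sup>2 \<partial>K) * (\<integral>x. (g x)\<^sup>2 \<partial>K)"
proof -
  have fg: "integrable K (\<lambda>x. \<bar>f x\<bar> * \<bar>g x\<bar>)"
    using integrable_norm[OF integrable_mult_square[OF assms]] by (simp add: abs_mult)
  have "(\<integral>\<^sup>+x. ennreal \<bar>f x\<bar> * ennreal \<bar>g x\<bar> \<partial>K)\<^sup>2 \<le>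
      (\<integral>\<^sup>+x. (ennreal \<bar>f x\<bar>)\<^sup>2 \<partial>K) * (\<integral>\<^sup>+x. (ennreal \<bar>g x\<bar>)\<^sup>2 \<partial>K)"
    by (rule Cauchy_Schwarz_nn_integral) measurable
  also have "(\<integral>\<^sup>+x. ennreal \<bar>f x\<bar> * ennreal \<bar>g x\<bar> \<partial>K) = ennreal (\<integral>x. \<bar>f x\<bar> * \<bar>g x\<bar> \<partial>K)"
    using nn_integral_eq_integral[OF fg] by (simp add: ennreal_mult)
  also have "(\<integral>\<^sup>+x. (ennreal \<bar>f x\<bar>)\<^sup>2 \<partial>K) = ennreal (\<integral>x. (f x)\<^sup>2 \<partial>K)"
    using nn_integral_eq_integral[OF f] by (simp add: ennreal_power)
  also have "(\<integral>\<^sup>+x. (ennreal \<bar>g x\<bar>)\<^sup>2 \<partial>K) = ennreal (\<integral>x. (g x)\<^sup>2 \<partial>K)"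
    using nn_integral_eq_integral[OF g] by (simp add: ennreal_power)
  finally have "ennreal ((\<integral>x. \<bar>f x\<bar> * \<bar>g x\<bar> \<partial>K)\<^sup>2) \<le> ennreal ((\<integral>x. (f x)\<^sup>2 \<partial>K) * (\<integral>x. (g x)\<^sup>2 \<partial>K))"
    by (simp add: ennreal_power ennreal_mult)
  then have "(\<integral>x. \<bar>f x\<bar> * \<bar>g x\<bar> \<partial>K)\<^sup>2 \<le> (\<integral>x. (f x)\<^sup>2 \<partial>K) * (\<integral>x. (g x)\<^sup>2 \<partial>K)"
    by (subst (asm) ennreal_le_iff) auto
  moreover have "\<bar>\<integral>x. f x * g x \<partial>K\<bar> \<le> (\<integral>x. \<bar>f x\<bar> * \<bar>g x\<bar> \<partial>K)"
    using integral_abs_bound[of K "\<lambda>x. f x * g x"] by (simp add: abs_mult)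
  then have "\<bar>\<integral>x. f x * g x \<partial>K\<bar>\<^sup>2 \<le> (\<integral>x. \<bar>f x\<bar> * \<bar>g x\<bar> \<partial>K)\<^sup>2"
    by (rule power_mono) simp
  ultimately show ?thesis by simp
qed

lemma integral_mult_L2_limit:
  fixes F Z :: "'b \<Rightarrow> real" and Y :: "nat \<Rightarrow> 'b \<Rightarrow> real"
  assumes [measurable]: "F \<in> borel_measurable K" "Z \<in> borel_measurable K" "\<And>k. Y k \<in> borel_measurable K"
    and F: "integrable K (\<lambda>x. (F x)\<^sup>2)" and Z: "integrable K (\<lambda>x. (Z x)\<^sup>2)"
    and Y: "\<And>k. integrable K (\<lambda>x. (Y k x)\<^sup>2)"
    and lim: "(\<lambda>k. \<integral>\<^sup>+x. ennreal ((Z x - Y k x)\<^sup>2) \<partial>K) \<longlonglongrightarrow> 0"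
  shows "(\<lambda>k. \<integral>x. F x * Y k x \<partial>K) \<longlonglongrightarrow> (\<integral>x. F x * Z x \<partial>K)"
proof -
  have D: "integrable K (\<lambda>x. (Z x - Y k x)\<^sup>2)" for k
    using Z Y[of k] integrable_mult_square[of Z K "Y k"] by (simp add: power2_diff mult.assoc)
  have FD: "integrable K (\<lambda>x. F x * (Z x - Y k x))" for k
    by (rule integrable_mult_square[OF assms(1) _ F D]) (intro borel_measurable_diff assms)
  have FZ: "integrable K (\<lambda>x. F x * Z x)" and FY: "integrable K (\<lambda>x. F x * Y k x)" for k
    using integrable_mult_square[OF assms(1,2) F Z] integrable_mult_square[OF assms(1,3) F Y] by auto
  have "(\<lambda>k. \<integral>x. (Z x - Y k x)\<^sup>2 \<partial>K) \<longlonglongrightarrow> 0"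
    using lim D by (subst (asm) nn_integral_eq_integral) (auto simp: ennreal_tendsto_0_iff)
  then have "(\<lambda>k. (\<integral>x. (F x)\<^sup>2 \<partial>K) * (\<integral>x. (Z x - Y k x)\<^sup>2 \<partial>K)) \<longlonglongrightarrow> (\<integral>x. (F x)\<^sup>2 \<partial>K) * 0"
    by (rule tendsto_mult_left)
  then have bound: "(\<lambda>k. (\<integral>x. (F x)\<^sup>2 \<partial>K) * (\<integral>x. (Z x - Y k x)\<^sup>2 \<partial>K)) \<longlonglongrightarrow> 0" by simp
  have "(\<lambda>k. (\<integral>x. F x * (Z x - Y k x) \<partial>K)\<^sup>2) \<longlonglongrightarrow> 0"
  proof (rule Lim_null_comparison[OF _ bound])
    show "eventually (\<lambda>k. norm ((\<integral>x. F x * (Z x - Y k x) \<partial>K)\<^sup>2) \<le> (\<integral>x. (F x)\<^sup>2 \<partial>K) * (\<integral>x. (Z x - Y k x)\<^sup>2 \<partial>K)) sequentially"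
    proof (rule always_eventually, rule allI)
      fix k show "norm ((\<integral>x. F x * (Z x - Y k x) \<partial>K)\<^sup>2) \<le> (\<integral>x. (F x)\<^sup>2 \<partial>K) * (\<integral>x. (Z x - Y k x)\<^sup>2 \<partial>K)"
        using Cauchy_Schwarz_integral[OF assms(1) borel_measurable_diff[OF assms(2) assms(3)[of k]] F D[of k]] by simp
    qed
  qed
  from tendsto_real_sqrt[OF this] have "(\<lambda>k. \<bar>\<integral>x. F x * (Z x - Y k x) \<partial>K\<bar>) \<longlonglongrightarrow> 0" by simp
  then have "(\<lambda>k. \<integral>x. F x * (Z x - Y k x) \<partial>K) \<longlonglongrightarrow> 0" by (rule tendsto_rabs_zero_cancel)
  then have "(\<lambda>k. (\<integral>x. F x * Z x \<partial>K) - (\<integral>x. F x * (Z x - Y k x) \<partial>K)) \<longlonglongrightarrow> (\<integral>x. F x * Z x \<partial>K) - 0"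
    by (intro tendsto_intros)
  moreover have "(\<integral>x. F x * Z x \<partial>K) - (\<integral>x. F x * (Z x - Y k x) \<partial>K) = (\<integral>x. F x * Y k x \<partial>K)" for k
    using FZ FY by (simp add: right_diff_distrib)
  ultimately show ?thesis by simp
qed

context config_functional
begin

definition proj :: "real \<times> 'a \<Rightarrow> real" where
  "proj = real_cond_exp prodM predM (grad f)"

lemma proj_pred [measurable]: "proj \<in> borel_measurable predM"
  unfolding proj_def by simp

lemma proj_meas [measurable]: "proj \<in> borel_measurable prodM"
  by (rule measurable_from_subalg[OF subalgebra_pred proj_pred])

lemma integrable_proj: "integrable prodM proj"
  unfolding proj_def by (rule pred.real_cond_exp_int(1)[OF integrable_grad])

lemma proj_duality:
  assumes u: "simple_pair u I"
  shows "(\<integral>\<omega>. F \<omega> * I \<omega> \<partial>M) = lam * (\<integral>x. u x * proj x \<partial>prodM)"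
  using simple_pair_duality[OF u] pred.real_cond_exp_intg(2)[OF simple_pair_integrable_mult[OF u integrable_grad]
      simple_pair_measurable[OF u]] unfolding proj_def by simp

text \<open>
  The gradient itself need not be square integrable, but its projection is: testing the
  duality with simple integrands close to a truncation of the projection and using the isometry
  bounds the norm of the truncation by that of \<open>F\<close>.
\<close>

lemma proj_truncated_bound:
  fixes n :: nat
  defines "h \<equiv> \<lambda>x. proj x * indicator {y. \<bar>y\<bar> \<le> real n} (proj x)"
  shows "lam * (\<integral>x. (h x)\<^sup>2 \<partial>prodM) \<le> (\<integral>\<omega>. (F \<omega>)\<^sup>2 \<partial>M)"
proof (rule field_le_epsilon)
  fix e :: real assume e: "0 < e"
  have h_pred: "h \<in> borel_measurable predM" unfolding h_def by measurable
  have h [measurable]: "h \<in> borel_measurable prodM"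
    by (rule measurable_from_subalg[OF subalgebra_pred h_pred])
  have h_bd: "\<bar>h x\<bar> \<le> real n" for x unfolding h_def by (auto simp: indicator_def)
  define w where "w x = 1 + \<bar>proj x\<bar>" for x
  have w: "integrable prodM w" "\<And>x. 0 \<le> w x" unfolding w_def using integrable_proj by auto
  have wm [measurable]: "w \<in> borel_measurable prodM" using w(1) by auto
  define H where "H = (\<integral>x. (h x)\<^sup>2 \<partial>prodM)"
  define G where "G = (\<integral>x. \<bar>proj x\<bar> \<partial>prodM)"
  define K where "K = lam * (H + 4 + 2 * G)"
  have HG: "0 \<le> H" "0 \<le> G" unfolding H_def G_def by simp_all
  have K: "0 \<le> K" unfolding K_def using lam_pos HG by simp
  \<comment> \<open>accuracy of the approximation; the errors below add up to \<open>\<delta> * K\<close>\<close>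
  define \<delta> where "\<delta> = min 1 (e / (K + 1))"
  have \<delta>: "0 < \<delta>" "\<delta> \<le> 1" using e K unfolding \<delta>_def by auto
  have \<delta>K: "\<delta> * K \<le> e"
  proof -
    have "\<delta> * K \<le> (e / (K + 1)) * (K + 1)" using K e \<delta> by (intro mult_mono) (auto simp: \<delta>_def)
    then show ?thesis using K by simp
  qed
  have h_sq: "integrable prodM (\<lambda>x. (h x)\<^sup>2)"
  proof (rule prod.integrable_const_bound[where B="(real n)\<^sup>2"])
    show "AE x in prodM. norm ((h x)\<^sup>2) \<le> (real n)\<^sup>2"
    proof (rule AE_I2)
      fix x show "norm ((h x)\<^sup>2) \<le> (real n)\<^sup>2" using power_mono[OF h_bd[of x], of 2] by simp
    qed
  qed measurable
  have "approximable w h"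
  proof (rule predictable_approximable[OF w h_pred])
    have "integrable prodM (\<lambda>x. (h x)\<^sup>2 * w x)"
    proof (rule prod.integrable_bounded_mult[OF _ _ w(1)])
      show "\<bar>(h x)\<^sup>2\<bar> \<le> (real n)\<^sup>2" for x using h_bd[of x] power_mono[of "\<bar>h x\<bar>" "real n" 2] by simp
    qed measurable
    then show "(\<integral>\<^sup>+x. ennreal ((h x)\<^sup>2 * w x) \<partial>prodM) < \<infinity>"
      using w(2) by (subst nn_integral_eq_integral) auto
  qed
  then obtain u I where u: "simple_pair u I" "(\<integral>\<^sup>+x. ennreal ((h x - u x)\<^sup>2 * w x) \<partial>prodM) < ennreal (\<delta>\<^sup>2)"
    using approximableE[of w h "\<delta>\<^sup>2"] \<delta> by auto
  note um [measurable] = simple_pair_measurable_prod[OF u(1)]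
  obtain C where C: "\<And>x. x \<in> space prodM \<Longrightarrow> \<bar>u x\<bar> \<le> C" using simple_pair_bounded[OF u(1)] by auto
  define d where "d x = (h x - u x)\<^sup>2" for x
  have dm [measurable]: "d \<in> borel_measurable prodM" unfolding d_def by measurable
  have d0: "0 \<le> d x" for x by (simp add: d_def)
  have dw: "integrable prodM (\<lambda>x. d x * w x)"
  proof (rule prod.integrable_bounded_mult[OF dm _ w(1)])
    fix x assume "x \<in> space prodM"
    then have "\<bar>h x - u x\<bar> \<le> real n + C" using h_bd[of x] C[of x] by linarith
    then show "\<bar>d x\<bar> \<le> (real n + C)\<^sup>2" unfolding d_def using power_mono[of "\<bar>h x - u x\<bar>" "real n + C" 2] by simp
  qed
  have "ennreal (\<integral>x. d x * w x \<partial>prodM) < ennreal (\<delta>\<^sup>2)"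
    using u(2) nn_integral_eq_integral[OF dw] d0 w(2) unfolding d_def by simp
  then have dw_le: "(\<integral>x. d x * w x \<partial>prodM) \<le> \<delta>\<^sup>2"
    using ennreal_less_iff[of "\<integral>x. d x * w x \<partial>prodM" "\<delta>\<^sup>2"] d0 w(2) by (simp add: less_imp_le)
  have d_int: "integrable prodM d" and dg_int: "integrable prodM (\<lambda>x. \<bar>proj x\<bar> * d x)"
    by (rule Bochner_Integration.integrable_bound[OF dw]; use d0 in \<open>auto simp: w_def distrib_left mult.commute\<close>)+
  have d_le: "(\<integral>x. d x \<partial>prodM) \<le> \<delta>\<^sup>2" and dg_le: "(\<integral>x. \<bar>proj x\<bar> * d x \<partial>prodM) \<le> \<delta>\<^sup>2"
  proof -
    have "(\<integral>x. d x \<partial>prodM) \<le> (\<integral>x. d x * w x \<partial>prodM)" "(\<integral>x. \<bar>proj x\<bar> * d x \<partial>prodM) \<le> (\<integral>x. d x * w x \<partial>prodM)"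
      using d_int dg_int dw d0 by (auto intro!: integral_mono simp: w_def distrib_left mult.commute)
    then show "(\<integral>x. d x \<partial>prodM) \<le> \<delta>\<^sup>2" "(\<integral>x. \<bar>proj x\<bar> * d x \<partial>prodM) \<le> \<delta>\<^sup>2" using dw_le by auto
  qed
  have young: "\<bar>y\<bar> \<le> \<delta> + y\<^sup>2 / \<delta>" for y :: real
  proof -
    have "2 * \<delta> * \<bar>y\<bar> \<le> \<delta>\<^sup>2 + y\<^sup>2" using sum_squares_bound[of \<delta> "\<bar>y\<bar>"] by simp
    moreover have "0 \<le> \<delta> * \<bar>y\<bar>" using \<delta> by simp
    ultimately have "\<bar>y\<bar> * \<delta> \<le> \<delta>\<^sup>2 + y\<^sup>2" by (simp only: mult.commute[of "\<bar>y\<bar>"] mult.assoc)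
    then have "\<bar>y\<bar> \<le> (\<delta>\<^sup>2 + y\<^sup>2) / \<delta>" using \<delta> by (simp add: pos_le_divide_eq)
    then show ?thesis using \<delta> by (simp add: power2_eq_square add_divide_distrib)
  qed
  have gh: "proj x * h x = (h x)\<^sup>2" for x unfolding h_def by (auto simp: indicator_def power2_eq_square)
  have uu: "integrable prodM (\<lambda>x. u x * u x)" by (rule simple_pair_integrable_mult[OF u(1) simple_pair_integrable[OF u(1)]])
  have ug: "integrable prodM (\<lambda>x. u x * proj x)" by (rule simple_pair_integrable_mult[OF u(1) integrable_proj])
  \<comment> \<open>the pairing with \<open>proj\<close> changes little; this uses the part \<open>\<bar>proj x\<bar>\<close> of the weight\<close>
  have H1: "H \<le> (\<integral>x. u x * proj x \<partial>prodM) + (\<delta> * G + \<delta>)"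
  proof -
    have "H \<le> (\<integral>x. u x * proj x + (\<delta> * \<bar>proj x\<bar> + \<bar>proj x\<bar> * d x / \<delta>) \<partial>prodM)"
      unfolding H_def
    proof (rule integral_mono[OF h_sq])
      show "integrable prodM (\<lambda>x. u x * proj x + (\<delta> * \<bar>proj x\<bar> + \<bar>proj x\<bar> * d x / \<delta>))"
        using ug integrable_proj dg_int by auto
      fix x
      have "\<bar>proj x\<bar> * \<bar>h x - u x\<bar> \<le> \<bar>proj x\<bar> * (\<delta> + d x / \<delta>)"
        using young[of "h x - u x"] unfolding d_def by (intro mult_left_mono) auto
      moreover have "proj x * (h x - u x) \<le> \<bar>proj x\<bar> * \<bar>h x - u x\<bar>"
        by (metis abs_ge_self abs_mult)
      ultimately show "(h x)\<^sup>2 \<le> u x * proj x + (\<delta> * \<bar>proj x\<bar> + \<bar>proj x\<bar> * d x / \<delta>)"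
        using gh[of x] by (simp add: algebra_simps)
    qed
    also have "\<dots> = (\<integral>x. u x * proj x \<partial>prodM) + (\<delta> * G + (\<integral>x. \<bar>proj x\<bar> * d x \<partial>prodM) / \<delta>)"
      unfolding G_def using ug integrable_proj dg_int by simp
    also have "\<dots> \<le> (\<integral>x. u x * proj x \<partial>prodM) + (\<delta> * G + \<delta>\<^sup>2 / \<delta>)"
      using dg_le \<delta> by (intro add_left_mono divide_right_mono) auto
    finally show ?thesis using \<delta> by (simp add: power2_eq_square)
  qed
  \<comment> \<open>the norm changes little; this uses the part \<open>1\<close> of the weight\<close>
  have H2: "(\<integral>x. u x * u x \<partial>prodM) \<le> (1 + \<delta>) * H + 2 * \<delta>"
  proof -
    have "(\<integral>x. u x * u x \<partial>prodM) \<le> (\<integral>x. (1 + \<delta>) * (h x)\<^sup>2 + (1 + 1 / \<delta>) * d x \<partial>prodM)"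
    proof (rule integral_mono[OF uu])
      show "integrable prodM (\<lambda>x. (1 + \<delta>) * (h x)\<^sup>2 + (1 + 1 / \<delta>) * d x)" using h_sq d_int by auto
      fix x
      let ?r = "h x - u x"
      have "0 \<le> (\<delta> * h x + ?r)\<^sup>2 / \<delta>" using \<delta> by simp
      also have "(\<delta> * h x + ?r)\<^sup>2 / \<delta> = \<delta> * (h x)\<^sup>2 + 2 * h x * ?r + ?r\<^sup>2 / \<delta>"
        using \<delta> by (simp add: power2_eq_square field_simps)
      finally have "0 \<le> \<delta> * (h x)\<^sup>2 + 2 * h x * ?r + ?r\<^sup>2 / \<delta>" .
      moreover have "u x * u x = (h x)\<^sup>2 - 2 * h x * ?r + ?r\<^sup>2" by (simp add: power2_eq_square algebra_simps)
      moreover have "(1 + \<delta>) * (h x)\<^sup>2 + (1 + 1 / \<delta>) * d x = (h x)\<^sup>2 + \<delta> * (h x)\<^sup>2 + ?r\<^sup>2 + ?r\<^sup>2 / \<delta>"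
        unfolding d_def by (simp add: algebra_simps)
      ultimately show "u x * u x \<le> (1 + \<delta>) * (h x)\<^sup>2 + (1 + 1 / \<delta>) * d x" by linarith
    qed
    also have "\<dots> = (1 + \<delta>) * H + (1 + 1 / \<delta>) * (\<integral>x. d x \<partial>prodM)"
      unfolding H_def using h_sq d_int by simp
    also have "\<dots> \<le> (1 + \<delta>) * H + (1 + 1 / \<delta>) * \<delta>\<^sup>2"
      using d_le \<delta> by (intro add_left_mono mult_left_mono) auto
    also have "(1 + 1 / \<delta>) * \<delta>\<^sup>2 = \<delta>\<^sup>2 + \<delta>" using \<delta> by (simp add: field_simps power2_eq_square)
    also have "\<delta>\<^sup>2 \<le> \<delta>" using \<delta> by (simp add: power2_eq_square mult_left_le)
    finally show ?thesis by simp
  qed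
  have I_sq: "integrable M (\<lambda>\<omega>. (I \<omega>)\<^sup>2)" and [measurable]: "I \<in> borel_measurable M"
    using simple_pair_L2[OF u(1)] by (auto simp: L2_def)
  have "lam * (\<integral>x. u x * proj x \<partial>prodM) = (\<integral>\<omega>. F \<omega> * I \<omega> \<partial>M)" using proj_duality[OF u(1)] by simp
  also have "\<dots> \<le> (\<integral>\<omega>. (F \<omega>)\<^sup>2 / 2 + (I \<omega>)\<^sup>2 / 2 \<partial>M)"
  proof (rule integral_mono)
    show "integrable M (\<lambda>\<omega>. F \<omega> * I \<omega>)" by (rule integrable_L2_mult[OF F_L2 simple_pair_L2[OF u(1)]])
    show "F \<omega> * I \<omega> \<le> (F \<omega>)\<^sup>2 / 2 + (I \<omega>)\<^sup>2 / 2" for \<omega> using sum_squares_bound[of "F \<omega>" "I \<omega>"] by simp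
  qed (use F_sq I_sq in auto)
  also have "\<dots> = (\<integral>\<omega>. (F \<omega>)\<^sup>2 \<partial>M) / 2 + (\<integral>\<omega>. (I \<omega>)\<^sup>2 \<partial>M) / 2" using F_sq I_sq by simp
  also have "(\<integral>\<omega>. (I \<omega>)\<^sup>2 \<partial>M) = lam * (\<integral>x. u x * u x \<partial>prodM)"
    using simple_pair_isometry[OF u(1) u(1)] by (simp add: power2_eq_square)
  finally have "2 * (lam * (\<integral>x. u x * proj x \<partial>prodM)) \<le> (\<integral>\<omega>. (F \<omega>)\<^sup>2 \<partial>M) + lam * (\<integral>x. u x * u x \<partial>prodM)" by simp
  also have "lam * (\<integral>x. u x * u x \<partial>prodM) \<le> lam * ((1 + \<delta>) * H + 2 * \<delta>)"
    using H2 lam_pos by (intro mult_left_mono) auto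
  finally have "2 * (lam * (\<integral>x. u x * proj x \<partial>prodM)) \<le> (\<integral>\<omega>. (F \<omega>)\<^sup>2 \<partial>M) + lam * ((1 + \<delta>) * H + 2 * \<delta>)" by simp
  moreover have "lam * H \<le> lam * ((\<integral>x. u x * proj x \<partial>prodM) + (\<delta> * G + \<delta>))"
    using H1 lam_pos by (intro mult_left_mono) auto
  moreover have "\<delta> * K = lam * (\<delta> * H) + 4 * (lam * \<delta>) + 2 * (lam * (\<delta> * G))"
    unfolding K_def by (simp add: algebra_simps)
  ultimately have "lam * H \<le> (\<integral>\<omega>. (F \<omega>)\<^sup>2 \<partial>M) + \<delta> * K" by (simp add: algebra_simps)
  then show "lam * (\<integral>x. (h x)\<^sup>2 \<partial>prodM) \<le> (\<integral>\<omega>. (F \<omega>)\<^sup>2 \<partial>M) + e" using \<delta>K unfolding H_def by linarith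
qed

theorem proj_square_integrable: "integrable prodM (\<lambda>x. (proj x)\<^sup>2)"
proof -
  define h where "h n x = proj x * indicator {y. \<bar>y\<bar> \<le> real n} (proj x)" for n x
  have hm [measurable]: "h n \<in> borel_measurable prodM" for n unfolding h_def by measurable
  have h_sq: "integrable prodM (\<lambda>x. (h n x)\<^sup>2)" for n
  proof (rule prod.integrable_const_bound[where B="(real n)\<^sup>2"])
    have bd: "\<bar>h n x\<bar> \<le> real n" for x unfolding h_def by (auto simp: indicator_def)
    show "AE x in prodM. norm ((h n x)\<^sup>2) \<le> (real n)\<^sup>2"
    proof (rule AE_I2)
      fix x show "norm ((h n x)\<^sup>2) \<le> (real n)\<^sup>2" using power_mono[OF bd[of x], of 2] by simp
    qed
  qed measurable
  have "(\<lambda>n. \<integral>\<^sup>+x. ennreal ((h n x)\<^sup>2) \<partial>prodM) \<longlonglongrightarrow> (\<integral>\<^sup>+x. ennreal ((proj x)\<^sup>2) \<partial>prodM)"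
  proof (rule nn_integral_LIMSEQ)
    show "incseq (\<lambda>n x. ennreal ((h n x)\<^sup>2))"
    proof (intro incseq_SucI le_funI ennreal_leI)
      fix n x show "(h n x)\<^sup>2 \<le> (h (Suc n) x)\<^sup>2"
        unfolding h_def by (cases "\<bar>proj x\<bar> \<le> real n") (auto simp: indicator_def)
    qed
    fix x
    obtain m :: nat where m: "\<bar>proj x\<bar> \<le> real m" using real_arch_simple by blast
    have "eventually (\<lambda>n. ennreal ((h n x)\<^sup>2) = ennreal ((proj x)\<^sup>2)) sequentially"
      using eventually_ge_at_top[of m]
      by eventually_elim (use m in \<open>auto simp: h_def indicator_def\<close>)
    then show "(\<lambda>n. ennreal ((h n x)\<^sup>2)) \<longlonglongrightarrow> ennreal ((proj x)\<^sup>2)" by (rule tendsto_eventually)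
  qed measurable
  moreover have "(\<integral>\<^sup>+x. ennreal ((h n x)\<^sup>2) \<partial>prodM) \<le> ennreal ((\<integral>\<omega>. (F \<omega>)\<^sup>2 \<partial>M) / lam)" for n
  proof -
    have "(\<integral>x. (h n x)\<^sup>2 \<partial>prodM) \<le> (\<integral>\<omega>. (F \<omega>)\<^sup>2 \<partial>M) / lam"
      using proj_truncated_bound[of n] lam_pos unfolding h_def by (simp add: field_simps)
    then show ?thesis by (subst nn_integral_eq_integral[OF h_sq]) (auto intro: ennreal_leI)
  qed
  ultimately have "(\<integral>\<^sup>+x. ennreal ((proj x)\<^sup>2) \<partial>prodM) \<le> ennreal ((\<integral>\<omega>. (F \<omega>)\<^sup>2 \<partial>M) / lam)"
    by (intro LIMSEQ_le_const2) auto
  then show ?thesis by (intro integrableI_bounded) (auto simp: le_less_trans)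
qed

end

context poisson_setting
begin

section \<open>The operator-covariant derivative\<close>

lemma predictable_iff: "predictable M T N u \<longleftrightarrow> (\<lambda>x. u (fst x) (snd x)) \<in> borel_measurable predM"
  by (simp add: predictable_def case_prod_unfold)

lemma energy_norm_sq_prod:
  assumes "(\<lambda>x. u (fst x) (snd x)) \<in> borel_measurable prodM"
  shows "energy_norm_sq M lam T u = ennreal lam * (\<integral>\<^sup>+x. ennreal ((u (fst x) (snd x))\<^sup>2) \<partial>prodM)"
proof -
  have "(\<lambda>x. ennreal ((u (fst x) (snd x))\<^sup>2)) \<in> borel_measurable prodM" using assms by measurable
  from tm.nn_integral_snd[OF this] show ?thesis unfolding energy_norm_sq_def by simp
qed

lemma energy_inner_prod:
  assumes "integrable prodM (\<lambda>x. g (fst x) (snd x) * u (fst x) (snd x))"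
  shows "energy_inner M lam T g u = lam * (\<integral>x. g (fst x) (snd x) * u (fst x) (snd x) \<partial>prodM)"
  unfolding energy_inner_def
  using tm.integral_snd[of "\<lambda>t \<omega>. g t \<omega> * u t \<omega>"] assms by (simp add: case_prod_unfold)

lemma energy_space_iff:
  "u \<in> energy_space M lam T N \<longleftrightarrow> (\<lambda>x. u (fst x) (snd x)) \<in> borel_measurable predM \<and>
    integrable prodM (\<lambda>x. (u (fst x) (snd x))\<^sup>2)"
proof (cases "(\<lambda>x. u (fst x) (snd x)) \<in> borel_measurable predM")
  case True
  then have m [measurable]: "(\<lambda>x. u (fst x) (snd x)) \<in> borel_measurable prodM"
    by (rule measurable_from_subalg[OF subalgebra_pred])
  have "integrable prodM (\<lambda>x. (u (fst x) (snd x))\<^sup>2) \<longleftrightarrow> (\<integral>\<^sup>+x. ennreal ((u (fst x) (snd x))\<^sup>2) \<partial>prodM) < \<infinity>"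
    unfolding integrable_iff_bounded using borel_measurable_power[OF m, of 2] by (simp add: m)
  also have "\<dots> \<longleftrightarrow> energy_norm_sq M lam T u < \<infinity>"
  proof -
    have "ennreal lam \<noteq> 0" "ennreal lam < \<infinity>" using lam_pos by simp_all
    then show ?thesis unfolding energy_norm_sq_prod[OF m] infinity_ennreal_def ennreal_mult_less_top
      by fastforce
  qed
  finally show ?thesis using True by (auto simp: energy_space_def predictable_iff)
qed (auto simp: energy_space_def predictable_iff)

lemma simple_data_pair:
  "simple_data M T N n ts \<xi> \<Longrightarrow>
    simple_pair (\<lambda>x. simple_process n ts \<xi> (fst x) (snd x)) (simple_integral lam N n ts \<xi>)"
proof (induction n)
  case 0
  show ?case using simple_pair.zero by (simp add: simple_process_def simple_integral_def[abs_def])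
next
  case (Suc n)
  have *: "0 \<le> ts 0" "\<And>i. i < Suc n \<Longrightarrow> ts i \<le> ts (Suc i)" "ts (Suc n) \<le> T"
    and \<xi>: "\<xi> n \<in> borel_measurable (filt M T N (ts n))" "\<exists>C. \<forall>\<omega>\<in>space M. \<bar>\<xi> n \<omega>\<bar> \<le> C"
    using Suc.prems by (auto simp: simple_data_def)
  have "simple_data M T N n ts \<xi>"
    using Suc.prems *(2)[of n] *(3) unfolding simple_data_def by auto
  note IH = Suc.IH[OF this]
  have "ts 0 \<le> ts i" if "i \<le> n" for i
    using that
  proof (induction i)
    case (Suc i)
    then show ?case using *(2)[of i] by simp
  qed simp
  then have "elementary (ts n) (ts (Suc n)) (\<xi> n)"
    unfolding elementary_def using *(1) *(2)[of n] *(3) \<xi> order_trans[of 0 "ts 0" "ts n"] by auto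
  from simple_pair.step[OF IH this] show ?case
    by (simp add: simple_process_def simple_integral_def)
qed

lemma elementary_stoch_integral:
  assumes e: "elementary a b \<xi>"
  shows "is_stoch_integral M lam T N (\<lambda>t \<omega>. \<xi> \<omega> * indicator {a<..b} t) (\<lambda>\<omega>. \<xi> \<omega> * incr a b \<omega>)"
  unfolding is_stoch_integral_def
proof (intro conjI exI allI)
  let ?ts = "\<lambda>i::nat. if i = 0 then a else b"
  show "(\<lambda>\<omega>. \<xi> \<omega> * incr a b \<omega>) \<in> L2 M" by (rule elementary_L2[OF e])
  show "simple_data M T N 1 ?ts (\<lambda>_. \<xi>)" for k :: nat
    using e by (auto simp: simple_data_def elementary_def)
  show "(\<lambda>k::nat. energy_norm_sq M lam T (\<lambda>t \<omega>. \<xi> \<omega> * indicator {a<..b} t - simple_process 1 ?ts (\<lambda>_. \<xi>) t \<omega>)) \<longlonglongrightarrow> 0"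
    by (simp add: simple_process_def energy_norm_sq_def)
  show "(\<lambda>k::nat. \<integral>\<^sup>+\<omega>. ennreal ((\<xi> \<omega> * incr a b \<omega> - simple_integral lam N 1 ?ts (\<lambda>_. \<xi>) \<omega>)\<^sup>2) \<partial>M) \<longlonglongrightarrow> 0"
    by (simp add: simple_integral_def)
qed

lemma simple_pair_square_integrable: "simple_pair u I \<Longrightarrow> integrable prodM (\<lambda>x. (u x)\<^sup>2)"
  using simple_pair_integrable_mult[OF _ simple_pair_integrable] by (simp add: power2_eq_square)

end

context config_functional
begin

text \<open>
  For simple integrands the defining identity is \<open>proj_duality\<close>. Both sides are continuous along the
  approximating sequence of a stochastic integral, because \<open>F\<close>, the integrals and \<open>proj\<close> are square
  integrable.
\<close>

theorem op_cov_deriv_proj: "is_op_cov_deriv M lam T N F (\<lambda>t \<omega>. proj (t, \<omega>))"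
  unfolding is_op_cov_deriv_def
proof (intro conjI ballI allI impI)
  show "(\<lambda>t \<omega>. proj (t, \<omega>)) \<in> energy_space M lam T N"
    unfolding energy_space_iff using proj_pred proj_square_integrable by simp
  fix u I assume u: "u \<in> energy_space M lam T N" and I: "is_stoch_integral M lam T N u I"
  let ?u = "\<lambda>x. u (fst x) (snd x)"
  have up: "?u \<in> borel_measurable predM" and usq: "integrable prodM (\<lambda>x. (?u x)\<^sup>2)"
    using u by (auto simp: energy_space_iff)
  have um: "?u \<in> borel_measurable prodM" by (rule measurable_from_subalg[OF subalgebra_pred up])
  have IL2: "I \<in> L2 M" using I by (simp add: is_stoch_integral_def)
  from I obtain n ts \<xi> where sd: "\<And>k. simple_data M T N (n k) (ts k) (\<xi> k)"
    and lim_u: "(\<lambda>k. energy_norm_sq M lam T (\<lambda>t \<omega>. u t \<omega> - simple_process (n k) (ts k) (\<xi> k) t \<omega>)) \<longlonglongrightarrow> 0"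
    and lim_I: "(\<lambda>k. \<integral>\<^sup>+\<omega>. ennreal ((I \<omega> - simple_integral lam N (n k) (ts k) (\<xi> k) \<omega>)\<^sup>2) \<partial>M) \<longlonglongrightarrow> 0"
    unfolding is_stoch_integral_def by blast
  define v where "v k x = simple_process (n k) (ts k) (\<xi> k) (fst x) (snd x)" for k and x :: "real \<times> 'a"
  define J where "J k = simple_integral lam N (n k) (ts k) (\<xi> k)" for k
  have vJ: "simple_pair (v k) (J k)" for k
    using simple_data_pair[OF sd[of k]] unfolding v_def J_def .
  have JL2: "J k \<in> L2 M" for k by (rule simple_pair_L2[OF vJ])
  have vm: "v k \<in> borel_measurable prodM" for k by (rule simple_pair_measurable_prod[OF vJ])
  have "(\<lambda>k. \<integral>\<omega>. F \<omega> * J k \<omega> \<partial>M) \<longlonglongrightarrow> (\<integral>\<omega>. F \<omega> * I \<omega> \<partial>M)"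
    using IL2 JL2 lim_I F_sq by (intro integral_mult_L2_limit) (auto simp: L2_def J_def)
  moreover have "(\<lambda>k. \<integral>x. proj x * v k x \<partial>prodM) \<longlonglongrightarrow> (\<integral>x. proj x * ?u x \<partial>prodM)"
  proof (rule integral_mult_L2_limit[OF proj_meas um vm proj_square_integrable usq simple_pair_square_integrable[OF vJ]])
    have e: "energy_norm_sq M lam T (\<lambda>t \<omega>. u t \<omega> - simple_process (n k) (ts k) (\<xi> k) t \<omega>) =
        ennreal lam * (\<integral>\<^sup>+x. ennreal ((?u x - v k x)\<^sup>2) \<partial>prodM)" for k
      using um vm[of k] unfolding v_def by (intro energy_norm_sq_prod) auto
    have "(\<lambda>k. ennreal (1 / lam) * (ennreal lam * (\<integral>\<^sup>+x. ennreal ((?u x - v k x)\<^sup>2) \<partial>prodM))) \<longlonglongrightarrow> ennreal (1 / lam) * 0"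
      using lim_u unfolding e by (intro ennreal_tendsto_cmult) auto
    moreover have "ennreal (1 / lam) * (ennreal lam * y) = y" for y
    proof -
      have "ennreal (1 / lam) * ennreal lam = 1" using lam_pos by (simp flip: ennreal_mult)
      then show ?thesis by (simp flip: mult.assoc)
    qed
    ultimately show "(\<lambda>k. \<integral>\<^sup>+x. ennreal ((?u x - v k x)\<^sup>2) \<partial>prodM) \<longlonglongrightarrow> 0" by simp
  qed
  then have "(\<lambda>k. lam * (\<integral>x. proj x * v k x \<partial>prodM)) \<longlonglongrightarrow> lam * (\<integral>x. proj x * ?u x \<partial>prodM)"
    by (rule tendsto_mult_left)
  moreover have "lam * (\<integral>x. proj x * v k x \<partial>prodM) = (\<integral>\<omega>. F \<omega> * J k \<omega> \<partial>M)" for k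
    using proj_duality[OF vJ[of k]] by (simp add: mult.commute)
  ultimately have "(\<integral>\<omega>. F \<omega> * I \<omega> \<partial>M) = lam * (\<integral>x. proj x * ?u x \<partial>prodM)"
    using LIMSEQ_unique by simp
  also have "\<dots> = energy_inner M lam T (\<lambda>t \<omega>. proj (t, \<omega>)) u"
    using integrable_mult_square[OF proj_meas um proj_square_integrable usq]
    by (subst energy_inner_prod) simp_all
  finally show "(\<integral>\<omega>. F \<omega> * I \<omega> \<partial>M) = energy_inner M lam T (\<lambda>t \<omega>. proj (t, \<omega>)) u" .
qed

context
  fixes g :: "real \<Rightarrow> 'a \<Rightarrow> real"
  assumes g: "is_op_cov_deriv M lam T N F g"
begin

abbreviation "gp \<equiv> \<lambda>x. g (fst x) (snd x)"

lemma g_pred: "gp \<in> borel_measurable predM" and g_sq: "integrable prodM (\<lambda>x. (gp x)\<^sup>2)"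
  using g by (auto simp: is_op_cov_deriv_def energy_space_iff)

lemma g_meas [measurable]: "gp \<in> borel_measurable prodM"
  by (rule measurable_from_subalg[OF subalgebra_pred g_pred])

lemma integrable_g: "integrable prodM gp"
  using integrable_mult_square[of gp prodM "\<lambda>_. 1"] g_sq by simp

text \<open>
  Testing the defining identity of \<open>g\<close> with the elementary integrand \<open>1\<^sub>A 1\<^bsub>(a,b]\<^esub>\<close> and comparing with
  integration by parts.
\<close>

lemma grad_minus_g_zero:
  assumes "P \<in> sets predM"
  shows "(LINT x:P|prodM. grad f x - gp x) = 0"
proof (rule predictable_integral_zero[OF _ _ assms])
  show "integrable prodM (\<lambda>x. grad f x - gp x)" using integrable_grad integrable_g by auto
  fix a b A assume a: "0 \<le> a" "a \<le> b" "b \<le> T" "A \<in> sets (filt M T N a)"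
  have e: "elementary a b (indicator A)" by (rule elementary_indicator[OF a])
  let ?u = "\<lambda>x. indicator A (snd x) * indicator {a<..b} (fst x) :: real"
  have sp: "simple_pair ?u (\<lambda>\<omega>. indicator A \<omega> * incr a b \<omega>)" by (rule simple_pair_elementary[OF e])
  have "(\<lambda>t \<omega>. indicator A \<omega> * indicator {a<..b} t :: real) \<in> energy_space M lam T N"
    unfolding energy_space_iff using simple_pair_measurable[OF sp] simple_pair_square_integrable[OF sp] by simp
  then have "(\<integral>\<omega>. F \<omega> * (indicator A \<omega> * incr a b \<omega>) \<partial>M) = energy_inner M lam T g (\<lambda>t \<omega>. indicator A \<omega> * indicator {a<..b} t)"
    using g elementary_stoch_integral[OF e] unfolding is_op_cov_deriv_def by blast
  also have "\<dots> = lam * (\<integral>x. gp x * ?u x \<partial>prodM)"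
    using simple_pair_integrable_mult[OF sp integrable_g] by (subst energy_inner_prod) (simp_all add: mult.commute)
  finally have "lam * (\<integral>x. ?u x * grad f x \<partial>prodM) = lam * (\<integral>x. ?u x * gp x \<partial>prodM)"
    using simple_pair_duality[OF sp] by (simp add: mult.commute)
  then have "(\<integral>x. ?u x * grad f x \<partial>prodM) = (\<integral>x. ?u x * gp x \<partial>prodM)" using lam_pos by simp
  then have "(\<integral>x. ?u x * grad f x - ?u x * gp x \<partial>prodM) = 0"
    using simple_pair_integrable_mult[OF sp integrable_g] simple_pair_integrable_mult[OF sp integrable_grad] by simp
  then show "(\<integral>x. indicator {a<..b} (fst x) * indicator A (snd x) * (grad f x - gp x) \<partial>prodM) = 0"
    by (simp add: algebra_simps)
qed

theorem op_cov_deriv_eq_projection: "AE x in prodM. gp x = real_cond_exp prodM predM (grad f) x"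
proof -
  have "AE x in prodM. real_cond_exp prodM predM (grad f) x = gp x"
  proof (rule pred.real_cond_exp_charact[OF _ integrable_grad integrable_g g_pred])
    fix P assume P: "P \<in> sets predM"
    have i: "set_integrable prodM P h" if "integrable prodM h" for h :: "real \<times> 'a \<Rightarrow> real"
      unfolding set_integrable_def using that P sets_pred_prod by (intro integrable_mult_indicator) auto
    show "(LINT x:P|prodM. grad f x) = (LINT x:P|prodM. gp x)"
      using grad_minus_g_zero[OF P] set_integral_diff(2)[OF i[OF integrable_grad] i[OF integrable_g]] by simp
  qed
  then show ?thesis by eventually_elim simp
qed

theorem predictable_projection_op_cov_deriv: "is_predictable_projection M T N (discrete_gradient T N f) g"
  unfolding is_predictable_projection_def
proof (intro conjI)
  show "integrable prodM (\<lambda>(t, \<omega>). discrete_gradient T N f t \<omega>)"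
    using integrable_grad by (simp add: case_prod_unfold)
  show "predictable M T N g" using g_pred by (simp add: predictable_iff)
  show "AE (t, \<omega>) in prodM. g t \<omega> = real_cond_exp prodM predM (\<lambda>(s, \<omega>'). discrete_gradient T N f s \<omega>') (t, \<omega>)"
    using op_cov_deriv_eq_projection by (simp add: case_prod_unfold)
qed

end
end

context poisson_setting
begin

section \<open>Random variables as functionals of the configuration\<close>

text \<open>
  The path values are almost surely the counts of the configuration, and null events correspond
  to the empty set of configurations.
\<close>

lemma NA_event_config:
  assumes "A \<in> sets (null_augmented M N T)"
  shows "\<exists>C\<in>sets (config_space T). AE \<omega> in M. \<omega> \<in> A \<longleftrightarrow> conf \<omega> \<in> C"
  using assms unfolding sets_NA
proof (induction rule: sigma_sets.induct)
  case (Basic A)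
  then show ?case
  proof
    assume "A \<in> {N s -` B \<inter> space M | s B. s \<in> {0..T}}"
    then obtain s B where A: "A = N s -` B \<inter> space M" and s: "s \<in> {0..T}" by auto
    let ?C = "(\<lambda>\<eta>. card (\<eta> \<inter> {0..s})) -` B \<inter> space (config_space T)"
    have "?C \<in> sets (config_space T)" using measurable_count by (rule measurable_sets) simp
    moreover have "AE \<omega> in M. \<omega> \<in> A \<longleftrightarrow> conf \<omega> \<in> ?C"
      using AE_count AE_space
      by eventually_elim (use s conf_in_configurations in \<open>auto simp: A space_config_space\<close>)
    ultimately show ?thesis by blast
  next
    assume "A \<in> null_sets M"
    then have "AE \<omega> in M. \<omega> \<in> A \<longleftrightarrow> conf \<omega> \<in> {}" using AE_not_in by auto
    then show ?thesis by blast
  qed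
next
  case Empty
  have "AE \<omega> in M. \<omega> \<in> {} \<longleftrightarrow> conf \<omega> \<in> {}" by simp
  then show ?case by blast
next
  case (Compl A)
  then obtain C where C: "C \<in> sets (config_space T)" "AE \<omega> in M. \<omega> \<in> A \<longleftrightarrow> conf \<omega> \<in> C" by auto
  have "AE \<omega> in M. \<omega> \<in> space M - A \<longleftrightarrow> conf \<omega> \<in> space (config_space T) - C"
    using C(2) AE_space by eventually_elim (use conf_in_configurations in \<open>auto simp: space_config_space\<close>)
  then show ?case using sets.compl_sets[OF C(1)] by blast
next
  case (Union A)
  then have "\<forall>i. \<exists>C. C \<in> sets (config_space T) \<and> (AE \<omega> in M. \<omega> \<in> A i \<longleftrightarrow> conf \<omega> \<in> C)" by blast
  from choice[OF this] obtain C where C: "\<And>i. C i \<in> sets (config_space T)"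
    "\<And>i. AE \<omega> in M. \<omega> \<in> A i \<longleftrightarrow> conf \<omega> \<in> C i" by blast
  have "AE \<omega> in M. \<forall>i. \<omega> \<in> A i \<longleftrightarrow> conf \<omega> \<in> C i" using C(2) by (simp add: AE_all_countable)
  then have "AE \<omega> in M. \<omega> \<in> (\<Union>i. A i) \<longleftrightarrow> conf \<omega> \<in> (\<Union>i. C i)" by eventually_elim auto
  moreover have "(\<Union>i. C i) \<in> sets (config_space T)" using C(1) by auto
  ultimately show ?case by blast
qed

text \<open>
  Limits are taken on the side of configurations. There \<open>lim\<close> also assigns a value where the sequence
  diverges, which happens on a null set only.
\<close>

lemma config_functional_nonneg:
  fixes u :: "'a \<Rightarrow> real"
  assumes "u \<in> borel_measurable (filt M T N T)" "\<And>\<omega>. 0 \<le> u \<omega>"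
  shows "\<exists>f\<in>borel_measurable (config_space T). AE \<omega> in M. u \<omega> = f (conf \<omega>)"
  using assms
proof (induction rule: borel_measurable_induct_real)
  case (set A)
  then obtain C where C: "C \<in> sets (config_space T)" "AE \<omega> in M. \<omega> \<in> A \<longleftrightarrow> conf \<omega> \<in> C"
    using NA_event_config sets_filt_T by auto
  then have "indicator C \<in> borel_measurable (config_space T)" "AE \<omega> in M. indicator A \<omega> = (indicator C (conf \<omega>) :: real)"
    by (auto simp: indicator_def)
  then show ?case by blast
next
  case (mult u c)
  then obtain f where f: "f \<in> borel_measurable (config_space T)" "AE \<omega> in M. u \<omega> = f (conf \<omega>)" by blast
  have "AE \<omega> in M. c * u \<omega> = c * f (conf \<omega>)" using f(2) by eventually_elim simp
  moreover have "(\<lambda>\<eta>. c * f \<eta>) \<in> borel_measurable (config_space T)" using f(1) by measurable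
  ultimately show ?case by (intro bexI[of _ "\<lambda>\<eta>. c * f \<eta>"])
next
  case (add u v)
  then obtain f h where f: "f \<in> borel_measurable (config_space T)" "AE \<omega> in M. u \<omega> = f (conf \<omega>)"
    and h: "h \<in> borel_measurable (config_space T)" "AE \<omega> in M. v \<omega> = h (conf \<omega>)" by blast
  have "AE \<omega> in M. v \<omega> + u \<omega> = h (conf \<omega>) + f (conf \<omega>)" using f(2) h(2) by eventually_elim simp
  moreover have "(\<lambda>\<eta>. h \<eta> + f \<eta>) \<in> borel_measurable (config_space T)" using f(1) h(1) by measurable
  ultimately show ?case by (intro bexI[of _ "\<lambda>\<eta>. h \<eta> + f \<eta>"])
next
  case (seq U)
  then have "\<forall>i. \<exists>f. f \<in> borel_measurable (config_space T) \<and> (AE \<omega> in M. U i \<omega> = f (conf \<omega>))" by blast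
  from choice[OF this] obtain f where f: "\<And>i. f i \<in> borel_measurable (config_space T)"
    "\<And>i. AE \<omega> in M. U i \<omega> = f i (conf \<omega>)" by blast
  have "AE \<omega> in M. \<forall>i. U i \<omega> = f i (conf \<omega>)" using f(2) by (simp add: AE_all_countable)
  then have "AE \<omega> in M. u \<omega> = lim (\<lambda>i. f i (conf \<omega>))"
    using AE_space
  proof eventually_elim
    case (elim \<omega>)
    have "(\<lambda>i. U i \<omega>) \<longlonglongrightarrow> u \<omega>" using seq.hyps(4)[of \<omega>] elim(2) by (simp add: space_filt)
    then have "(\<lambda>i. f i (conf \<omega>)) \<longlonglongrightarrow> u \<omega>" using elim(1) by simp
    then show ?case by (rule limI[symmetric])
  qed
  moreover have "(\<lambda>\<eta>. lim (\<lambda>i. f i \<eta>)) \<in> borel_measurable (config_space T)"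
    using f(1) by (rule borel_measurable_lim_metric)
  ultimately show ?case by (intro bexI[of _ "\<lambda>\<eta>. lim (\<lambda>i. f i \<eta>)"])
qed

theorem config_functional_exists:
  assumes "F \<in> borel_measurable (filt M T N T)"
  shows "\<exists>f. is_config_functional M T N F f"
proof -
  have m: "(\<lambda>\<omega>. max (F \<omega>) 0) \<in> borel_measurable (filt M T N T)"
    "(\<lambda>\<omega>. max (- F \<omega>) 0) \<in> borel_measurable (filt M T N T)" using assms by measurable
  obtain f1 where f1: "f1 \<in> borel_measurable (config_space T)" "AE \<omega> in M. max (F \<omega>) 0 = f1 (conf \<omega>)"
    using config_functional_nonneg[OF m(1)] by (meson max.cobounded2)
  obtain f2 where f2: "f2 \<in> borel_measurable (config_space T)" "AE \<omega> in M. max (- F \<omega>) 0 = f2 (conf \<omega>)"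
    using config_functional_nonneg[OF m(2)] by (meson max.cobounded2)
  have "AE \<omega> in M. F \<omega> = f1 (conf \<omega>) - f2 (conf \<omega>)"
    using f1(2) f2(2) by eventually_elim (auto simp: max_def split: if_splits)
  then have "is_config_functional M T N F (\<lambda>\<eta>. f1 \<eta> - f2 \<eta>)"
    unfolding is_config_functional_def by (intro conjI borel_measurable_diff f1(1) f2(1))
  then show ?thesis by blast
qed

section \<open>Conditional expectations at fixed times\<close>

lemma filt_left_Pow: "(\<Union>s\<in>{0..<t}. sets (filt M T N s)) \<subseteq> Pow (space M)"
  using filt_subset sets.sets_into_space by blast

lemma space_filt_left: "space (filt_left M T N t) = space M"
  unfolding filt_left_def using filt_left_Pow by (rule space_measure_of)

lemma sets_filt_left: "sets (filt_left M T N t) = sigma_sets (space M) (\<Union>s\<in>{0..<t}. sets (filt M T N s))"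
  unfolding filt_left_def using filt_left_Pow by (rule sets_measure_of)

lemma subalgebra_filt_left: "subalgebra M (filt_left M T N t)"
  unfolding subalgebra_def space_filt_left sets_filt_left
  by (intro conjI refl sets.sigma_sets_subset UN_least filt_subset)

text \<open>
  A predictable process at time \<open>t\<close> is determined strictly before \<open>t\<close>: a rectangle over \<open>(s, r]\<close> meets
  the time \<open>t\<close> only if \<open>s < t\<close>. At time zero this fails for the rectangles over \<open>{0}\<close>.
\<close>

lemma measurable_section:
  assumes t: "0 < t" "t \<le> T"
  shows "(\<lambda>\<omega>. (t, \<omega>)) \<in> measurable (filt_left M T N t) predM"
proof (rule measurable_sigma_sets[OF sets_pred predictable_rectangles_Pow])
  show "(\<lambda>\<omega>. (t, \<omega>)) \<in> space (filt_left M T N t) \<rightarrow> {0..T} \<times> space M"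
    using t by (auto simp: space_filt_left)
  fix R assume "R \<in> predictable_rectangles"
  then show "(\<lambda>\<omega>. (t, \<omega>)) -` R \<inter> space (filt_left M T N t) \<in> sets (filt_left M T N t)"
    unfolding predictable_rectangles_def
  proof (elim UnE CollectE exE conjE)
    fix A assume "R = {0} \<times> A"
    then have "(\<lambda>\<omega>. (t, \<omega>)) -` R \<inter> space (filt_left M T N t) = {}" using t by auto
    then show ?thesis by simp
  next
    fix s r A assume R: "R = {s<..r} \<times> A" "0 \<le> s" "A \<in> sets (filt M T N s)"
    have A: "A \<subseteq> space M" using sets.sets_into_space[OF R(3)] by (simp add: space_filt)
    show ?thesis
    proof (cases "s < t \<and> t \<le> r")
      case True
      then have "(\<lambda>\<omega>. (t, \<omega>)) -` R \<inter> space (filt_left M T N t) = A" using R A by (auto simp: space_filt_left)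
      also have "\<dots> \<in> sets (filt_left M T N t)" unfolding sets_filt_left using R True by (intro sigma_sets.Basic) auto
      finally show ?thesis .
    next
      case False
      then have "(\<lambda>\<omega>. (t, \<omega>)) -` R \<inter> space (filt_left M T N t) = {}" using R by auto
      then show ?thesis by simp
    qed
  qed
qed

text \<open>
  By right-continuity of the paths, counts at rational times before \<open>t\<close> determine all counts
  before \<open>t\<close>. Up to null sets the left limit of the filtration therefore has countably many
  generators.
\<close>

lemma filt_left_rational_cylinders:
  assumes t: "0 < t" "t \<le> T"
  shows "sets (filt_left M T N t) \<subseteq> sigma_sets (space M) (cylinders_and_null ({0..<t} \<inter> \<rat>))"
proof -
  let ?G = "cylinders_and_null ({0..<t} \<inter> \<rat>)"
  define K where "K = sigma (space M) ?G"
  have "?G \<subseteq> Pow (space M)"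
    using cylinders_and_null_subset[of "{0..<t} \<inter> \<rat>"] t sets.sets_into_space[of _ M] by force
  then have K: "space K = space M" "sets K = sigma_sets (space M) ?G"
    unfolding K_def by (auto simp: space_measure_of sets_measure_of)
  have rat: "{\<omega> \<in> space M. N q \<omega> = k} \<in> sets K" if "q \<in> {0..<t} \<inter> \<rat>" for q k
  proof -
    have "path_cylinder [(q, k)] \<in> ?G" unfolding cylinders_and_null_def using that by auto
    moreover have "path_cylinder [(q, k)] = {\<omega> \<in> space M. N q \<omega> = k}" by (auto simp: path_cylinder_def)
    ultimately show ?thesis unfolding K(2) by (intro sigma_sets.Basic) simp
  qed
  have all: "{\<omega> \<in> space M. N r \<omega> = k} \<in> sets K" if r: "0 \<le> r" "r < t" for r k
  proof -
    have "\<exists>q\<in>\<rat>. r < q \<and> q < r + (t - r) / real (Suc n)" for n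
      using r by (intro Rats_dense_in_real) simp
    then obtain q where q: "\<And>n. q n \<in> \<rat>" "\<And>n. r < q n" "\<And>n. q n < r + (t - r) / real (Suc n)" by metis
    have qt: "q n \<in> {0..<t} \<inter> \<rat>" for n
    proof -
      have "(t - r) / real (Suc n) \<le> (t - r) / 1" using r by (intro divide_left_mono) auto
      then have "q n < t" using q(3)[of n] by simp
      then show ?thesis using q(1,2)[of n] r by simp
    qed
    have "(\<lambda>n. r + (t - r) / real (Suc n)) \<longlonglongrightarrow> r + 0"
      by (intro tendsto_intros LIMSEQ_Suc lim_const_over_n)
    then have "q \<longlonglongrightarrow> r"
      using q(2,3) by (intro tendsto_sandwich[of "\<lambda>_. r" q sequentially "\<lambda>n. r + (t - r) / real (Suc n)"])
        (auto intro!: always_eventually less_imp_le)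
    then have q_right: "filterlim q (at_right r) sequentially"
      unfolding filterlim_at using q(2) by (auto simp: less_imp_neq[THEN not_sym])
    have ev: "eventually (\<lambda>n. N (q n) \<omega> = N r \<omega>) sequentially" if "\<omega> \<in> space M" for \<omega>
      using N_right_cont[OF that, of r] r t
      by (intro nat_tendsto_eventually_eq filterlim_compose[OF _ q_right]) auto
    have "{\<omega> \<in> space M. N r \<omega> = k} = {\<omega> \<in> space K. \<exists>m. \<forall>n. m \<le> n \<longrightarrow> N (q n) \<omega> = k}"
    proof (intro set_eqI iffI)
      fix \<omega> assume "\<omega> \<in> {\<omega> \<in> space M. N r \<omega> = k}"
      then show "\<omega> \<in> {\<omega> \<in> space K. \<exists>m. \<forall>n. m \<le> n \<longrightarrow> N (q n) \<omega> = k}"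
        using ev[of \<omega>] by (simp add: K(1) eventually_sequentially)
    next
      fix \<omega> assume \<omega>: "\<omega> \<in> {\<omega> \<in> space K. \<exists>m. \<forall>n. m \<le> n \<longrightarrow> N (q n) \<omega> = k}"
      then have "eventually (\<lambda>n. N (q n) \<omega> = k) sequentially" by (auto simp: eventually_sequentially)
      moreover have "eventually (\<lambda>n. N (q n) \<omega> = N r \<omega>) sequentially" using \<omega> K(1) by (intro ev) auto
      ultimately have "eventually (\<lambda>n::nat. N r \<omega> = k) sequentially" by eventually_elim simp
      then show "\<omega> \<in> {\<omega> \<in> space M. N r \<omega> = k}" using \<omega> K(1) by simp
    qed
    also have "\<dots> \<in> sets K"
    proof (intro sets.sets_Collect_countable_Ex sets.sets_Collect_countable_All sets.sets_Collect_imp)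
      show "{\<omega> \<in> space K. N (q n) \<omega> = k} \<in> sets K" for n using rat[OF qt] K(1) by simp
    qed auto
    finally show ?thesis .
  qed
  \<comment> \<open>real times are reached by rational times from the right, still before \<open>t\<close>\<close>
  have NA: "sets (null_augmented M N s) \<subseteq> sets K" if "s < t" for s
    unfolding sets_NA K(1)[symmetric]
  proof (rule sets.sigma_sets_subset, safe)
    fix r and B :: "nat set" assume r: "r \<in> {0..s}"
    have "N r -` B \<inter> space K = (\<Union>k\<in>B. {\<omega> \<in> space M. N r \<omega> = k})" using K(1) by auto
    also have "\<dots> \<in> sets K"
    proof (rule sets.countable_UN'')
      show "{\<omega> \<in> space M. N r \<omega> = k} \<in> sets K" for k using all[of r k] r that by simp
    qed simp
    finally show "N r -` B \<inter> space K \<in> sets K" .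
  next
    fix A assume "A \<in> null_sets M"
    then show "A \<in> sets K" unfolding K(2) by (intro sigma_sets.Basic) (simp add: cylinders_and_null_def)
  qed
  have "sets (filt M T N s) \<subseteq> sets K" if "s < t" for s
    using filt_subset_NA[of s "(s + t) / 2"] NA[of "(s + t) / 2"] that t by auto
  then have "(\<Union>s\<in>{0..<t}. sets (filt M T N s)) \<subseteq> sets K" by (intro UN_least) auto
  from sets.sigma_sets_subset[OF this] show ?thesis
    unfolding sets_filt_left by (simp only: K)
qed

lemma fst_measurable_pred: "fst \<in> borel_measurable predM"
  unfolding borel_measurable_iff_le
proof
  fix c :: real
  have sp: "space M \<in> sets (filt M T N s)" for s using sets.top[of "filt M T N s"] by (simp add: space_filt)
  have z: "{0} \<times> space M \<in> sets predM"
    unfolding sets_pred predictable_rectangles_def using sp by (intro sigma_sets.Basic) auto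
  have i: "{0<..b} \<times> space M \<in> sets predM" if "0 \<le> b" "b \<le> T" for b
    unfolding sets_pred predictable_rectangles_def using sp that by (intro sigma_sets.Basic UnI2) blast
  show "{x \<in> space predM. fst x \<le> c} \<in> sets predM"
  proof (cases "0 \<le> c")
    case True
    have "{x \<in> space predM. fst x \<le> c} = {0} \<times> space M \<union> {0<..min c T} \<times> space M"
      using True T_pos by (auto simp: space_pred)
    then show ?thesis using z i[of "min c T"] True T_pos by auto
  next
    case False
    then have e: "{x \<in> space predM. fst x \<le> c} = {}" by (auto simp: space_pred)
    show ?thesis unfolding e by simp
  qed
qed

lemma predictable_rectangle:
  assumes B: "B \<in> sets (time_measure T)" and q: "0 \<le> q" "q \<le> T" "A \<in> sets (filt M T N q)"
  shows "(B \<inter> {q<..T}) \<times> A \<in> sets predM"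
proof -
  have "B \<in> sets borel" using B unfolding time_measure_def by (subst (asm) sets_restrict_space_iff) auto
  then have "fst -` B \<inter> space predM \<in> sets predM" using fst_measurable_pred by (rule measurable_sets[rotated])
  moreover have "{q<..T} \<times> A \<in> sets predM"
    unfolding sets_pred predictable_rectangles_def using q by (intro sigma_sets.Basic UnI2) blast
  ultimately have "(fst -` B \<inter> space predM) \<inter> ({q<..T} \<times> A) \<in> sets predM" by auto
  moreover have "(fst -` B \<inter> space predM) \<inter> ({q<..T} \<times> A) = (B \<inter> {q<..T}) \<times> A"
    using q sets.sets_into_space[OF q(3)] by (auto simp: space_pred space_filt)
  ultimately show ?thesis by simp
qed

end

context config_functional
begin

context
  fixes g :: "real \<Rightarrow> 'a \<Rightarrow> real"
  assumes g: "is_op_cov_deriv M lam T N F g"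
begin

text \<open>
  Let \<open>q\<close> be the last time occurring in the cylinder \<open>A\<close>. For every Borel set \<open>B\<close> of times after \<open>q\<close> the
  product \<open>B \<times> A\<close> is predictable, so gradient and \<open>g\<close> have the same integral over it. Hence
  their integrals over \<open>A\<close> agree at almost every time after \<open>q\<close>.
\<close>

lemma AE_cylinder_zero:
  fixes L :: "(rat \<times> nat) list"
  defines "A \<equiv> path_cylinder (map (\<lambda>p. (of_rat (fst p), snd p)) L)"
  shows "AE t in time_measure T. (\<forall>p\<in>set L. of_rat (fst p) \<in> {0..<t}) \<longrightarrow>
    (LINT \<omega>:A|M. discrete_gradient T N f t \<omega> - g t \<omega>) = 0"
proof (cases "\<forall>p\<in>set L. of_rat (fst p) \<in> {0..<T}")
  case False
  then obtain p where p: "p \<in> set L" "of_rat (fst p) \<notin> {0..<T}" by blast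
  have "\<not> (\<forall>p\<in>set L. of_rat (fst p) \<in> {0..<t})" if "t \<in> {0..T}" for t
  proof -
    have "of_rat (fst p) \<notin> {0..<t}" using p(2) that by auto
    then show ?thesis using p(1) by blast
  qed
  then have "t \<in> {0..T} \<Longrightarrow> (\<forall>p\<in>set L. of_rat (fst p) \<in> {0..<t}) \<longrightarrow>
      (LINT \<omega>:A|M. discrete_gradient T N f t \<omega> - g t \<omega>) = 0" for t by blast
  then show ?thesis by (intro AE_I2) (simp only: space_time_measure)
next
  case True
  define q where "q = Max (insert 0 ((\<lambda>p. of_rat (fst p)) ` set L) :: real set)"
  have q: "0 \<le> q" "q \<le> T" using True T_pos unfolding q_def by (auto intro: less_imp_le)
  have le: "of_rat (fst p) \<le> q" if "p \<in> set L" for p using that unfolding q_def by (intro Max_ge) auto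
  have lt: "q < t" if "0 < t" "\<forall>p\<in>set L. of_rat (fst p) \<in> {0..<t}" for t
    using that unfolding q_def by (subst Max_less_iff) auto
  have "A \<in> sets (null_augmented M N q)"
    unfolding A_def by (rule sets_path_cylinder) (use True le in auto)
  then have A: "A \<in> sets (filt M T N q)" using NA_subset_filt[OF q(2)] by auto
  have AM: "A \<in> sets M" using A filt_subset by auto
  define Z where "Z x = grad f x - g (fst x) (snd x)" for x
  have Z: "integrable prodM Z" unfolding Z_def using integrable_grad integrable_g[OF g] by auto
  have S: "{q<..T} \<in> sets (time_measure T)" using sets_time[of q T] q by simp
  define \<phi> where "\<phi> t = (\<integral>\<omega>. indicator {q<..T} t * indicator A \<omega> * Z (t, \<omega>) \<partial>M)" for t
  have int: "integrable prodM (\<lambda>x. indicator B (fst x) * indicator A (snd x) * Z x)" if "B \<in> sets (time_measure T)" for B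
    using that AM by (intro prod.integrable_bounded_mult[OF _ _ Z, of _ 1]) (auto simp: indicator_def)
  have \<phi>_int: "integrable (time_measure T) \<phi>"
    unfolding \<phi>_def using tm.integrable_fst'[OF int[OF S]] by simp
  have "AE t in time_measure T. \<phi> t = 0"
  proof (rule density_unique_real[OF \<phi>_int])
    fix B assume B: "B \<in> sets (time_measure T)"
    have BS: "B \<inter> {q<..T} \<in> sets (time_measure T)" using B S by auto
    have "(LINT t:B|time_measure T. \<phi> t) = (\<integral>t. (\<integral>\<omega>. indicator (B \<inter> {q<..T}) t * indicator A \<omega> * Z (t, \<omega>) \<partial>M) \<partial>time_measure T)"
      unfolding set_lebesgue_integral_def \<phi>_def
      by (intro Bochner_Integration.integral_cong refl) (auto simp: indicator_def)
    also have "\<dots> = (\<integral>x. indicator (B \<inter> {q<..T}) (fst x) * indicator A (snd x) * Z x \<partial>prodM)"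
      using tm.integral_fst'[OF int[OF BS]] by simp
    also have "\<dots> = (LINT x:(B \<inter> {q<..T}) \<times> A|prodM. Z x)"
      unfolding set_lebesgue_integral_def
      by (intro Bochner_Integration.integral_cong refl) (auto simp: indicator_def)
    also have "\<dots> = 0"
      using grad_minus_g_zero[OF g predictable_rectangle[OF B q A]] unfolding Z_def .
    finally show "(LINT t:B|time_measure T. \<phi> t) = (LINT t:B|time_measure T. 0)"
      by (simp add: set_lebesgue_integral_def)
  qed simp
  moreover have "AE t in time_measure T. t \<notin> {0}" by (rule AE_time_not_in_finite) simp
  ultimately show ?thesis using AE_space[of "time_measure T"]
  proof eventually_elim
    case (elim t)
    show ?case
    proof
      assume "\<forall>p\<in>set L. of_rat (fst p) \<in> {0..<t}"
      then have "q < t" "t \<le> T" using lt[of t] elim(2,3) by (auto simp: space_time_measure)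
      then have "\<phi> t = (LINT \<omega>:A|M. discrete_gradient T N f t \<omega> - g t \<omega>)"
        unfolding \<phi>_def set_lebesgue_integral_def Z_def
        by (intro Bochner_Integration.integral_cong refl) (auto simp: indicator_def)
      then show "(LINT \<omega>:A|M. discrete_gradient T N f t \<omega> - g t \<omega>) = 0" using elim(1) by simp
    qed
  qed
qed

text \<open>
  Rational cylinders are countable in number, so almost every \<open>t\<close> is good for all of them at once; for
  such \<open>t\<close> the cylinders before \<open>t\<close> and the null sets generate the left limit of the filtration.
\<close>

theorem cond_exp_process_op_cov_deriv: "is_cond_exp_process M T N (discrete_gradient T N f) g"
  unfolding is_cond_exp_process_def
proof
  show "(\<lambda>(t, \<omega>). g t \<omega>) \<in> borel_measurable prodM"
    using g_meas[OF g] by (simp add: case_prod_unfold)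
  have cyl: "AE t in time_measure T. \<forall>L :: (rat \<times> nat) list. (\<forall>p\<in>set L. of_rat (fst p) \<in> {0..<t}) \<longrightarrow>
      (LINT \<omega>:path_cylinder (map (\<lambda>p. (of_rat (fst p), snd p)) L)|M. discrete_gradient T N f t \<omega> - g t \<omega>) = 0"
    using AE_cylinder_zero by (simp add: AE_all_countable)
  have X: "AE t in time_measure T. integrable M (discrete_gradient T N f t)"
    using tm.AE_integrable_fst'[OF integrable_grad] by simp
  have G: "AE t in time_measure T. integrable M (g t)"
    using tm.AE_integrable_fst'[OF integrable_g[OF g]] by simp
  have pos: "AE t in time_measure T. t \<notin> {0}" by (rule AE_time_not_in_finite) simp
  show "AE t in time_measure T. integrable M (discrete_gradient T N f t) \<and>
      (AE \<omega> in M. g t \<omega> = real_cond_exp M (filt_left M T N t) (discrete_gradient T N f t) \<omega>)"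
    using cyl X G pos AE_space[of "time_measure T"]
  proof eventually_elim
    case (elim t)
    have t: "0 < t" "t \<le> T" using elim(4,5) by (auto simp: space_time_measure)
    let ?Z = "\<lambda>\<omega>. discrete_gradient T N f t \<omega> - g t \<omega>"
    let ?D = "{0..<t} \<inter> \<rat>"
    have D: "?D \<subseteq> {0..T}" using t by auto
    have Z: "integrable M ?Z" using elim(2,3) by auto
    have c: "(LINT \<omega>:path_cylinder L|M. ?Z \<omega>) = 0" if L: "fst ` set L \<subseteq> ?D" for L
    proof -
      have "\<exists>L' :: (rat \<times> nat) list. L = map (\<lambda>p. (of_rat (fst p), snd p)) L'"
        unfolding ex_map_conv
      proof
        fix p assume "p \<in> set L"
        then have "fst p \<in> \<rat>" using L by auto
        then obtain r where "fst p = of_rat r" by (auto elim: Rats_cases)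
        then show "\<exists>x :: rat \<times> nat. p = (of_rat (fst x), snd x)"
          by (intro exI[of _ "(r, snd p)"]) (simp add: prod_eq_iff)
      qed
      then obtain L' :: "(rat \<times> nat) list" where L': "L = map (\<lambda>p. (of_rat (fst p), snd p)) L'" by blast
      then have "\<forall>p\<in>set L'. of_rat (fst p) \<in> {0..<t}" using L by force
      then show ?thesis using elim(1) unfolding L' by blast
    qed
    have zero: "(LINT \<omega>:A|M. ?Z \<omega>) = 0" if "A \<in> sets (filt_left M T N t)" for A
    proof (rule set_integral_zero_generate[OF Z Int_stable_cylinders_and_null[OF D] cylinders_and_null_subset[OF D]])
      show "(LINT \<omega>:A|M. ?Z \<omega>) = 0" if "A \<in> cylinders_and_null ?D" for A
        using that unfolding cylinders_and_null_def
      proof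
        assume "A \<in> null_sets M"
        then have "AE \<omega> in M. indicator A \<omega> *\<^sub>R ?Z \<omega> = 0"
          using AE_not_in[of A M] by auto
        then show ?thesis unfolding set_lebesgue_integral_def by (rule integral_eq_zero_AE)
      qed (use c in auto)
      show "(\<integral>\<omega>. ?Z \<omega> \<partial>M) = 0"
        using c[of "[]"] set_integral_space[OF Z] by (simp add: path_cylinder_def)
      show "A \<in> sigma_sets (space M) (cylinders_and_null ?D)"
        using that filt_left_rational_cylinders[OF t] by auto
    qed
    interpret S: finite_measure_subalgebra M "filt_left M T N t"
      by unfold_locales (rule subalgebra_filt_left)
    have i: "set_integrable M A h" if "integrable M h" "A \<in> sets (filt_left M T N t)" for A and h :: "'a \<Rightarrow> real"
      unfolding set_integrable_def using that subalgebra_filt_left[of t]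
      by (intro integrable_mult_indicator) (auto simp: subalgebra_def)
    have "AE \<omega> in M. real_cond_exp M (filt_left M T N t) (discrete_gradient T N f t) \<omega> = g t \<omega>"
    proof (rule S.real_cond_exp_charact[OF _ elim(2,3)])
      show "(LINT \<omega>:A|M. discrete_gradient T N f t \<omega>) = (LINT \<omega>:A|M. g t \<omega>)"
        if "A \<in> sets (filt_left M T N t)" for A
        using zero[OF that] set_integral_diff(2)[OF i[OF elim(2) that] i[OF elim(3) that]] by simp
      show "g t \<in> borel_measurable (filt_left M T N t)"
        using measurable_compose[OF measurable_section[OF t] g_pred[OF g]] by simp
    qed
    then show ?case using elim(2) by auto
  qed
qed

theorem cond_exp_process_unique:
  assumes Y: "is_cond_exp_process M T N (discrete_gradient T N f) Y"
  shows "AE (t, \<omega>) in prodM. g t \<omega> = Y t \<omega>"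
proof (rule tm.AE_pair_measure)
  have "(\<lambda>x. Y (fst x) (snd x)) \<in> borel_measurable prodM"
    using Y by (simp add: is_cond_exp_process_def case_prod_unfold)
  then show "{x \<in> space prodM. case x of (t, \<omega>) \<Rightarrow> g t \<omega> = Y t \<omega>} \<in> sets prodM"
    using g_meas[OF g] by (simp add: case_prod_unfold)
  have "AE t in time_measure T. (AE \<omega> in M. Y t \<omega> = real_cond_exp M (filt_left M T N t) (discrete_gradient T N f t) \<omega>)"
    "AE t in time_measure T. (AE \<omega> in M. g t \<omega> = real_cond_exp M (filt_left M T N t) (discrete_gradient T N f t) \<omega>)"
    using Y cond_exp_process_op_cov_deriv unfolding is_cond_exp_process_def by auto
  then show "AE t in time_measure T. AE \<omega> in M. case (t, \<omega>) of (t, \<omega>) \<Rightarrow> g t \<omega> = Y t \<omega>"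
  proof eventually_elim
    case (elim t)
    then show ?case by eventually_elim simp
  qed
qed

end
end

theorem proposition4p7:
  fixes M :: "'a measure" and N :: "real \<Rightarrow> 'a \<Rightarrow> nat" and lam T :: real and F :: "'a \<Rightarrow> real"
  assumes "prob_space M" and "complete_measure M"
    and "0 < T" and "0 < lam"
    and "poisson_process M lam T N"
    and "F \<in> L2 M" and "F \<in> borel_measurable (filt M T N T)"
  shows "(\<exists>f. is_config_functional M T N F f) \<and>
    (\<exists>g. is_op_cov_deriv M lam T N F g) \<and>
    (\<forall>f g. is_config_functional M T N F f \<longrightarrow> is_op_cov_deriv M lam T N F g \<longrightarrow>
       is_cond_exp_process M T N (discrete_gradient T N f) g \<and>
       (\<forall>Y. is_cond_exp_process M T N (discrete_gradient T N f) Y \<longrightarrow>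
          (AE (t, \<omega>) in time_measure T \<Otimes>\<^sub>M M. g t \<omega> = Y t \<omega>)) \<and>
       is_predictable_projection M T N (discrete_gradient T N f) g)"
proof -
  interpret poisson_setting M N lam T
    using assms by (intro poisson_setting.intro poisson_setting_axioms.intro)
  have cf: "config_functional M N lam T F f" if "is_config_functional M T N F f" for f
    using that assms(6) by unfold_locales
  obtain f where f: "is_config_functional M T N F f"
    using config_functional_exists[OF assms(7)] by blast
  show ?thesis
    using f config_functional.op_cov_deriv_proj[OF cf[OF f]]
      config_functional.cond_exp_process_op_cov_deriv[OF cf]
      config_functional.cond_exp_process_unique[OF cf]
      config_functional.predictable_projection_op_cov_deriv[OF cf]
    by blast
qed

end
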